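(* Fix an order on $\Phi^+$. With products taken in the specified order, the set $\{E_A1_\lambda\mid A\in\mathbb{N}^{\Phi^+},\ \lambda\in\Lambda(n,d),\ \chi(E_A)\preceq\lambda\}$ is an $\mathcal{A}$-basis of the Borel Schur algebra $\mathbf{S}_{\mathcal{A}}^{\geqslant0}$, and the set $\{1_\lambda F_C\mid C\in\mathbb{N}^{\Phi^+},\ \lambda\in\Lambda(n,d),\ \chi(F_C)\preceq\lambda\}$ is an $\mathcal{A}$-basis of the Borel Schur algebra $\mathbf{S}_{\mathcal{A}}^{\leqslant0}$.
   Context: $n\ge1$, $d\ge0$ are integers, $\mathbb{N}=\{0,1,2,\dots\}$, $v$ is an indeterminate, $\mathcal{A}=\mathbb{Z}[v,v^{-1}]$. $\varepsilon_1,\dots,\varepsilon_n$ is the standard orthonormal basis of $\mathbb{R}^n$; $\Phi^+=\{\varepsilon_i-\varepsilon_j\mid i<j\}$, $\alpha_i=\varepsilon_i-\varepsilon_{i+1}$. $\mathbf{U}=\mathbf{U}(\mathfrak{gl}_n)$ is the $\mathbb{Q}(v)$-algebra with generators $E_i,F_i$ ($1\le i\le n-1$), $K_i^{\pm1}$ ($1\le i\le n$) and relations: $K_iK_j=K_jK_i$, $K_iK_i^{-1}=K_i^{-1}K_i=1$; $E_iF_j-F_jE_i=\delta_{ij}(K_iK_{i+1}^{-1}-K_i^{-1}K_{i+1})/(v-v^{-1})$; $K_iE_j=v^{(\varepsilon_i,\alpha_j)}E_jK_i$, $K_iF_j=v^{-(\varepsilon_i,\alpha_j)}F_jK_i$;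 $E_i^2E_j-(v+v^{-1})E_iE_jE_i+E_jE_i^2=0$ for $|i-j|=1$, $E_iE_j=E_jE_i$ otherwise; and the same two relations with $F$ in place of $E$. $\mathbf{V}$ is the natural module with basis $w_1,\dots,w_n$: $K_iw_j=v^{\delta_{ij}}w_j$, $E_iw_j=\delta_{j,i+1}w_i$, $F_iw_j=\delta_{ij}w_{i+1}$; $\mathbf{U}$ acts on $\mathbf{V}^{\otimes d}$ through a standard comultiplication, e.g. $\Delta(K_i)=K_i\otimes K_i$, $\Delta(E_i)=E_i\otimes K_iK_{i+1}^{-1}+1\otimes E_i$, $\Delta(F_i)=F_i\otimes1+K_i^{-1}K_{i+1}\otimes F_i$. $\mathbf{S}(n,d)$ is the image of $\mathbf{U}\to\operatorname{End}(\mathbf{V}^{\otimes d})$; images of elements of $\mathbf{U}$ are denoted by the same symbols. Notation: $[m]=(v^m-v^{-m})/(v-v^{-1})$, $[m]!=[m]\cdots[1]$, $[0]!=1$; $\begin{bmatrix} K_i \\ t \end{bmatrix}=\prod_{s=1}^t\frac{K_iv^{-s+1}-K_i^{-1}v^{s-1}}{v^s-v^{-s}}$, $\begin{bmatrix} K_i \\ 0 \end{bmatrix}=1$. $\Lambda(n,d)=\{\lambda\in\mathbb{N}^n\mid\sum\lambda_i=d\}$, $1_\lambda=\prod_i\begin{bmatrix} K_i \\ \lambda_i \end{bmatrix}$. Root vectors: for $\alpha=\varepsilon_i-\varepsilon_j$, $i<j$: if $j-i=1$, $X_\alpha=E_i$, $X_{-\alpha}=F_i$; if $j-i>1$, inductively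 $X_\alpha=v^{-1}E_iX_{\alpha-\alpha_i}-X_{\alpha-\alpha_i}E_i$, $X_{-\alpha}=vX_{-\alpha+\alpha_i}F_i-F_iX_{-\alpha+\alpha_i}$. $X_{\pm\alpha}^{(m)}=X_{\pm\alpha}^m/[m]!$. $E_A=\prod_{\alpha\in\Phi^+}X_\alpha^{(A(\alpha))}$, $F_C=\prod_{\alpha\in\Phi^+}X_{-\alpha}^{(C(\alpha))}$. Content: $\chi(E_A)=\sum_{\alpha=\varepsilon_i-\varepsilon_j\in\Phi^+}A(\alpha)\varepsilon_j$ and $\chi(F_C)=\sum_{\alpha=\varepsilon_i-\varepsilon_j\in\Phi^+}C(\alpha)\varepsilon_j$. $\preceq$ is the componentwise order on $\mathbb{N}^n$. $\mathbf{S}_{\mathcal{A}}^+$ (resp. $\mathbf{S}_{\mathcal{A}}^-$) is the $\mathcal{A}$-subalgebra of $\mathbf{S}(n,d)$ generated by the $X_\alpha^{(m)}$ (resp. $X_{-\alpha}^{(m)}$), $\alpha\in\Phi^+$, $m\in\mathbb{N}$; $\mathbf{S}_{\mathcal{A}}^0$ is the $\mathcal{A}$-subalgebra generated by the $K_i^{\pm1}$ and $\begin{bmatrix} K_i \\ m \end{bmatrix}$. The Borel Schur algebras are $\mathbf{S}_{\mathcal{A}}^{\geqslant0}=\mathbf{S}_{\mathcal{A}}^0\mathbf{S}_{\mathcal{A}}^+$ and $\mathbf{S}_{\mathcal{A}}^{\leqslant0}=\mathbf{S}_{\mathcal{A}}^0\mathbf{S}_{\mathcal{A}}^-$ (the $\mathcal{A}$-spans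 of products). *)

theory Defs
  imports
    "HOL-Library.Poly_Mapping"
    "HOL-Computational_Algebra.Fraction_Field"
    "HOL-Computational_Algebra.Polynomial"
    "HOL-Algebra.QuotRing"
    "HOL-Algebra.Module"
begin

section \<open>The field \<open>\<rat>(v)\<close> and the ring \<open>\<A> = \<int>[v, v\<^sup>-\<^sup>1]\<close>\<close>

type_synonym qv = "rat poly fract"

definition v :: qv where
  "v = Fraction_Field.Fract [:0, 1:] 1"

definition Laurent :: "qv set" where
  "Laurent = {v powi k * Fraction_Field.Fract (map_poly of_int p) 1 | (k::int) (p::int poly). True}"

definition qint :: "nat \<Rightarrow> qv" where
  "qint m = (v ^ m - inverse v ^ m) / (v - inverse v)"

definition qfact :: "nat \<Rightarrow> qv" where
  "qfact m = (\<Prod>k=1..m. qint k)"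


section \<open>Free algebras over \<open>\<rat>(v)\<close>\<close>

text \<open>
  The free algebra on \<open>'a\<close> is the monoid algebra of the free monoid on \<open>'a\<close>.
  The wrapper type makes the free monoid, written additively, an instance of
  \<^class>\<open>monoid_add\<close>, so that the product on \<^typ>\<open>'b::monoid_add \<Rightarrow>\<^sub>0 qv\<close> is the
  convolution (concatenation) product.
\<close>

datatype 'a word = Word (letters: "'a list")

instantiation word :: (type) monoid_add
begin
definition zero_word :: "'a word" where "zero_word = Word []"
definition plus_word :: "'a word \<Rightarrow> 'a word \<Rightarrow> 'a word"
  where "plus_word x y = Word (letters x @ letters y)"
instance by standard (simp_all add: zero_word_def plus_word_def)
end

type_synonym 'a free = "'a word \<Rightarrow>\<^sub>0 qv"

definition cst :: "qv \<Rightarrow> 'a free" where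
  "cst c = Poly_Mapping.single 0 c"

definition gen :: "'a \<Rightarrow> 'a free" where
  "gen a = Poly_Mapping.single (Word [a]) 1"

definition monomial :: "'a list \<Rightarrow> 'a free" where
  "monomial w = Poly_Mapping.single (Word w) 1"

definition lin_ext :: "('a list \<Rightarrow> 'b free) \<Rightarrow> 'a free \<Rightarrow> 'b free" where
  "lin_ext f x = (\<Sum>w\<in>Poly_Mapping.keys x. cst (Poly_Mapping.lookup x w) * f (letters w))"


section \<open>The quantized enveloping algebra of \<open>gl\<^sub>n\<close>\<close>

text \<open>Generators are indexed by all naturals; \<open>ugens n\<close> selects those of \<open>\<^bold>U(gl\<^sub>n)\<close>.\<close>

datatype ugen = GE nat | GF nat | GK nat | GKinv nat

definition ugens :: "nat \<Rightarrow> ugen set" where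
  "ugens n = GE ` {1..<n} \<union> GF ` {1..<n} \<union> GK ` {1..n} \<union> GKinv ` {1..n}"

abbreviation UE :: "nat \<Rightarrow> ugen free" where "UE i \<equiv> gen (GE i)"
abbreviation UF :: "nat \<Rightarrow> ugen free" where "UF i \<equiv> gen (GF i)"
abbreviation UK :: "nat \<Rightarrow> ugen free" where "UK i \<equiv> gen (GK i)"
abbreviation UKinv :: "nat \<Rightarrow> ugen free" where "UKinv i \<equiv> gen (GKinv i)"

text \<open>\<open>eps_alpha i j\<close> is the inner product \<open>(\<epsilon>\<^sub>i, \<alpha>\<^sub>j)\<close> with \<open>\<alpha>\<^sub>j = \<epsilon>\<^sub>j - \<epsilon>\<^sub>j\<^sub>+\<^sub>1\<close>.\<close>

definition eps_alpha :: "nat \<Rightarrow> nat \<Rightarrow> int" where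
  "eps_alpha i j = (if i = j then 1 else 0) - (if i = j + 1 then 1 else 0)"

definition adjacent :: "nat \<Rightarrow> nat \<Rightarrow> bool" where
  "adjacent i j \<longleftrightarrow> i = j + 1 \<or> j = i + 1"

text \<open>A relation \<open>x = y\<close> is recorded as the element \<open>x - y\<close> of the free algebra.\<close>

definition urels :: "nat \<Rightarrow> ugen free set" where
  "urels n =
     {UK i * UK j - UK j * UK i | i j. i \<in> {1..n} \<and> j \<in> {1..n}}
   \<union> {UK i * UKinv i - 1 | i. i \<in> {1..n}}
   \<union> {UKinv i * UK i - 1 | i. i \<in> {1..n}}
   \<union> {UE i * UF j - UF j * UE i
        - (if i = j then cst (1 / (v - inverse v)) * (UK i * UKinv (i+1) - UKinv i * UK (i+1)) else 0)
      | i j. i \<in> {1..<n} \<and> j \<in> {1..<n}}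
   \<union> {UK i * UE j - cst (v powi eps_alpha i j) * (UE j * UK i) | i j. i \<in> {1..n} \<and> j \<in> {1..<n}}
   \<union> {UK i * UF j - cst (v powi (- eps_alpha i j)) * (UF j * UK i) | i j. i \<in> {1..n} \<and> j \<in> {1..<n}}
   \<union> {UE i * UE i * UE j - cst (v + inverse v) * (UE i * UE j * UE i) + UE j * UE i * UE i
      | i j. i \<in> {1..<n} \<and> j \<in> {1..<n} \<and> adjacent i j}
   \<union> {UE i * UE j - UE j * UE i | i j. i \<in> {1..<n} \<and> j \<in> {1..<n} \<and> \<not> adjacent i j}
   \<union> {UF i * UF i * UF j - cst (v + inverse v) * (UF i * UF j * UF i) + UF j * UF i * UF i
      | i j. i \<in> {1..<n} \<and> j \<in> {1..<n} \<and> adjacent i j}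
   \<union> {UF i * UF j - UF j * UF i | i j. i \<in> {1..<n} \<and> j \<in> {1..<n} \<and> \<not> adjacent i j}"

definition Ufree :: "nat \<Rightarrow> ugen free ring" where
  "Ufree n = \<lparr>carrier = {x. \<forall>w\<in>Poly_Mapping.keys x. set (letters w) \<subseteq> ugens n},
              mult = (*), one = 1, zero = 0, add = (+)\<rparr>"

definition Uideal :: "nat \<Rightarrow> ugen free set" where
  "Uideal n = genideal (Ufree n) (urels n)"

definition U :: "nat \<Rightarrow> ugen free set ring" where
  "U n = Ufree n Quot Uideal n"

definition Uclass :: "nat \<Rightarrow> ugen free \<Rightarrow> ugen free set" where
  "Uclass n x = Uideal n +>\<^bsub>Ufree n\<^esub> x"


section \<open>Tensor space\<close>

text \<open>
  The tensor algebra of a space with basis \<open>w\<^sub>1, w\<^sub>2, \<dots>\<close> is the free algebra on the naturals,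
  with \<open>w\<^sub>j = gen j\<close> and \<open>x \<otimes> y = x * y\<close>. Inside it, \<open>\<^bold>V\<^sup>\<otimes>\<^sup>d\<close> is the span of the
  monomials of length \<open>d\<close> in \<open>w\<^sub>1, \<dots>, w\<^sub>n\<close>.
\<close>

definition tensor :: "nat \<Rightarrow> nat \<Rightarrow> nat free set" where
  "tensor n d = {t. \<forall>w\<in>Poly_Mapping.keys t. length (letters w) = d \<and> set (letters w) \<subseteq> {1..n}}"

text \<open>The natural module.\<close>

definition natK :: "nat \<Rightarrow> nat \<Rightarrow> nat free" where
  "natK i j = cst (if i = j then v else 1) * gen j"

definition natKinv :: "nat \<Rightarrow> nat \<Rightarrow> nat free" where
  "natKinv i j = cst (if i = j then inverse v else 1) * gen j"

definition natE :: "nat \<Rightarrow> nat \<Rightarrow> nat free" where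
  "natE i j = (if j = i + 1 then gen i else 0)"

definition natF :: "nat \<Rightarrow> nat \<Rightarrow> nat free" where
  "natF i j = (if i = j then gen (i + 1) else 0)"

text \<open>
  The action on tensors, obtained by iterating the comultiplication
  \<open>\<Delta>(K\<^sub>i) = K\<^sub>i \<otimes> K\<^sub>i\<close>, \<open>\<Delta>(E\<^sub>i) = E\<^sub>i \<otimes> K\<^sub>i K\<^sub>i\<^sub>+\<^sub>1\<^sup>-\<^sup>1 + 1 \<otimes> E\<^sub>i\<close>,
  \<open>\<Delta>(F\<^sub>i) = F\<^sub>i \<otimes> 1 + K\<^sub>i\<^sup>-\<^sup>1 K\<^sub>i\<^sub>+\<^sub>1 \<otimes> F\<^sub>i\<close>, split as \<open>\<^bold>V \<otimes> \<^bold>V\<^sup>\<otimes>\<^sup>(\<^sup>d\<^sup>-\<^sup>1\<^sup>)\<close>. On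
  \<open>\<^bold>V\<^sup>\<otimes>\<^sup>0\<close> the action is through the counit.
\<close>

primrec wordK :: "nat \<Rightarrow> nat list \<Rightarrow> nat free" where
  "wordK i [] = 1"
| "wordK i (a # w) = natK i a * wordK i w"

definition opK :: "nat \<Rightarrow> nat free \<Rightarrow> nat free" where
  "opK i = lin_ext (wordK i)"

primrec wordKinv :: "nat \<Rightarrow> nat list \<Rightarrow> nat free" where
  "wordKinv i [] = 1"
| "wordKinv i (a # w) = natKinv i a * wordKinv i w"

definition opKinv :: "nat \<Rightarrow> nat free \<Rightarrow> nat free" where
  "opKinv i = lin_ext (wordKinv i)"

primrec wordE :: "nat \<Rightarrow> nat list \<Rightarrow> nat free" where
  "wordE i [] = 0"
| "wordE i (a # w) = natE i a * opK i (opKinv (i + 1) (monomial w)) + gen a * wordE i w"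

definition opE :: "nat \<Rightarrow> nat free \<Rightarrow> nat free" where
  "opE i = lin_ext (wordE i)"

primrec wordF :: "nat \<Rightarrow> nat list \<Rightarrow> nat free" where
  "wordF i [] = 0"
| "wordF i (a # w) = natF i a * monomial w + opKinv i (opK (i + 1) (gen a)) * wordF i w"

definition opF :: "nat \<Rightarrow> nat free \<Rightarrow> nat free" where
  "opF i = lin_ext (wordF i)"

fun gen_op :: "ugen \<Rightarrow> nat free \<Rightarrow> nat free" where
  "gen_op (GE i) = opE i"
| "gen_op (GF i) = opF i"
| "gen_op (GK i) = opK i"
| "gen_op (GKinv i) = opKinv i"

primrec word_op :: "ugen list \<Rightarrow> nat free \<Rightarrow> nat free" where
  "word_op [] t = t"
| "word_op (g # gs) t = gen_op g (word_op gs t)"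

text \<open>The \<open>\<rat>(v)\<close>-algebra of endomorphisms of \<open>\<^bold>V\<^sup>\<otimes>\<^sup>d\<close>.\<close>

definition End_tensor :: "nat \<Rightarrow> nat \<Rightarrow> (qv, nat free \<Rightarrow> nat free) module" where
  "End_tensor n d =
    \<lparr>carrier = {f \<in> tensor n d \<rightarrow>\<^sub>E tensor n d.
        (\<forall>s\<in>tensor n d. \<forall>t\<in>tensor n d. f (s + t) = f s + f t) \<and>
        (\<forall>c. \<forall>t\<in>tensor n d. f (cst c * t) = cst c * f t)},
     mult = compose (tensor n d), one = (\<lambda>t\<in>tensor n d. t),
     zero = (\<lambda>t\<in>tensor n d. 0), add = (\<lambda>f g. \<lambda>t\<in>tensor n d. f t + g t),
     smult = (\<lambda>c f. \<lambda>t\<in>tensor n d. cst c * f t)\<rparr>"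

text \<open>
  The action of the free algebra, and the representation \<open>\<rho> : \<^bold>U \<rightarrow> End(\<^bold>V\<^sup>\<otimes>\<^sup>d)\<close> that it induces on
  the quotient. It is well defined by \<open>rho_Uclass\<close> and multiplicative by \<open>rho_hom\<close>, both below.
\<close>

definition free_act :: "nat \<Rightarrow> nat \<Rightarrow> ugen free \<Rightarrow> (nat free \<Rightarrow> nat free)" where
  "free_act n d x =
     (\<lambda>t\<in>tensor n d. \<Sum>w\<in>Poly_Mapping.keys x. cst (Poly_Mapping.lookup x w) * word_op (letters w) t)"

definition rho :: "nat \<Rightarrow> nat \<Rightarrow> ugen free set \<Rightarrow> (nat free \<Rightarrow> nat free)" where
  "rho n d X = the_elem (free_act n d ` X)"

definition Schur :: "nat \<Rightarrow> nat \<Rightarrow> (nat free \<Rightarrow> nat free) set" where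
  "Schur n d = rho n d ` carrier (U n)"

text \<open>The element of \<open>\<^bold>S(n,d)\<close> denoted by the same symbol as the element of \<open>\<^bold>U\<close> represented by \<open>x\<close>.\<close>

definition Simg :: "nat \<Rightarrow> nat \<Rightarrow> ugen free \<Rightarrow> (nat free \<Rightarrow> nat free)" where
  "Simg n d x = rho n d (Uclass n x)"


section \<open>Root vectors, idempotents and contents\<close>

text \<open>The positive root \<open>\<epsilon>\<^sub>i - \<epsilon>\<^sub>j\<close> is represented by the pair \<open>(i, j)\<close>.\<close>

definition Phi_pos :: "nat \<Rightarrow> (nat \<times> nat) set" where
  "Phi_pos n = {(i, j). 1 \<le> i \<and> i < j \<and> j \<le> n}"

text \<open>For \<open>\<alpha> = \<epsilon>\<^sub>i - \<epsilon>\<^sub>j\<close> one has \<open>\<alpha> - \<alpha>\<^sub>i = \<epsilon>\<^sub>i\<^sub>+\<^sub>1 - \<epsilon>\<^sub>j\<close>.\<close>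

function Xpos :: "nat \<Rightarrow> nat \<Rightarrow> ugen free" where
  "Xpos i j = (if j \<le> i + 1 then UE i
     else cst (inverse v) * (UE i * Xpos (i + 1) j) - Xpos (i + 1) j * UE i)"
  by auto
termination by (relation "measure (\<lambda>(i, j). j - i)") auto

function Xneg :: "nat \<Rightarrow> nat \<Rightarrow> ugen free" where
  "Xneg i j = (if j \<le> i + 1 then UF i
     else cst v * (Xneg (i + 1) j * UF i) - UF i * Xneg (i + 1) j)"
  by auto
termination by (relation "measure (\<lambda>(i, j). j - i)") auto

declare Xpos.simps [simp del] Xneg.simps [simp del]

definition Xpos_div :: "nat \<times> nat \<Rightarrow> nat \<Rightarrow> ugen free" where
  "Xpos_div \<alpha> m = cst (1 / qfact m) * Xpos (fst \<alpha>) (snd \<alpha>) ^ m"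

definition Xneg_div :: "nat \<times> nat \<Rightarrow> nat \<Rightarrow> ugen free" where
  "Xneg_div \<alpha> m = cst (1 / qfact m) * Xneg (fst \<alpha>) (snd \<alpha>) ^ m"

text \<open>The list \<open>\<beta>s\<close> enumerates the positive roots in the order chosen for the products.\<close>

definition E_mon :: "(nat \<times> nat) list \<Rightarrow> (nat \<times> nat \<Rightarrow> nat) \<Rightarrow> ugen free" where
  "E_mon \<beta>s A = prod_list (map (\<lambda>\<alpha>. Xpos_div \<alpha> (A \<alpha>)) \<beta>s)"

definition F_mon :: "(nat \<times> nat) list \<Rightarrow> (nat \<times> nat \<Rightarrow> nat) \<Rightarrow> ugen free" where
  "F_mon \<beta>s C = prod_list (map (\<lambda>\<alpha>. Xneg_div \<alpha> (C \<alpha>)) \<beta>s)"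

text \<open>
  \<open>Kbinom i t\<close> represents the product of the \<open>(K\<^sub>i v\<^sup>-\<^sup>s\<^sup>+\<^sup>1 - K\<^sub>i\<^sup>-\<^sup>1 v\<^sup>s\<^sup>-\<^sup>1) / (v\<^sup>s - v\<^sup>-\<^sup>s)\<close> for
  \<open>1 \<le> s \<le> t\<close>. These factors, like those of \<open>one_wt\<close>, commute in \<open>\<^bold>U\<close> (not in the free algebra),
  hence any order may be chosen.
\<close>

definition Kbinom :: "nat \<Rightarrow> nat \<Rightarrow> ugen free" where
  "Kbinom i t = prod_list (map (\<lambda>s. cst (1 / (v ^ s - inverse v ^ s)) *
       (cst (v powi (1 - int s)) * UK i - cst (v powi (int s - 1)) * UKinv i)) [1..<t+1])"

definition Lambda :: "nat \<Rightarrow> nat \<Rightarrow> (nat \<Rightarrow> nat) set" where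
  "Lambda n d = {\<mu> \<in> {1..n} \<rightarrow>\<^sub>E UNIV. (\<Sum>i=1..n. \<mu> i) = d}"

definition one_wt :: "nat \<Rightarrow> (nat \<Rightarrow> nat) \<Rightarrow> ugen free" where
  "one_wt n \<mu> = prod_list (map (\<lambda>i. Kbinom i (\<mu> i)) [1..<n+1])"

text \<open>
  The \<open>k\<close>-th coordinate of \<open>\<Sum> A(\<epsilon>\<^sub>i - \<epsilon>\<^sub>j) \<epsilon>\<^sub>j\<close>, which is both \<open>\<chi>(E\<^sub>A)\<close> and \<open>\<chi>(F\<^sub>A)\<close>.
\<close>

definition content :: "nat \<Rightarrow> (nat \<times> nat \<Rightarrow> nat) \<Rightarrow> nat \<Rightarrow> nat" where
  "content n A k = (\<Sum>(i, j)\<in>Phi_pos n. if j = k then A (i, j) else 0)"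

definition wt_le :: "nat \<Rightarrow> (nat \<Rightarrow> nat) \<Rightarrow> (nat \<Rightarrow> nat) \<Rightarrow> bool" where
  "wt_le n \<nu> \<mu> \<longleftrightarrow> (\<forall>k\<in>{1..n}. \<nu> k \<le> \<mu> k)"

definition Borel_index :: "nat \<Rightarrow> nat \<Rightarrow> ((nat \<times> nat \<Rightarrow> nat) \<times> (nat \<Rightarrow> nat)) set" where
  "Borel_index n d = {(A, \<mu>). A \<in> Phi_pos n \<rightarrow>\<^sub>E UNIV \<and> \<mu> \<in> Lambda n d \<and> wt_le n (content n A) \<mu>}"


section \<open>\<open>\<A>\<close>-submodules and \<open>\<A>\<close>-subalgebras of a \<open>\<rat>(v)\<close>-algebra\<close>

definition A_comb :: "(qv, 'b) module \<Rightarrow> 'i set \<Rightarrow> ('i \<Rightarrow> qv) \<Rightarrow> ('i \<Rightarrow> 'b) \<Rightarrow> 'b" where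
  "A_comb M J c b = finsum M (\<lambda>i. c i \<odot>\<^bsub>M\<^esub> b i) J"

definition A_span :: "(qv, 'b) module \<Rightarrow> 'b set \<Rightarrow> 'b set" where
  "A_span M X = {A_comb M J c (\<lambda>x. x) | J c. finite J \<and> J \<subseteq> X \<and> c \<in> J \<rightarrow> Laurent}"

definition A_independent :: "(qv, 'b) module \<Rightarrow> 'i set \<Rightarrow> ('i \<Rightarrow> 'b) \<Rightarrow> bool" where
  "A_independent M I b \<longleftrightarrow>
     (\<forall>J c. finite J \<and> J \<subseteq> I \<and> c \<in> J \<rightarrow> Laurent \<and> A_comb M J c b = \<zero>\<^bsub>M\<^esub> \<longrightarrow> (\<forall>i\<in>J. c i = 0))"

text \<open>The family \<open>(b i)\<^sub>i\<^sub>\<in>\<^sub>I\<close> is an \<open>\<A>\<close>-basis of \<open>N\<close>; in particular \<open>b\<close> is injective on \<open>I\<close>.\<close>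

definition A_basis :: "(qv, 'b) module \<Rightarrow> 'i set \<Rightarrow> ('i \<Rightarrow> 'b) \<Rightarrow> 'b set \<Rightarrow> bool" where
  "A_basis M I b N \<longleftrightarrow> b \<in> I \<rightarrow> carrier M \<and> A_independent M I b \<and> A_span M (b ` I) = N"

definition A_subalgebra :: "(qv, 'b) module \<Rightarrow> 'b set \<Rightarrow> bool" where
  "A_subalgebra M B \<longleftrightarrow> B \<subseteq> carrier M \<and> \<one>\<^bsub>M\<^esub> \<in> B \<and>
     (\<forall>x\<in>B. \<forall>y\<in>B. x \<oplus>\<^bsub>M\<^esub> y \<in> B \<and> x \<otimes>\<^bsub>M\<^esub> y \<in> B) \<and>
     (\<forall>c\<in>Laurent. \<forall>x\<in>B. c \<odot>\<^bsub>M\<^esub> x \<in> B)"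

definition Schur_A_generated :: "nat \<Rightarrow> nat \<Rightarrow> (nat free \<Rightarrow> nat free) set \<Rightarrow> (nat free \<Rightarrow> nat free) set" where
  "Schur_A_generated n d G = \<Inter>{B. A_subalgebra (End_tensor n d) B \<and> B \<subseteq> Schur n d \<and> G \<subseteq> B}"

definition SA_plus :: "nat \<Rightarrow> nat \<Rightarrow> (nat free \<Rightarrow> nat free) set" where
  "SA_plus n d = Schur_A_generated n d {Simg n d (Xpos_div \<alpha> m) | \<alpha> m. \<alpha> \<in> Phi_pos n}"

definition SA_minus :: "nat \<Rightarrow> nat \<Rightarrow> (nat free \<Rightarrow> nat free) set" where
  "SA_minus n d = Schur_A_generated n d {Simg n d (Xneg_div \<alpha> m) | \<alpha> m. \<alpha> \<in> Phi_pos n}"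

definition SA_zero :: "nat \<Rightarrow> nat \<Rightarrow> (nat free \<Rightarrow> nat free) set" where
  "SA_zero n d = Schur_A_generated n d
     ({Simg n d (UK i) | i. i \<in> {1..n}} \<union> {Simg n d (UKinv i) | i. i \<in> {1..n}}
      \<union> {Simg n d (Kbinom i m) | i m. i \<in> {1..n}})"

definition Borel_ge :: "nat \<Rightarrow> nat \<Rightarrow> (nat free \<Rightarrow> nat free) set" where
  "Borel_ge n d = A_span (End_tensor n d)
     {x \<otimes>\<^bsub>End_tensor n d\<^esub> y | x y. x \<in> SA_zero n d \<and> y \<in> SA_plus n d}"

definition Borel_le :: "nat \<Rightarrow> nat \<Rightarrow> (nat free \<Rightarrow> nat free) set" where
  "Borel_le n d = A_span (End_tensor n d)
     {x \<otimes>\<^bsub>End_tensor n d\<^esub> y | x y. x \<in> SA_zero n d \<and> y \<in> SA_minus n d}"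


section \<open>The representation is well defined\<close>

text \<open>
  The operators satisfy the defining relations of \<open>\<^bold>U\<close>, so that the action of the free algebra
  factors through \<open>\<rho>\<close>, and \<open>\<rho>\<close> is a ring homomorphism.
\<close>


lemma cst_simps [simp]: "cst 0 = 0" "cst 1 = 1"
  by (simp_all add: cst_def)

lemma cst_add: "cst (a + b) = cst a + cst b"
  and cst_diff: "cst (a - b) = cst a - cst b"
  and cst_minus: "cst (- a) = - cst a"
  and cst_mult: "cst (a * b) = cst a * cst b"
  by (simp_all add: cst_def single_add single_diff single_uminus mult_single)

lemma cst_sum: "cst (\<Sum>i\<in>I. f i) = (\<Sum>i\<in>I. cst (f i))"
  by (induct I rule: infinite_finite_induct) (simp_all add: cst_add)

lemma lookup_cst_mult: "Poly_Mapping.lookup (cst c * x) w = c * Poly_Mapping.lookup x w"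
  unfolding cst_def mult_map_scale_conv_mult [symmetric]
  by (simp add: Poly_Mapping.map.rep_eq when_def)

lemma free_expand: "x = (\<Sum>w\<in>Poly_Mapping.keys x. cst (Poly_Mapping.lookup x w) * monomial (letters w))"
proof (rule poly_mapping_eqI)
  fix u
  have "Poly_Mapping.lookup (\<Sum>w\<in>Poly_Mapping.keys x. cst (Poly_Mapping.lookup x w) * monomial (letters w)) u
      = (\<Sum>w\<in>Poly_Mapping.keys x. if w = u then Poly_Mapping.lookup x w else 0)"
    unfolding lookup_sum
    by (rule sum.cong) (auto simp: lookup_cst_mult monomial_def lookup_single when_def)
  then show "Poly_Mapping.lookup x u = Poly_Mapping.lookup (\<Sum>w\<in>Poly_Mapping.keys x. cst (Poly_Mapping.lookup x w) * monomial (letters w)) u"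
    by (auto simp: sum.delta in_keys_iff)
qed

lemma single_cst: "Poly_Mapping.single w c = cst c * monomial (letters w)"
  by (simp add: cst_def monomial_def mult_single plus_word_def zero_word_def)

lemma cst_central: "x * cst c = cst c * x"
proof -
  have m: "monomial w * cst c = cst c * monomial w" for w :: "'a list"
    by (simp add: cst_def monomial_def mult_single)
  show ?thesis
    by (subst (1 2) free_expand [of x])
       (simp add: sum_distrib_left sum_distrib_right mult.assoc m flip: cst_mult,
        simp add: mult.commute flip: mult.assoc cst_mult)
qed

lemma cst_left_commute: "x * (cst c * y) = cst c * (x * y)"
  by (metis cst_central mult.assoc)

lemma monomial_Nil: "monomial [] = 1"
  and monomial_Cons: "monomial (a # w) = gen a * monomial w"
  by (simp_all add: monomial_def gen_def mult_single plus_word_def flip: zero_word_def)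

lemma keys_cst: "Poly_Mapping.keys (cst c * x) \<subseteq> Poly_Mapping.keys x"
  by (auto simp: in_keys_iff lookup_cst_mult)

definition lin :: "('a free \<Rightarrow> 'b free) \<Rightarrow> bool" where
  "lin f \<longleftrightarrow> (\<forall>x y. f (x + y) = f x + f y) \<and> (\<forall>c x. f (cst c * x) = cst c * f x)"

lemma linD: assumes "lin f"
  shows "f (x + y) = f x + f y" "f (cst c * x) = cst c * f x" "f 0 = 0"
    "f (- x) = - f x" "f (x - y) = f x - f y" "f (\<Sum>i\<in>I. g i) = (\<Sum>i\<in>I. f (g i))"
proof -
  show a: "f (x + y) = f x + f y" for x y using assms by (simp add: lin_def)
  show s: "f (cst c * x) = cst c * f x" for x c using assms by (simp add: lin_def)
  show z: "f 0 = 0" using s [of 0 0] by simp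
  show m: "f (- x) = - f x" for x using s [of "- 1" x] by (simp add: cst_minus)
  show "f (x - y) = f x - f y" using a [of x "- y"] m by simp
  show "f (\<Sum>i\<in>I. g i) = (\<Sum>i\<in>I. f (g i))"
    by (induct I rule: infinite_finite_induct) (simp_all add: a z)
qed

lemma lin_lin_ext: "lin (lin_ext f)"
  unfolding lin_def
proof safe
  fix x y
  show "lin_ext f (x + y) = lin_ext f x + lin_ext f y"
    unfolding lin_ext_def by (rule setsum_keys_plus_distrib) (simp_all add: cst_add algebra_simps)
next
  fix c x
  show "lin_ext f (cst c * x) = cst c * lin_ext f x"
    unfolding lin_ext_def sum_distrib_left
    by (rule sum.mono_neutral_cong_left)
       (auto simp: in_keys_iff lookup_cst_mult cst_mult mult.assoc)
qed

lemma lin_ext_monomial [simp]: "lin_ext f (monomial w) = f w"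
  by (simp add: lin_ext_def monomial_def)

lemma lin_eqI:
  assumes "lin f" "lin g" "f 1 = g 1" "\<And>a t. f t = g t \<Longrightarrow> f (gen a * t) = g (gen a * t)"
  shows "f t = g t"
proof -
  have m: "f (monomial w) = g (monomial w)" for w
    by (induct w) (simp_all add: monomial_Nil monomial_Cons assms)
  show ?thesis
    by (subst (1 2) free_expand) (simp add: linD [OF assms(1)] linD [OF assms(2)] m)
qed

lemma lin_ext_eqI: "lin f \<Longrightarrow> lin g \<Longrightarrow> (\<And>w. f (monomial w) = g (monomial w)) \<Longrightarrow> f t = g t"
  by (subst (1 2) free_expand) (simp add: linD)

lemma lin_id: "lin (\<lambda>x. x)"
  and lin_zero: "lin (\<lambda>x. 0)"
  and lin_comp: "lin f \<Longrightarrow> lin g \<Longrightarrow> lin (\<lambda>x. f (g x))"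
  and lin_add: "lin f \<Longrightarrow> lin g \<Longrightarrow> lin (\<lambda>x. f x + g x)"
  and lin_diff: "lin f \<Longrightarrow> lin g \<Longrightarrow> lin (\<lambda>x. f x - g x)"
  and lin_cmult: "lin f \<Longrightarrow> lin (\<lambda>x. y * f x)"
  by (auto simp: lin_def algebra_simps cst_left_commute)

lemma lin_op: "lin (opK i)" "lin (opKinv i)" "lin (opE i)" "lin (opF i)"
  by (simp_all add: opK_def opKinv_def opE_def opF_def lin_lin_ext)

lemma lin_if: "lin f \<Longrightarrow> lin g \<Longrightarrow> lin (\<lambda>x. if b then f x else g x)"
  by (cases b) simp_all

lemmas lins = lin_id lin_zero lin_if lin_add lin_diff lin_cmult
  lin_op lin_comp [OF lin_op(1)] lin_comp [OF lin_op(2)] lin_comp [OF lin_op(3)] lin_comp [OF lin_op(4)]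

lemmas op_lin = linD [OF lin_op(1)] linD [OF lin_op(2)] linD [OF lin_op(3)] linD [OF lin_op(4)]

lemma lin_ext_one [simp]: "lin_ext f 1 = f []"
  by (metis lin_ext_monomial monomial_Nil)

lemma op_one [simp]: "opK i 1 = 1" "opKinv i 1 = 1" "opE i 1 = 0" "opF i 1 = 0"
  by (simp_all add: opK_def opKinv_def opE_def opF_def)

lemma opK_gen: "opK i (gen a * t) = cst (if i = a then v else 1) * (gen a * opK i t)"
  by (rule lin_ext_eqI [where t = t], intro lins, intro lins) (simp add: opK_def natK_def mult.assoc flip: monomial_Cons)

lemma opKinv_gen: "opKinv i (gen a * t) = cst (if i = a then inverse v else 1) * (gen a * opKinv i t)"
  by (rule lin_ext_eqI [where t = t], intro lins, intro lins) (simp add: opKinv_def natKinv_def mult.assoc flip: monomial_Cons)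

lemma opE_gen: "opE i (gen a * t) = (if a = i + 1 then gen i * opK i (opKinv (i+1) t) else 0) + gen a * opE i t"
proof (rule lin_ext_eqI [where t = t])
  show "lin (\<lambda>t. opE i (gen a * t))" by (auto intro!: lins)
  show "lin (\<lambda>t. (if a = i + 1 then gen i * opK i (opKinv (i+1) t) else 0) + gen a * opE i t)"
    by (auto intro!: lins)
qed (simp add: opE_def natE_def flip: monomial_Cons)

lemma opF_gen: "opF i (gen a * t) = (if i = a then gen (i+1) * t else 0)
   + cst (if i = a then inverse v else if a = i + 1 then v else 1) * (gen a * opF i t)"
proof (rule lin_ext_eqI [where t = t])
  show "lin (\<lambda>t. opF i (gen a * t))" by (auto intro!: lins)
  show "lin (\<lambda>t. (if i = a then gen (i+1) * t else 0)
   + cst (if i = a then inverse v else if a = i + 1 then v else 1) * (gen a * opF i t))"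
    by (auto intro!: lins)
  fix w
  have "opKinv i (opK (i+1) (gen a)) = cst (if i = a then inverse v else if a = i + 1 then v else 1) * gen a"
    using opK_gen [of "i+1" a 1] opKinv_gen [of i a 1] by (simp add: op_lin)
  then show "opF i (gen a * monomial w) = (if i = a then gen (i+1) * monomial w else 0)
   + cst (if i = a then inverse v else if a = i + 1 then v else 1) * (gen a * opF i (monomial w))"
    by (simp add: opF_def natF_def mult.assoc flip: monomial_Cons)
qed

lemma v_nz [simp]: "v \<noteq> 0"
  by (simp add: v_def Zero_fract_def eq_fract)

lemma v_nonunit: "v * v \<noteq> 1" "v - inverse v \<noteq> 0"
proof -
  show *: "v * v \<noteq> 1" by (simp add: v_def One_fract_def eq_fract one_pCons)
  then show "v - inverse v \<noteq> 0" by (metis diff_eq_diff_eq diff_self right_inverse v_nz)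
qed

lemma vv: "v * inverse v = 1" "inverse v * v = 1" "v * (inverse v * x) = x" "inverse v * (v * x) = x"
    "v * v * inverse v = v" "inverse v * inverse v * v = inverse v"
  by (simp_all add: mult.assoc)

lemma gen_cst: "gen a * (cst c * y) = cst c * (gen a * y)"
  by (rule cst_left_commute)

lemma cst_cst: "cst c * (cst d * y) = cst (c * d) * y"
  by (simp add: cst_mult mult.assoc)

lemmas push = op_lin opK_gen opKinv_gen opE_gen opF_gen gen_cst cst_cst distrib_left right_diff_distrib

lemma opK_commute: "opK i (opK j t) = opK j (opK i t)"
  by (rule lin_eqI [where t = t]) (auto intro!: lins simp: push mult.commute)

lemma opKinv_commute: "opKinv i (opKinv j t) = opKinv j (opKinv i t)"
  by (rule lin_eqI [where t = t]) (auto intro!: lins simp: push mult.commute)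

lemma opK_opKinv_commute: "opK i (opKinv j t) = opKinv j (opK i t)"
  by (rule lin_eqI [where t = t]) (auto intro!: lins simp: push mult.commute)

lemma opK_opKinv [simp]: "opK i (opKinv i t) = t"
  by (rule lin_eqI [where t = t]) (auto intro!: lins simp: push)

lemma opKinv_opK [simp]: "opKinv i (opK i t) = t"
  by (simp flip: opK_opKinv_commute)

lemma opK_opE: "opK i (opE j t) = cst (v powi eps_alpha i j) * opE j (opK i t)"
proof (rule lin_eqI [where t = t])
  fix a t
  assume IH: "opK i (opE j t) = cst (v powi eps_alpha i j) * opE j (opK i t)"
  show "opK i (opE j (gen a * t)) = cst (v powi eps_alpha i j) * opE j (opK i (gen a * t))"
    by (auto simp: push IH eps_alpha_def opK_commute opK_opKinv_commute field_simps)
qed (auto intro!: lins simp: op_lin)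

lemma opK_opF: "opK i (opF j t) = cst (v powi (- eps_alpha i j)) * opF j (opK i t)"
proof (rule lin_eqI [where t = t])
  fix a t
  assume IH: "opK i (opF j t) = cst (v powi (- eps_alpha i j)) * opF j (opK i t)"
  show "opK i (opF j (gen a * t)) = cst (v powi (- eps_alpha i j)) * opF j (opK i (gen a * t))"
    by (auto simp: push IH eps_alpha_def field_simps)
qed (auto intro!: lins simp: op_lin)

lemma opKinv_opE: "opKinv i (opE j t) = cst (v powi (- eps_alpha i j)) * opE j (opKinv i t)"
proof -
  have "opKinv i (opE j (opK i (opKinv i t))) = opKinv i (cst (v powi (- eps_alpha i j)) * opK i (opE j (opKinv i t)))"
    by (simp only: opK_opE cst_cst) (simp add: power_int_minus)
  then show ?thesis by (simp add: push)
qed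

lemma opKinv_opF: "opKinv i (opF j t) = cst (v powi eps_alpha i j) * opF j (opKinv i t)"
proof -
  have "opKinv i (opF j (opK i (opKinv i t))) = opKinv i (cst (v powi eps_alpha i j) * opK i (opF j (opKinv i t)))"
    by (simp only: opK_opF cst_cst) (simp add: power_int_minus)
  then show ?thesis by (simp add: push)
qed

lemma opE_opF: "opE i (opF j t) - opF j (opE i t) =
  (if i = j then cst (1 / (v - inverse v)) * (opK i (opKinv (i+1) t) - opKinv i (opK (i+1) t)) else 0)"
proof (rule lin_eqI [where t = t])
  define c where "c = 1 / (v - inverse v)"
  have "c * (v - inverse v) = 1" using v_nonunit(2) by (simp add: c_def)
  then have c: "c * v = 1 + c * inverse v" by (simp only: right_diff_distrib diff_eq_eq)
  show "lin (\<lambda>t. if i = j then cst (1 / (v - inverse v)) * (opK i (opKinv (i+1) t) - opKinv i (opK (i+1) t)) else 0)"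
    by (auto intro!: lins)
  show "lin (\<lambda>t. opE i (opF j t) - opF j (opE i t))"
    by (auto intro!: lins)
  fix a t
  assume "opE i (opF j t) - opF j (opE i t) =
  (if i = j then cst (1 / (v - inverse v)) * (opK i (opKinv (i+1) t) - opKinv i (opK (i+1) t)) else 0)"
  then have IH: "opE i (opF j t) = opF j (opE i t) +
  (if i = j then cst c * (opK i (opKinv (i+1) t) - opKinv i (opK (i+1) t)) else 0)"
    by (simp add: algebra_simps c_def)
  show "opE i (opF j (gen a * t)) - opF j (opE i (gen a * t)) =
  (if i = j then cst (1 / (v - inverse v)) * (opK i (opKinv (i+1) (gen a * t)) - opKinv i (opK (i+1) (gen a * t))) else 0)"
    
  proof (cases "i = j")
    case True
    have IH': "opE j (opF j t) = opF j (opE j t) + cst c * (opK j (opKinv (j+1) t) - opKinv j (opK (j+1) t))"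
      using IH True by simp
    have c': "v * c = 1 + c * inverse v" "inverse v * c = c * inverse v"
      using c by (simp_all add: mult.commute)
    show ?thesis unfolding True c_def [symmetric]
      by (cases "a = j"; cases "a = j + 1")
        (simp_all add: push IH' opK_opF opKinv_opF eps_alpha_def c c' cst_add distrib_right vv opK_opKinv_commute)
  next
    case False
    then show ?thesis
      using IH by (cases "a = i"; cases "a = j + 1")
        (simp_all add: push opK_opF opKinv_opF eps_alpha_def vv)
  qed
qed (simp add: op_lin)

lemma opE_comm: "\<not> adjacent i j \<Longrightarrow> opE i (opE j t) = opE j (opE i t)"
proof (rule lin_eqI [where t = t])
  fix a t
  assume "\<not> adjacent i j" and IH: "opE i (opE j t) = opE j (opE i t)"
  then show "opE i (opE j (gen a * t)) = opE j (opE i (gen a * t))"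
    by (auto simp: adjacent_def push IH eps_alpha_def opK_opE opKinv_opE)
qed (auto intro!: lins simp: op_lin)

lemma opF_comm: "\<not> adjacent i j \<Longrightarrow> opF i (opF j t) = opF j (opF i t)"
proof (rule lin_eqI [where t = t])
  fix a t
  assume "\<not> adjacent i j" and IH: "opF i (opF j t) = opF j (opF i t)"
  then show "opF i (opF j (gen a * t)) = opF j (opF i (gen a * t))"
    by (auto simp: adjacent_def push IH)
qed (auto intro!: lins simp: op_lin)

lemma serre_step: "x - y + z = 0 \<longleftrightarrow> x = y - (z :: nat free)"
  by (simp add: algebra_simps)

lemma opE_serre: "adjacent i j \<Longrightarrow>
  opE i (opE i (opE j t)) - cst (v + inverse v) * opE i (opE j (opE i t)) + opE j (opE i (opE i t)) = 0"
proof (rule lin_eqI [where t = t])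
  fix a t
  assume adj: "adjacent i j" and "opE i (opE i (opE j t)) - cst (v + inverse v) * opE i (opE j (opE i t)) + opE j (opE i (opE i t)) = 0"
  then have IH: "opE i (opE i (opE j t)) = cst (v + inverse v) * opE i (opE j (opE i t)) - opE j (opE i (opE i t))"
    by (simp only: serre_step)
  show "opE i (opE i (opE j (gen a * t))) - cst (v + inverse v) * opE i (opE j (opE i (gen a * t))) + opE j (opE i (opE i (gen a * t))) = 0"
  proof (cases "i = j + 1")
    case True
    show ?thesis
      using IH unfolding True
      by (cases "a = j + 1"; cases "a = j + 2")
        (simp_all add: push opK_opE opKinv_opE eps_alpha_def cst_add distrib_right vv)
  next
    case False
    then have "j = i + 1" using adj by (auto simp: adjacent_def)
    then show ?thesis
      using IH
      by (cases "a = i + 1"; cases "a = i + 2")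
        (simp_all add: push opK_opE opKinv_opE eps_alpha_def cst_add distrib_right vv)
  qed
qed (auto intro!: lins simp: op_lin)

lemma opF_serre: "adjacent i j \<Longrightarrow>
  opF i (opF i (opF j t)) - cst (v + inverse v) * opF i (opF j (opF i t)) + opF j (opF i (opF i t)) = 0"
proof (rule lin_eqI [where t = t])
  fix a t
  assume adj: "adjacent i j" and "opF i (opF i (opF j t)) - cst (v + inverse v) * opF i (opF j (opF i t)) + opF j (opF i (opF i t)) = 0"
  then have IH: "opF i (opF i (opF j t)) = cst (v + inverse v) * opF i (opF j (opF i t)) - opF j (opF i (opF i t))"
    by (simp only: serre_step)
  show "opF i (opF i (opF j (gen a * t))) - cst (v + inverse v) * opF i (opF j (opF i (gen a * t))) + opF j (opF i (opF i (gen a * t))) = 0"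
  proof (cases "i = j + 1")
    case True
    show ?thesis
      using IH unfolding True
      by (cases "a = j"; cases "a = j + 1"; cases "a = j + 2")
        (simp_all add: push cst_add distrib_right vv)
  next
    case False
    then have "j = i + 1" using adj by (auto simp: adjacent_def)
    then show ?thesis
      using IH
      by (cases "a = i"; cases "a = i + 1"; cases "a = i + 2")
        (simp_all add: push cst_add distrib_right vv)
  qed
qed (auto intro!: lins simp: op_lin)

lemma ring_Ufree: "ring (Ufree n)"
proof (rule ringI)
  show "abelian_group (Ufree n)"
  proof (rule abelian_groupI)
    fix x assume x: "x \<in> carrier (Ufree n)"
    show "\<exists>y\<in>carrier (Ufree n). y \<oplus>\<^bsub>Ufree n\<^esub> x = \<zero>\<^bsub>Ufree n\<^esub>"
      by (rule bexI [of _ "- x"]) (use x in \<open>auto simp: Ufree_def in_keys_iff\<close>)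
  qed (use keys_add in \<open>fastforce simp: Ufree_def algebra_simps\<close>)+
  show "monoid (Ufree n)"
  proof (rule monoidI)
    fix x y assume "x \<in> carrier (Ufree n)" "y \<in> carrier (Ufree n)"
    then show "x \<otimes>\<^bsub>Ufree n\<^esub> y \<in> carrier (Ufree n)"
      using keys_mult [of x y] by (fastforce simp: Ufree_def plus_word_def)
  qed (simp_all add: Ufree_def mult.assoc zero_word_def)
qed (simp_all add: Ufree_def algebra_simps)

lemma lin_gen_op: "lin (gen_op g)"
  by (cases g) (simp_all add: lin_op)

lemma lin_word_op: "lin (word_op gs)"
proof (induct gs)
  case (Cons g gs)
  then show ?case using lin_comp [OF lin_gen_op Cons] by simp
qed (simp add: lin_def)

lemma word_op_append: "word_op (gs @ hs) t = word_op gs (word_op hs t)"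
  by (induct gs) simp_all

text \<open>The action on the whole tensor algebra, without restriction to \<open>tensor n d\<close>.\<close>

definition full_act :: "ugen free \<Rightarrow> nat free \<Rightarrow> nat free" where
  "full_act x t = lin_ext (\<lambda>gs. word_op gs t) x"

lemma free_act_full_act: "free_act n d x = (\<lambda>t\<in>tensor n d. full_act x t)"
  by (simp add: free_act_def full_act_def lin_ext_def)

lemma full_act_left: "full_act (x + y) t = full_act x t + full_act y t"
  "full_act (x - y) t = full_act x t - full_act y t"
  "full_act 0 t = 0" "full_act (- x) t = - full_act x t"
  "full_act (cst c * x) t = cst c * full_act x t"
  by (simp_all add: full_act_def linD [OF lin_lin_ext])

lemma full_act_one: "full_act 1 t = t"
  and full_act_monomial: "full_act (monomial gs) t = word_op gs t"
  by (simp_all add: full_act_def)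

lemma lin_full_act: "lin (full_act x)"
proof -
  have "lin (\<lambda>t. \<Sum>w\<in>W. cst (c w) * word_op (letters w) t)" if "finite W" for W c
    using that by (induct W) (auto intro!: lins lin_word_op)
  then show ?thesis
    by (simp add: full_act_def [abs_def] lin_ext_def)
qed

lemma monomial_append: "monomial (u @ w) = monomial u * monomial w"
  by (simp add: monomial_def mult_single plus_word_def)

lemma full_act_mult: "full_act (x * y) t = full_act x (full_act y t)"
proof -
  have 1: "full_act (monomial gs * y) t = full_act (monomial gs) (full_act y t)" for gs
    by (rule lin_ext_eqI [where t = y])
       (auto intro!: lins lin_comp [OF lin_word_op] simp: full_act_monomial word_op_append lin_def
          full_act_left cst_left_commute distrib_left linD [OF lin_word_op] simp flip: monomial_append)
  show ?thesis
    by (rule lin_ext_eqI [where t = x])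
       (simp_all add: 1 lin_def full_act_left distrib_right mult.assoc)
qed

lemma full_act_gen: "full_act (gen g) t = gen_op g t"
  using full_act_monomial [of "[g]" t] by (simp add: monomial_def gen_def)

lemma full_act_cst: "full_act (cst c) t = cst c * t"
  using full_act_left(5) [of c 1 t] by (simp add: full_act_one)

lemma full_act_urels:
  assumes "x \<in> urels n"
  shows "full_act x t = 0"
proof -
  note simps = full_act_left full_act_mult full_act_gen full_act_one full_act_cst
  show ?thesis
    using assms unfolding urels_def
    apply (elim UnE CollectE exE conjE)
    subgoal by (simp add: simps opK_commute)
    subgoal by (simp add: simps)
    subgoal by (simp add: simps)
    subgoal for i j using opE_opF [of i j t] by (cases "i = j") (simp_all add: simps)
    subgoal by (simp add: simps opK_opE)
    subgoal by (simp add: simps opK_opF)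
    subgoal by (simp add: simps opE_serre)
    subgoal for i j using opE_comm [of i j t] by (simp add: simps)
    subgoal by (simp add: simps opF_serre)
    subgoal for i j using opF_comm [of i j t] by (simp add: simps)
    done
qed

lemma tensor_closed:
  "0 \<in> tensor n d"
  "s \<in> tensor n d \<Longrightarrow> t \<in> tensor n d \<Longrightarrow> s + t \<in> tensor n d"
  "t \<in> tensor n d \<Longrightarrow> cst c * t \<in> tensor n d"
  "t \<in> tensor n d \<Longrightarrow> - t \<in> tensor n d"
  using keys_add [of s t] keys_cst [of c t]
  by (auto simp: tensor_def in_keys_iff)

lemma tensor_gen: "a \<in> {1..n} \<Longrightarrow> t \<in> tensor n d \<Longrightarrow> gen a * t \<in> tensor n (Suc d)"
  using keys_mult [of "gen a" t] by (fastforce simp: tensor_def gen_def plus_word_def)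

lemma tensor_one: "1 \<in> tensor n 0"
  by (simp add: tensor_def zero_word_def)

lemma tensor_induct [consumes 1, case_names zero add cst word]:
  assumes "t \<in> tensor n d" "P 0" "\<And>s t. P s \<Longrightarrow> P t \<Longrightarrow> P (s + t)" "\<And>c t. P t \<Longrightarrow> P (cst c * t)"
    "\<And>w. length w = d \<Longrightarrow> set w \<subseteq> {1..n} \<Longrightarrow> P (monomial w)"
  shows "P t"
proof -
  have "P (\<Sum>w\<in>W. cst (c w) * monomial (letters w))" if "finite W" "W \<subseteq> Poly_Mapping.keys t" for W c
    using that by (induct W) (use assms in \<open>auto simp: tensor_def\<close>)
  from this [of "Poly_Mapping.keys t" "Poly_Mapping.lookup t"] show ?thesis
    by (subst free_expand) simp
qed

lemma op_tensor:
  assumes "t \<in> tensor n d"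
  shows opK_tensor: "opK i t \<in> tensor n d"
    and opKinv_tensor: "opKinv i t \<in> tensor n d"
    and opE_tensor: "i \<in> {1..<n} \<Longrightarrow> opE i t \<in> tensor n d"
    and opF_tensor: "i \<in> {1..<n} \<Longrightarrow> opF i t \<in> tensor n d"
proof -
  have m: "monomial w \<in> tensor n (length w)" if "set w \<subseteq> {1..n}" for w
    using that by (simp add: tensor_def monomial_def)
  have K: "opK i (monomial w) \<in> tensor n (length w)" if "set w \<subseteq> {1..n}" for w i
    using that by (induct w) (auto simp: monomial_Nil monomial_Cons tensor_one opK_gen intro!: tensor_closed tensor_gen)
  have Kinv: "opKinv i (monomial w) \<in> tensor n (length w)" if "set w \<subseteq> {1..n}" for w i
    using that by (induct w) (auto simp: monomial_Nil monomial_Cons tensor_one opKinv_gen intro!: tensor_closed tensor_gen)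
  have K': "opK i t \<in> tensor n d" if "t \<in> tensor n d" for i t d
    using that by (induct rule: tensor_induct) (auto simp: op_lin intro!: tensor_closed K)
  have Kinv': "opKinv i t \<in> tensor n d" if "t \<in> tensor n d" for i t d
    using that by (induct rule: tensor_induct) (auto simp: op_lin intro!: tensor_closed Kinv)
  show "opK i t \<in> tensor n d" "opKinv i t \<in> tensor n d"
    using assms by (rule K', rule Kinv')
  show "opE i t \<in> tensor n d" if i: "i \<in> {1..<n}"
  proof -
    have E: "opE i (monomial w) \<in> tensor n (length w)" if "set w \<subseteq> {1..n}" for w
      using that i
      by (induct w) (auto simp: monomial_Nil monomial_Cons opE_gen intro!: tensor_closed tensor_gen K' Kinv' m)
    show ?thesis
      using assms by (induct rule: tensor_induct) (auto simp: op_lin intro!: tensor_closed E)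
  qed
  show "opF i t \<in> tensor n d" if i: "i \<in> {1..<n}"
  proof -
    have F: "opF i (monomial w) \<in> tensor n (length w)" if "set w \<subseteq> {1..n}" for w
      using that i
      by (induct w) (auto simp: monomial_Nil monomial_Cons opF_gen intro!: tensor_closed tensor_gen m)
    show ?thesis
      using assms by (induct rule: tensor_induct) (auto simp: op_lin intro!: tensor_closed F)
  qed
qed

lemma word_op_tensor:
  assumes "set gs \<subseteq> ugens n" "t \<in> tensor n d"
  shows "word_op gs t \<in> tensor n d"
  using assms
  by (induct gs) (auto simp: ugens_def op_tensor)

lemma full_act_tensor:
  assumes "x \<in> carrier (Ufree n)" "t \<in> tensor n d"
  shows "full_act x t \<in> tensor n d"
proof -
  have "(\<Sum>w\<in>W. cst (c w) * word_op (letters w) t) \<in> tensor n d"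
    if "finite W" "W \<subseteq> Poly_Mapping.keys x" for W c
    using that by (induct W) (use assms in \<open>auto simp: Ufree_def intro!: tensor_closed word_op_tensor\<close>)
  then show ?thesis by (simp add: full_act_def lin_ext_def)
qed

lemma Ufree_closed:
  "0 \<in> carrier (Ufree n)" "1 \<in> carrier (Ufree n)"
  "x \<in> carrier (Ufree n) \<Longrightarrow> y \<in> carrier (Ufree n) \<Longrightarrow> x + y \<in> carrier (Ufree n)"
  "x \<in> carrier (Ufree n) \<Longrightarrow> y \<in> carrier (Ufree n) \<Longrightarrow> x - y \<in> carrier (Ufree n)"
  "x \<in> carrier (Ufree n) \<Longrightarrow> y \<in> carrier (Ufree n) \<Longrightarrow> x * y \<in> carrier (Ufree n)"
  "cst c \<in> carrier (Ufree n)"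
  "g \<in> ugens n \<Longrightarrow> gen g \<in> carrier (Ufree n)"
proof -
  note mem = Ufree_def ring.simps partial_object.simps monoid.simps mem_Collect_eq
  show add: "x + y \<in> carrier (Ufree n)" if "x \<in> carrier (Ufree n)" "y \<in> carrier (Ufree n)" for x y
    using that keys_add [of x y] unfolding mem by blast
  have "- y \<in> carrier (Ufree n)" if "y \<in> carrier (Ufree n)" for y
    using that unfolding mem by (simp add: in_keys_iff)
  from add [OF _ this]
  show "x - y \<in> carrier (Ufree n)" if "x \<in> carrier (Ufree n)" "y \<in> carrier (Ufree n)" for x y
    using that by fastforce
  show "x * y \<in> carrier (Ufree n)" if x: "x \<in> carrier (Ufree n)" and y: "y \<in> carrier (Ufree n)" for x y
    unfolding mem
  proof
    fix w assume "w \<in> Poly_Mapping.keys (x * y)"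
    then obtain a b where "w = a + b" "a \<in> Poly_Mapping.keys x" "b \<in> Poly_Mapping.keys y"
      using keys_mult [of x y] by blast
    then show "set (letters w) \<subseteq> ugens n"
      using x y unfolding mem by (simp add: plus_word_def)
  qed
qed (simp_all add: Ufree_def cst_def gen_def zero_word_def)

lemma urels_carrier: "urels n \<subseteq> carrier (Ufree n)"
proof -
  have g: "i \<in> {1..n} \<Longrightarrow> UK i \<in> carrier (Ufree n)" "i \<in> {1..n} \<Longrightarrow> UKinv i \<in> carrier (Ufree n)"
    "i \<in> {1..<n} \<Longrightarrow> UE i \<in> carrier (Ufree n)" "i \<in> {1..<n} \<Longrightarrow> UF i \<in> carrier (Ufree n)" for i
    by (auto simp: ugens_def intro!: Ufree_closed)
  show ?thesis
    unfolding urels_def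
    by (intro Un_least subsetI; elim CollectE exE conjE; simp only: split: if_split)
       (auto intro!: Ufree_closed(1-6) g)
qed

lemma End_carrier: "f \<in> carrier (End_tensor n d) \<longleftrightarrow> f \<in> extensional (tensor n d) \<and>
    (\<forall>t\<in>tensor n d. f t \<in> tensor n d) \<and>
    (\<forall>s\<in>tensor n d. \<forall>t\<in>tensor n d. f (s + t) = f s + f t) \<and>
    (\<forall>c. \<forall>t\<in>tensor n d. f (cst c * t) = cst c * f t)"
  unfolding End_tensor_def PiE_def Pi_def by auto

lemma End_eqI:
  assumes "f \<in> extensional (tensor n d)" "g \<in> extensional (tensor n d)"
    "\<And>t. t \<in> tensor n d \<Longrightarrow> f t = g t"
  shows "f = g"
  using assms by (rule extensionalityI)

lemma End_ops:
  "\<one>\<^bsub>End_tensor n d\<^esub> = (\<lambda>t\<in>tensor n d. t)"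
  "\<zero>\<^bsub>End_tensor n d\<^esub> = (\<lambda>t\<in>tensor n d. 0)"
  "f \<oplus>\<^bsub>End_tensor n d\<^esub> g = (\<lambda>t\<in>tensor n d. f t + g t)"
  "f \<otimes>\<^bsub>End_tensor n d\<^esub> g = (\<lambda>t\<in>tensor n d. f (g t))"
  by (simp_all add: End_tensor_def compose_def)

lemma ring_End_tensor: "ring (End_tensor n d)"
proof (rule ringI)
  show "abelian_group (End_tensor n d)"
  proof (rule abelian_groupI)
    fix f assume "f \<in> carrier (End_tensor n d)"
    then show "\<exists>g\<in>carrier (End_tensor n d). g \<oplus>\<^bsub>End_tensor n d\<^esub> f = \<zero>\<^bsub>End_tensor n d\<^esub>"
      by (intro bexI [of _ "\<lambda>t\<in>tensor n d. - f t"])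
         (auto simp: End_carrier End_ops tensor_closed intro!: restrict_ext)
    from \<open>f \<in> carrier (End_tensor n d)\<close> show "\<zero>\<^bsub>End_tensor n d\<^esub> \<oplus>\<^bsub>End_tensor n d\<^esub> f = f"
      by (intro End_eqI [of _ n d]) (simp_all add: End_carrier End_ops)
  qed (simp_all add: End_carrier End_ops tensor_closed distrib_left add_ac cong: restrict_cong)
  show "monoid (End_tensor n d)"
  proof (rule monoidI)
    fix f assume "f \<in> carrier (End_tensor n d)"
    then show "\<one>\<^bsub>End_tensor n d\<^esub> \<otimes>\<^bsub>End_tensor n d\<^esub> f = f" "f \<otimes>\<^bsub>End_tensor n d\<^esub> \<one>\<^bsub>End_tensor n d\<^esub> = f"
      by (auto simp: End_carrier End_ops intro!: End_eqI [of _ n d])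
  qed (simp_all add: End_carrier End_ops tensor_closed cong: restrict_cong)
qed (simp_all add: End_carrier End_ops cong: restrict_cong)

lemma free_act_hom: "free_act n d \<in> ring_hom (Ufree n) (End_tensor n d)"
proof (rule ring_hom_memI)
  fix x y assume x: "x \<in> carrier (Ufree n)" and y: "y \<in> carrier (Ufree n)"
  show "free_act n d x \<in> carrier (End_tensor n d)"
    using x by (simp add: End_tensor_def free_act_full_act full_act_tensor tensor_closed linD [OF lin_full_act])
  show "free_act n d (x \<otimes>\<^bsub>Ufree n\<^esub> y) = free_act n d x \<otimes>\<^bsub>End_tensor n d\<^esub> free_act n d y"
    using y by (auto simp: Ufree_def End_tensor_def free_act_full_act full_act_mult compose_def fun_eq_iff
        intro!: full_act_tensor)
  show "free_act n d (x \<oplus>\<^bsub>Ufree n\<^esub> y) = free_act n d x \<oplus>\<^bsub>End_tensor n d\<^esub> free_act n d y"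
    by (simp add: Ufree_def End_tensor_def free_act_full_act full_act_left fun_eq_iff)
next
  show "free_act n d \<one>\<^bsub>Ufree n\<^esub> = \<one>\<^bsub>End_tensor n d\<^esub>"
    by (simp add: Ufree_def End_tensor_def free_act_full_act full_act_one)
qed

lemma Uideal_kernel: "Uideal n \<subseteq> {x \<in> carrier (Ufree n). free_act n d x = \<zero>\<^bsub>End_tensor n d\<^esub>}"
proof -
  interpret h: ring_hom_ring "Ufree n" "End_tensor n d" "free_act n d"
    by (rule ring_hom_ringI2 [OF ring_Ufree ring_End_tensor free_act_hom])
  have "urels n \<subseteq> a_kernel (Ufree n) (End_tensor n d) (free_act n d)"
  proof
    fix x assume x: "x \<in> urels n"
    then have "free_act n d x = \<zero>\<^bsub>End_tensor n d\<^esub>"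
      unfolding free_act_full_act End_ops by (intro restrict_ext full_act_urels)
    with x urels_carrier show "x \<in> a_kernel (Ufree n) (End_tensor n d) (free_act n d)"
      unfolding a_kernel_def' by blast
  qed
  from h.R.genideal_minimal [OF h.kernel_is_ideal this] show ?thesis
    unfolding Uideal_def a_kernel_def' .
qed

lemma ideal_Uideal: "ideal (Uideal n) (Ufree n)"
  unfolding Uideal_def by (rule ring.genideal_ideal [OF ring_Ufree urels_carrier])

lemma Uclass_iff: "y \<in> Uclass n x \<longleftrightarrow> (\<exists>i\<in>Uideal n. y = i \<oplus>\<^bsub>Ufree n\<^esub> x)"
  by (simp add: Uclass_def a_r_coset_def')

lemma carrier_U: "X \<in> carrier (U n) \<longleftrightarrow> (\<exists>x\<in>carrier (Ufree n). X = Uclass n x)"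
  by (simp add: U_def FactRing_def A_RCOSETS_def' Uclass_def)

lemma Uideal_kernelD:
  "i \<in> Uideal n \<Longrightarrow> i \<in> carrier (Ufree n)"
  "i \<in> Uideal n \<Longrightarrow> free_act n d i = \<zero>\<^bsub>End_tensor n d\<^esub>"
  using Uideal_kernel [of n d] by (simp_all add: subset_iff)

theorem rho_Uclass:
  assumes "x \<in> carrier (Ufree n)"
  shows "rho n d (Uclass n x) = free_act n d x"
proof -
  interpret h: ring_hom_ring "Ufree n" "End_tensor n d" "free_act n d"
    by (rule ring_hom_ringI2 [OF ring_Ufree ring_End_tensor free_act_hom])
  interpret I: ideal "Uideal n" "Ufree n"
    by (rule ideal_Uideal)
  have *: "free_act n d y = free_act n d x" if y: "y \<in> Uclass n x" for y
  proof -
    obtain i where i: "i \<in> Uideal n" "y = i \<oplus>\<^bsub>Ufree n\<^esub> x"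
      using y unfolding Uclass_iff by (rule bexE)
    note k = Uideal_kernelD [OF i(1)]
    show ?thesis
      unfolding i(2) h.hom_add [OF k(1) assms] k(2) by (rule h.S.l_zero [OF h.hom_closed [OF assms]])
  qed
  have x: "x \<in> Uclass n x"
    unfolding Uclass_def using assms by (rule I.a_rcos_self)
  have "free_act n d ` Uclass n x = (\<lambda>_. free_act n d x) ` Uclass n x"
    by (rule image_cong [OF refl *])
  also have "\<dots> = {free_act n d x}"
    by (rule image_constant [OF x])
  finally show ?thesis by (simp only: rho_def the_elem_eq)
qed

theorem rho_hom: "rho n d \<in> ring_hom (U n) (End_tensor n d)"
proof -
  interpret h: ring_hom_ring "Ufree n" "End_tensor n d" "free_act n d"
    by (rule ring_hom_ringI2 [OF ring_Ufree ring_End_tensor free_act_hom])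
  interpret I: ideal "Uideal n" "Ufree n"
    by (rule ideal_Uideal)
  show ?thesis
  proof (rule ring_hom_memI)
    fix X Y assume "X \<in> carrier (U n)" "Y \<in> carrier (U n)"
    then obtain x y where xy: "x \<in> carrier (Ufree n)" "y \<in> carrier (Ufree n)" "X = Uclass n x" "Y = Uclass n y"
      unfolding carrier_U by (elim bexE)
    have "X \<otimes>\<^bsub>U n\<^esub> Y = Uclass n (x \<otimes>\<^bsub>Ufree n\<^esub> y)"
      using xy by (simp add: U_def FactRing_def Uclass_def I.rcoset_mult_add)
    then show "rho n d (X \<otimes>\<^bsub>U n\<^esub> Y) = rho n d X \<otimes>\<^bsub>End_tensor n d\<^esub> rho n d Y"
      using xy by (simp add: rho_Uclass)
    have "X \<oplus>\<^bsub>U n\<^esub> Y = Uclass n (x \<oplus>\<^bsub>Ufree n\<^esub> y)"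
      using xy by (simp add: U_def FactRing_def Uclass_def I.a_rcos_sum)
    then show "rho n d (X \<oplus>\<^bsub>U n\<^esub> Y) = rho n d X \<oplus>\<^bsub>End_tensor n d\<^esub> rho n d Y"
      using xy by (simp add: rho_Uclass)
  next
    fix X assume "X \<in> carrier (U n)"
    then show "rho n d X \<in> carrier (End_tensor n d)"
      by (auto simp: carrier_U rho_Uclass)
  next
    have "\<one>\<^bsub>U n\<^esub> = Uclass n \<one>\<^bsub>Ufree n\<^esub>"
      by (simp add: U_def FactRing_def Uclass_def)
    then show "rho n d \<one>\<^bsub>U n\<^esub> = \<one>\<^bsub>End_tensor n d\<^esub>"
      by (simp add: rho_Uclass)
  qed
qed

theorem Simg_eq: "x \<in> carrier (Ufree n) \<Longrightarrow> Simg n d x = free_act n d x"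
  by (simp add: Simg_def rho_Uclass)

theorem Schur_eq: "Schur n d = free_act n d ` carrier (Ufree n)"
proof -
  have "carrier (U n) = Uclass n ` carrier (Ufree n)"
    using carrier_U by (simp add: set_eq_iff image_iff)
  then show ?thesis
    by (simp add: Schur_def image_image rho_Uclass cong: image_cong_simp)
qed

end

theory Submission
  imports Defs "HOL-Library.Product_Lexorder"
begin

text \<open>
  Tensor space carries Hecke operators commuting with the action of \<open>\<^bold>U\<close>. Let \<open>N\<close> be the set of endomorphisms
  that commute with them, preserve the \<open>\<A>\<close>-span of the words and only lower letters. An element of \<open>N\<close>
  is determined by its values on the descending words \<open>w\<close>, and these by their coefficients at the words
  that descend on each block of equal letters of \<open>w\<close>, that is, by one coefficient for each upper
  triangular matrix.

  The coproduct of the root vectors has a closed form, which shows that their divided powers preserve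
  the \<open>\<A>\<close>-span of the words; hence \<open>\<^bold>S\<^sub>\<A>\<^sup>\<ge>\<^sup>0 \<subseteq> N\<close>. On a descending word, \<open>E\<^sub>A\<close> produces, up to a power of \<open>v\<close>,
  the word of the matrix \<open>A\<close> and otherwise only matrices that are smaller for a weight under which moving
  a letter twice, or moving letters along a chain, loses against moving one letter directly. So, for
  every order of the roots, the coefficient matrix of the \<open>E\<^sub>A 1\<^sub>\<lambda>\<close> with \<open>\<chi>(E\<^sub>A) \<preceq> \<lambda>\<close> is triangular with units
  of \<open>\<A>\<close> on the diagonal, and these elements form an \<open>\<A>\<close>-basis of \<open>N\<close>.

  Transposing matrices and reversing words exchanges \<open>X\<^sub>-\<^sub>\<alpha>\<close> with \<open>X\<^sub>\<alpha>\<close> for the parameter \<open>v\<^sup>-\<^sup>1\<close>, which is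
  why the parameter \<open>q\<close> below is either \<open>v\<close> or \<open>v\<^sup>-\<^sup>1\<close>.
\<close>

section \<open>Laurent polynomials and quantum integers\<close>

text \<open>The condition \<chi>(E_A) \<preceq> \<lambda> says that the numbers
  \<open>\<mu> j - content n A j\<close> can serve as diagonal entries. So the index set consists
  exactly of the upper triangular matrices over the naturals with column sums \<lambda>. Every word
  lying letterwise below the descending word of weight \<lambda> yields such a matrix, so the
  coefficients that determine an element of \<open>N\<close> are as many as the proposed basis
  elements. A direct proof of spanning would have to reorder products of divided powers by
  commutation formulas that depend on the chosen order of the roots. Here a sandwich replaces this:
  the candidates are products from the Borel algebra, all such products lie in \<open>N\<close>
  because the generators do, and triangularity puts \<open>N\<close> into the \<A>-span of the
  candidates. The three modules therefore coincide, and the same system of coefficients gives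
  independence.\<close>

definition embZ :: "int poly \<Rightarrow> qv" where
  "embZ p = Fraction_Field.Fract (map_poly of_int p) 1"

lemma embZ_ring:
  "embZ (p + r) = embZ p + embZ r" "embZ (- p) = - embZ p" "embZ (p * r) = embZ p * embZ r" "embZ 1 = 1"
proof -
  have "map_poly rat_of_int (p + r) = map_poly of_int p + map_poly of_int r"
    by (rule poly_eqI) (simp add: coeff_map_poly)
  then show "embZ (p + r) = embZ p + embZ r"
    by (simp add: embZ_def)
  have "map_poly rat_of_int (- p) = - map_poly of_int p"
    by (rule poly_eqI) (simp add: coeff_map_poly)
  then show "embZ (- p) = - embZ p"
    by (simp add: embZ_def)
  have "map_poly rat_of_int (p * r) = map_poly of_int p * map_poly of_int r"
    by (rule poly_eqI) (simp add: coeff_map_poly coeff_mult)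
  then show "embZ (p * r) = embZ p * embZ r"
    by (simp add: embZ_def)
  show "embZ 1 = 1"
    by (simp add: embZ_def One_fract_def)
qed

lemma embZ_v: "embZ [:0, 1:] = v"
  by (simp add: embZ_def v_def map_poly_pCons)

lemma embZ_v_pow: "embZ ([:0, 1:] ^ m) = v ^ m"
  by (induct m) (simp_all add: embZ_ring embZ_v del: mult_pCons_left)

lemma Laurent_iff: "x \<in> Laurent \<longleftrightarrow> (\<exists>k p. x = v powi k * embZ p)"
  by (auto simp: Laurent_def embZ_def)

lemma Laurent_mult:
  assumes "x \<in> Laurent" "y \<in> Laurent"
  shows "x * y \<in> Laurent"
proof -
  obtain k p l r where "x = v powi k * embZ p" "y = v powi l * embZ r"
    using assms by (auto simp: Laurent_iff)
  then have "x * y = v powi (k + l) * embZ (p * r)"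
    by (simp add: embZ_ring power_int_add mult_ac)
  then show ?thesis unfolding Laurent_iff by blast
qed

lemma Laurent_powi_v: "v powi k \<in> Laurent"
  unfolding Laurent_iff by (intro exI [of _ k] exI [of _ 1]) (simp add: embZ_ring)

text \<open>After factoring out the smaller power of \<open>v\<close>, the other summand carries a
  nonnegative power, so the bracket stays in the image of \<open>embZ\<close>.\<close>

lemma Laurent_add:
  assumes "x \<in> Laurent" "y \<in> Laurent"
  shows "x + y \<in> Laurent"
proof -
  have *: "v powi k * embZ p + v powi l * embZ r \<in> Laurent" if "k \<le> l" for k l p r
  proof -
    have "v powi l = v powi k * v powi int (nat (l - k))"
      using that by (simp flip: power_int_add)
    then have "v powi k * embZ p + v powi l * embZ r = v powi k * embZ (p + [:0, 1:] ^ nat (l - k) * r)"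
      by (simp only: embZ_ring embZ_v_pow power_int_of_nat distrib_left mult.assoc)
    then show ?thesis unfolding Laurent_iff by blast
  qed
  obtain k p l r where "x = v powi k * embZ p" "y = v powi l * embZ r"
    using assms by (auto simp: Laurent_iff)
  then show ?thesis
    using * [of k l p r] * [of l k r p] by (cases "k \<le> l") (simp_all add: add.commute)
qed

lemma Laurent_uminus: "x \<in> Laurent \<Longrightarrow> - x \<in> Laurent"
  unfolding Laurent_iff by (metis embZ_ring(2) mult_minus_right)

lemma Laurent_diff: "x \<in> Laurent \<Longrightarrow> y \<in> Laurent \<Longrightarrow> x - y \<in> Laurent"
  using Laurent_add [of x "- y"] Laurent_uminus by simp

lemma Laurent_0: "0 \<in> Laurent" and Laurent_1: "1 \<in> Laurent"
  using Laurent_powi_v [of 0] Laurent_diff [of 1 1] by simp_all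

lemma Laurent_v: "v \<in> Laurent" "inverse v \<in> Laurent"
  using Laurent_powi_v [of 1] Laurent_powi_v [of "- 1"] by (simp_all add: power_int_minus)

lemma Laurent_power: "x \<in> Laurent \<Longrightarrow> x ^ m \<in> Laurent"
  by (induct m) (simp_all add: Laurent_1 Laurent_mult)

lemma Laurent_sum: "(\<And>i. i \<in> I \<Longrightarrow> f i \<in> Laurent) \<Longrightarrow> sum f I \<in> Laurent"
  by (induct I rule: infinite_finite_induct) (simp_all add: Laurent_0 Laurent_add)

lemma Laurent_prod: "(\<And>i. i \<in> I \<Longrightarrow> f i \<in> Laurent) \<Longrightarrow> prod f I \<in> Laurent"
  by (induct I rule: infinite_finite_induct) (simp_all add: Laurent_1 Laurent_mult)

lemma Laurent_prod_list: "(\<And>x. x \<in> set xs \<Longrightarrow> x \<in> Laurent) \<Longrightarrow> prod_list xs \<in> Laurent"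
  by (induct xs) (simp_all add: Laurent_1 Laurent_mult)

lemmas Laurent_intros = Laurent_0 Laurent_1 Laurent_v Laurent_powi_v Laurent_add Laurent_diff
  Laurent_uminus Laurent_mult Laurent_power Laurent_sum Laurent_prod

definition Laurent_unit :: "qv \<Rightarrow> bool" where
  "Laurent_unit c \<longleftrightarrow> c \<noteq> 0 \<and> c \<in> Laurent \<and> inverse c \<in> Laurent"

lemma Laurent_unit_mult: "Laurent_unit a \<Longrightarrow> Laurent_unit b \<Longrightarrow> Laurent_unit (a * b)"
  by (simp add: Laurent_unit_def Laurent_mult)

text \<open>Degrees separate the two sides. All nonvanishing of quantum integers and of the
  denominators in \<open>Kbinom\<close> comes from this.\<close>

lemma v_pow_neq_1: "m > 0 \<Longrightarrow> v ^ m \<noteq> 1"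
proof -
  assume "m > 0"
  have "v ^ m = Fraction_Field.Fract ([:0, 1:] ^ m) 1"
    by (induct m) (simp_all add: v_def One_fract_def)
  moreover have "degree ([:0, 1:] ^ m :: rat poly) = m"
    by (simp add: degree_power_eq)
  then have "[:0, 1:] ^ m \<noteq> (1 :: rat poly)"
    using \<open>m > 0\<close> by (metis degree_1 less_numeral_extra(3))
  ultimately show ?thesis
    by (simp add: One_fract_def eq_fract)
qed

lemma v_pow_diff: "m > 0 \<Longrightarrow> v ^ m - inverse v ^ m \<noteq> 0"
proof
  assume "m > 0" "v ^ m - inverse v ^ m = 0"
  then have "v ^ m = inverse (v ^ m)"
    by (simp add: power_inverse)
  then have "v ^ m * v ^ m = 1"
    by (metis power_not_zero right_inverse v_nz)
  then show False
    using v_pow_neq_1 [of "m + m"] \<open>m > 0\<close> by (simp add: power_add)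
qed

section \<open>Quantum integers and Gaussian binomial coefficients\<close>

lemma qint_0 [simp]: "qint 0 = 0"
  by (simp add: qint_def)

lemma qint_1 [simp]: "qint (Suc 0) = 1"
  using v_nonunit(2) by (simp add: qint_def)

lemma qint_nz: "m > 0 \<Longrightarrow> qint m \<noteq> 0"
  using v_pow_diff v_nonunit(2) by (simp add: qint_def)

lemma qfact_Suc: "qfact (Suc m) = qint (Suc m) * qfact m"
  by (simp add: qfact_def mult.commute)

lemma qfact_0 [simp]: "qfact 0 = 1"
  by (simp add: qfact_def)

lemma qfact_nz: "qfact m \<noteq> 0"
  by (induct m) (simp_all add: qfact_Suc qint_nz)

text \<open>The eigenvalue of \<open>Kbinom i t\<close> on a word with \<open>m\<close> letters
  \<open>i\<close>, on which K_i acts by \<open>v ^ m\<close>; hence the factors of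
  \<open>Kbinom\<close> with this value inserted instead of a quotient of factorials.\<close>

definition qbinom :: "nat \<Rightarrow> nat \<Rightarrow> qv" where
  "qbinom m t = (\<Prod>s\<in>{1..t}. (v powi (int m - int s + 1) - v powi (int s - 1 - int m)) / (v ^ s - inverse v ^ s))"

lemma qbinom_0 [simp]: "qbinom m 0 = 1"
  by (simp add: qbinom_def)

text \<open>The numerators are the denominators in reverse order.\<close>

lemma qbinom_self: "qbinom m m = 1"
proof -
  have "qbinom m m = (\<Prod>s\<in>{1..m}. v ^ (m + 1 - s) - inverse v ^ (m + 1 - s)) / (\<Prod>s\<in>{1..m}. v ^ s - inverse v ^ s)"
    unfolding qbinom_def prod_dividef [symmetric]
  proof (rule prod.cong)
    fix s assume "s \<in> {1..m}"
    then have "int m - int s + 1 = int (m + 1 - s)" "int s - 1 - int m = - int (m + 1 - s)"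
      by auto
    then show "(v powi (int m - int s + 1) - v powi (int s - 1 - int m)) / (v ^ s - inverse v ^ s) =
      (v ^ (m + 1 - s) - inverse v ^ (m + 1 - s)) / (v ^ s - inverse v ^ s)"
      by (simp only: power_int_minus power_int_of_nat power_inverse)
  qed simp
  moreover have "(\<Prod>s\<in>{1..m}. v ^ (m + 1 - s) - inverse v ^ (m + 1 - s)) = (\<Prod>s\<in>{1..m}. v ^ s - inverse v ^ s)"
    by (rule prod.reindex_bij_witness [of _ "\<lambda>s. m + 1 - s" "\<lambda>s. m + 1 - s"]) auto
  moreover have "(\<Prod>s\<in>{1..m}. v ^ s - inverse v ^ s) \<noteq> 0"
    using v_pow_diff by (simp add: Suc_le_eq)
  ultimately show ?thesis
    by simp
qed

text \<open>The factor at \<open>s = Suc m\<close> vanishes.\<close>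

lemma qbinom_less: "m < t \<Longrightarrow> qbinom m t = 0"
  unfolding qbinom_def by (rule prod_zero) (auto intro!: bexI [of _ "Suc m"])

lemma qbinom_Suc: "qbinom m (Suc t) = qbinom m t * ((v powi (int m - int t) - v powi (int t - int m)) / (v ^ Suc t - inverse v ^ Suc t))"
  by (simp add: qbinom_def)

lemma qbinom_absorb: "qbinom (Suc m) (Suc t) = (v powi (int m + 1) - v powi (- 1 - int m)) / (v ^ Suc t - inverse v ^ Suc t) * qbinom m t"
proof (induct t)
  case 0
  show ?case by (simp add: qbinom_def)
next
  case (Suc t)
  show ?case
    unfolding qbinom_Suc [of "Suc m" "Suc t"] Suc unfolding qbinom_Suc [of m t]
    by (simp add: add_diff_add mult_ac)
qed

text \<open>The factors of \<open>qbinom\<close> have denominators, so integrality is not visible in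
  the definition. This Pascal rule, obtained from absorption by splitting the top numerator, gives
  it by induction on \<open>m\<close>.\<close>

lemma qbinom_pascal: "qbinom (Suc m) (Suc t) = v ^ (Suc t) * qbinom m (Suc t) + v powi (int t - int m) * qbinom m t"
proof -
  let ?d = "v ^ Suc t - inverse v ^ Suc t"
  have d: "?d \<noteq> 0" by (rule v_pow_diff) simp
  have "int t + 1 = int (Suc t)" "- int t - 1 = - int (Suc t)"
    by simp_all
  then have p: "v ^ Suc t = v powi (int t + 1)" "inverse v ^ Suc t = v powi (- int t - 1)"
    by (simp_all only: power_int_minus power_int_of_nat power_inverse)
  have "v powi (int m + 1) - v powi (- 1 - int m)
      = v ^ Suc t * (v powi (int m - int t) - v powi (int t - int m)) + v powi (int t - int m) * ?d"
    unfolding p by (simp add: right_diff_distrib add.commute minus_diff_commute flip: power_int_add)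
  then have "(v powi (int m + 1) - v powi (- 1 - int m)) / ?d
      = v ^ Suc t * ((v powi (int m - int t) - v powi (int t - int m)) / ?d) + v powi (int t - int m)"
    using d by (simp only: add_divide_distrib) simp
  then show ?thesis
    unfolding qbinom_absorb qbinom_Suc [of m t] by (simp only: distrib_right) (simp only: mult_ac)
qed

lemma qbinom_Laurent: "qbinom m t \<in> Laurent"
proof (induct m arbitrary: t)
  case 0
  then show ?case by (cases t) (simp_all add: qbinom_less Laurent_0 Laurent_1)
next
  case (Suc m)
  then show ?case by (cases t) (simp_all only: qbinom_0 qbinom_pascal Laurent_intros)
qed

section \<open>Operators on the tensor algebra\<close>

abbreviation cf :: "'a free \<Rightarrow> 'a list \<Rightarrow> qv" where
  "cf t w \<equiv> Poly_Mapping.lookup t (Word w)"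

lemma free_eqI: "(\<And>w. cf s w = cf t w) \<Longrightarrow> s = t"
  by (metis poly_mapping_eqI word.collapse)

lemma cf_monomial: "cf (monomial u) w = (if u = w then 1 else 0)"
  by (simp add: monomial_def lookup_single when_def)

lemma cf_gen_Cons: "cf (gen a * t) (c # w) = (if a = c then cf t w else 0)"
proof -
  have "cf (gen a * t) (c # w) = (\<Sum>u\<in>Poly_Mapping.keys t. Poly_Mapping.lookup t u * cf (monomial (a # letters u)) (c # w))"
    by (subst free_expand [of t]) (simp add: sum_distrib_left lookup_sum cst_left_commute lookup_cst_mult flip: monomial_Cons)
  also have "\<dots> = (if a = c then cf (\<Sum>u\<in>Poly_Mapping.keys t. cst (Poly_Mapping.lookup t u) * monomial (letters u)) w else 0)"
    by (auto simp: cf_monomial lookup_sum lookup_cst_mult)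
  finally show ?thesis
    by (simp flip: free_expand)
qed

lemma cf_gen_Nil: "cf (gen a * t) [] = 0"
proof -
  have "cf (gen a * t) [] = (\<Sum>u\<in>Poly_Mapping.keys t. Poly_Mapping.lookup t u * cf (monomial (a # letters u)) [])"
    by (subst free_expand [of t]) (simp add: sum_distrib_left lookup_sum cst_left_commute lookup_cst_mult flip: monomial_Cons)
  then show ?thesis
    by (simp add: cf_monomial)
qed

lemma cf_simps:
  "cf (s + t) w = cf s w + cf t w" "cf (s - t) w = cf s w - cf t w" "cf (- t) w = - cf t w"
  "cf 0 w = 0" "cf (cst c * t) w = c * cf t w"
  by (simp_all add: lookup_add lookup_minus lookup_cst_mult)

lemma cf_lin:
  assumes "lin f"
  shows "cf (f t) u = (\<Sum>w\<in>Poly_Mapping.keys t. Poly_Mapping.lookup t w * cf (f (monomial (letters w))) u)"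
proof -
  have "f t = (\<Sum>w\<in>Poly_Mapping.keys t. cst (Poly_Mapping.lookup t w) * f (monomial (letters w)))"
    by (subst free_expand [of t]) (simp only: linD(2,6) [OF assms])
  then show ?thesis
    by (simp only: lookup_sum lookup_cst_mult)
qed

lemma cf_lin_nz:
  assumes "lin f" "cf (f t) u \<noteq> 0"
  obtains w where "cf t w \<noteq> 0" "cf (f (monomial w)) u \<noteq> 0"
proof -
  have "(\<Sum>w\<in>Poly_Mapping.keys t. Poly_Mapping.lookup t w * cf (f (monomial (letters w))) u) \<noteq> 0"
    using assms(2) by (simp add: cf_lin [OF assms(1), symmetric])
  then obtain w where "w \<in> Poly_Mapping.keys t" "Poly_Mapping.lookup t w * cf (f (monomial (letters w))) u \<noteq> 0"
    by (rule sum.not_neutral_contains_not_neutral)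
  then show thesis
    using that [of "letters w"] by auto
qed

section \<open>Diagonal operators and root vectors on the tensor algebra\<close>

definition dg :: "(nat \<Rightarrow> qv) \<Rightarrow> nat free \<Rightarrow> nat free" where
  "dg \<phi> = lin_ext (\<lambda>w. cst (prod_list (map \<phi> w)) * monomial w)"

lemma dg_monomial: "dg \<phi> (monomial w) = cst (prod_list (map \<phi> w)) * monomial w"
  by (simp add: dg_def)

lemma lin_dg: "lin (dg \<phi>)"
  by (simp add: dg_def lin_lin_ext)

lemma lin_dgc: "lin f \<Longrightarrow> lin (\<lambda>x. dg \<phi> (f x :: nat free))" for f :: "nat free \<Rightarrow> nat free"
  by (rule lin_comp [OF lin_dg])

lemmas lin_rules = lin_id lin_zero lin_add lin_diff lin_cmult lin_if lin_dgc

lemma dg_gen: "dg \<phi> (gen a * t) = cst (\<phi> a) * (gen a * dg \<phi> t)"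
  by (rule lin_ext_eqI [where t = t])
     (auto intro!: lin_rules simp: dg_monomial gen_cst cst_cst simp flip: monomial_Cons)

lemma prod_list_map_mult: "prod_list (map (\<lambda>c. f c * g c) w) = prod_list (map f w) * (prod_list (map g w) :: qv)"
  by (induct w) (simp_all add: mult_ac)

lemma dg_dg: "dg \<phi> (dg \<psi> t) = dg (\<lambda>c. \<phi> c * \<psi> c) t"
  by (rule lin_ext_eqI [where t = t])
     (auto intro!: lin_rules simp: dg_monomial linD [OF lin_dg] cst_cst prod_list_map_mult mult_ac)

lemma dg_one: "dg \<phi> 1 = 1"
  using dg_monomial [of \<phi> "[]"] by (simp add: monomial_Nil)

lemma dg_commute: "dg \<phi> (dg \<psi> t) = dg \<psi> (dg \<phi> t)"
  by (simp add: dg_dg mult.commute)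

text \<open>The eigenvalue of K_i K_j^-1 on the letter \<open>c\<close>, with \<open>q\<close> in
  place of \<open>v\<close>.\<close>

definition kap :: "qv \<Rightarrow> nat \<Rightarrow> nat \<Rightarrow> nat \<Rightarrow> qv" where
  "kap q i j c = (if c = i then q else if c = j then inverse q else 1)"

primrec Rop_word :: "qv \<Rightarrow> nat list \<Rightarrow> nat \<Rightarrow> nat \<Rightarrow> nat free" where
  "Rop_word q [] i j = 0"
| "Rop_word q (a # w) i j = gen a * Rop_word q w i j
     + (if a = j then gen i * dg (kap q i j) (monomial w) else 0)
     + (if i < a \<and> a < j then cst (inverse q - q) * (gen i * (cst (prod_list (map (kap q i a) w)) * Rop_word q w a j)) else 0)"

text \<open>
  \<open>Rop q i j\<close> is the action of \<open>v\<^sup>j\<^sup>-\<^sup>i\<^sup>-\<^sup>1 X\<^sub>\<alpha>\<close> for \<open>\<alpha> = \<epsilon>\<^sub>i - \<epsilon>\<^sub>j\<close>, with \<open>q\<close> in place of \<open>v\<close>. Its recursion on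
  words comes from \<open>\<Delta>(X\<^sub>i\<^sub>j) = X\<^sub>i\<^sub>j \<otimes> K\<^sub>i K\<^sub>j\<^sup>-\<^sup>1 + 1 \<otimes> X\<^sub>i\<^sub>j + (v\<^sup>-\<^sup>2 - 1) \<Sum>\<^sub>i\<^sub><\<^sub>a\<^sub><\<^sub>j X\<^sub>i\<^sub>a \<otimes> X\<^sub>a\<^sub>j K\<^sub>i K\<^sub>a\<^sup>-\<^sup>1\<close>.
\<close>

definition Rop :: "qv \<Rightarrow> nat \<Rightarrow> nat \<Rightarrow> nat free \<Rightarrow> nat free" where
  "Rop q i j = lin_ext (\<lambda>w. Rop_word q w i j)"

lemma lin_Rop: "lin (Rop q i j)"
  by (simp add: Rop_def lin_lin_ext)

lemma lin_Rc: "lin f \<Longrightarrow> lin (\<lambda>x. Rop q i j (f x))" for f :: "nat free \<Rightarrow> nat free"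
  by (rule lin_comp [OF lin_Rop])

lemmas lin_rules' = lin_rules lin_Rc

lemma Rop_one: "Rop q i j 1 = 0"
  by (simp add: Rop_def)

lemma Rop_gen: "Rop q i j (gen a * t) = gen a * Rop q i j t
     + (if a = j then gen i * dg (kap q i j) t else 0)
     + (if i < a \<and> a < j then cst (inverse q - q) * (gen i * Rop q a j (dg (kap q i a) t)) else 0)"
proof (rule lin_ext_eqI [where t = t])
  fix w
  have "Rop q i j (gen a * monomial w) = Rop_word q (a # w) i j"
    by (simp add: Rop_def flip: monomial_Cons)
  then show "Rop q i j (gen a * monomial w) = gen a * Rop q i j (monomial w)
     + (if a = j then gen i * dg (kap q i j) (monomial w) else 0)
     + (if i < a \<and> a < j then cst (inverse q - q) * (gen i * Rop q a j (dg (kap q i a) (monomial w))) else 0)"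
    by (simp add: dg_monomial linD [OF lin_Rop]) (simp add: Rop_def)
qed (intro lin_rules')+

lemmas Rpush = Rop_gen dg_gen gen_cst cst_cst distrib_left right_diff_distrib
  linD [OF lin_Rop] linD [OF lin_dg]

text \<open>Peeling a letter off a word changes the index of \<open>Rop\<close> and inserts a
  diagonal operator, so identities are proved for a whole family at once. The hypothesis for
  \<open>dg \<phi> t\<close> costs nothing: on a monomial \<open>dg\<close> is a scalar.\<close>

lemma lin_family_eqI:
  assumes lin: "\<And>i. i \<in> I \<Longrightarrow> lin (f i)" "\<And>i. i \<in> I \<Longrightarrow> lin (g i)"
    and one: "\<And>i. i \<in> I \<Longrightarrow> f i 1 = g i 1"
    and gen: "\<And>a t i. (\<And>k. k \<in> I \<Longrightarrow> f k t = g k t) \<Longrightarrow> (\<And>k \<phi>. k \<in> I \<Longrightarrow> f k (dg \<phi> t) = g k (dg \<phi> t)) \<Longrightarrow>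
      i \<in> I \<Longrightarrow> f i (gen a * t) = g i (gen a * t)"
    and i: "i \<in> I"
  shows "f i t = g i t"
proof -
  have m: "\<forall>i\<in>I. f i (monomial w) = g i (monomial w)" for w
  proof (induct w)
    case (Cons a w)
    show ?case
      unfolding monomial_Cons using Cons
      by (intro ballI gen) (simp_all add: dg_monomial linD [OF lin(1)] linD [OF lin(2)])
  qed (simp add: monomial_Nil one)
  show ?thesis
    by (rule lin_ext_eqI [where t = t]) (use lin i m in auto)
qed

text \<open>The operator has weight \<epsilon>_i - \<epsilon>_j. The family is indexed by
  \<open>i\<close> with \<open>j\<close> fixed, because the recursion replaces \<open>i\<close> by
  an intermediate letter and keeps \<open>j\<close>.\<close>

lemma dg_Rop:
  assumes "i < j" "\<And>c. \<phi> c \<noteq> 0"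
  shows "dg \<phi> (Rop q i j t) = cst (\<phi> i / \<phi> j) * Rop q i j (dg \<phi> t)"
proof (rule lin_family_eqI [where f = "\<lambda>i t. dg \<phi> (Rop q i j t)" and g = "\<lambda>i t. cst (\<phi> i / \<phi> j) * Rop q i j (dg \<phi> t)" and I = "{..<j}"])
  fix a t i
  assume IH: "\<And>k \<psi>. k \<in> {..<j} \<Longrightarrow> dg \<phi> (Rop q k j (dg \<psi> t)) = cst (\<phi> k / \<phi> j) * Rop q k j (dg \<phi> (dg \<psi> t))"
    and IH': "\<And>k. k \<in> {..<j} \<Longrightarrow> dg \<phi> (Rop q k j t) = cst (\<phi> k / \<phi> j) * Rop q k j (dg \<phi> t)"
    and i: "i \<in> {..<j}"
  show "dg \<phi> (Rop q i j (gen a * t)) = cst (\<phi> i / \<phi> j) * Rop q i j (dg \<phi> (gen a * t))"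
    using i assms(2) by (auto simp: Rpush IH IH' dg_commute [of \<phi>] mult_ac)
qed (use assms in \<open>auto intro!: lin_rules' simp: Rop_one dg_one linD [OF lin_dg]\<close>)

lemma dg_Rop_kap:
  assumes "q \<noteq> 0" "i < j"
  shows "dg (kap q k l) (Rop q i j t) = cst (kap q k l i / kap q k l j) * Rop q i j (dg (kap q k l) t)"
  by (rule dg_Rop) (use assms in \<open>auto simp: kap_def\<close>)

lemma E_Rop_commute:
  assumes q: "q \<noteq> 0" and "Suc i < b" "b < j"
  shows "Rop q i (Suc i) (Rop q b j t) = Rop q b j (Rop q i (Suc i) t)"
proof (rule lin_family_eqI [where f = "\<lambda>b t. Rop q i (Suc i) (Rop q b j t)" and g = "\<lambda>b t. Rop q b j (Rop q i (Suc i) t)" and I = "{Suc i<..<j}"])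
  fix c t b
  assume IH: "\<And>k. k \<in> {Suc i<..<j} \<Longrightarrow> Rop q i (Suc i) (Rop q k j t) = Rop q k j (Rop q i (Suc i) t)"
    and IH': "\<And>k \<phi>. k \<in> {Suc i<..<j} \<Longrightarrow> Rop q i (Suc i) (Rop q k j (dg \<phi> t)) = Rop q k j (Rop q i (Suc i) (dg \<phi> t))"
    and b: "b \<in> {Suc i<..<j}"
  show "Rop q i (Suc i) (Rop q b j (gen c * t)) = Rop q b j (Rop q i (Suc i) (gen c * t))"
    using q b by (auto simp: Rpush IH IH' dg_Rop_kap kap_def)
qed (use assms in \<open>auto intro!: lin_rules' simp: Rop_one linD [OF lin_Rop]\<close>)

lemma kap_mult: "q \<noteq> 0 \<Longrightarrow> i \<noteq> j \<Longrightarrow> j \<noteq> k \<Longrightarrow> i \<noteq> k \<Longrightarrow> kap q i j c * kap q j k c = kap q i k c"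
  by (auto simp: kap_def)

text \<open>The recursion X = v^-1 E X - X E of the root vectors becomes E R - q R E after
  multiplication by v^(j-i-1), so this lemma certifies the closed form given by
  \<open>Rop_word\<close>. When a letter is peeled off, the terms with an intermediate letter match
  because E_i commutes with the root vectors that start beyond \<open>Suc i\<close>.\<close>

lemma Rop_step:
  assumes q: "q \<noteq> 0" and ij: "Suc i < j"
  shows "Rop q i j t = Rop q i (Suc i) (Rop q (Suc i) j t) - cst q * Rop q (Suc i) j (Rop q i (Suc i) t)"
proof (rule lin_eqI [where t = t])
  fix c t
  assume IH: "Rop q i j t = Rop q i (Suc i) (Rop q (Suc i) j t) - cst q * Rop q (Suc i) j (Rop q i (Suc i) t)"
  have kk: "dg (kap q i (Suc i)) (dg (kap q (Suc i) k) t) = dg (kap q i k) t" if "Suc i < k" for k t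
    using q that by (simp add: dg_dg kap_mult)
  show "Rop q i j (gen c * t) = Rop q i (Suc i) (Rop q (Suc i) j (gen c * t)) - cst q * Rop q (Suc i) j (Rop q i (Suc i) (gen c * t))"
    using q ij
    by (cases "c = Suc i"; cases "c = j"; cases "Suc i < c \<and> c < j")
       (auto simp: Rpush IH dg_Rop_kap kap_def [of q _ _ "Suc i"] kap_def [of q _ _ i] kap_def [of q _ _ j] kap_def [of q _ _ c] inverse_eq_divide E_Rop_commute kk cst_diff algebra_simps)
qed (auto intro!: lin_rules' simp: Rop_one linD [OF lin_Rop])

text \<open>Roots with the same end \<open>j\<close> q-commute, which allows the factors of a power
  of \<open>Rop q i j\<close> to be collected. The peeled letter can replace \<open>i\<close> as
  well as \<open>a\<close>, so the family is indexed by pairs.\<close>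

lemma Rop_Rop_commute:
  assumes q: "q \<noteq> 0" and "i < a" "a < j"
  shows "Rop q i j (Rop q a j t) = cst (inverse q) * Rop q a j (Rop q i j t)"
proof -
  have "(case p of (i, a) \<Rightarrow> Rop q i j (Rop q a j t)) = (case p of (i, a) \<Rightarrow> cst (inverse q) * Rop q a j (Rop q i j t))"
    if "p \<in> {(i, a). i < a \<and> a < j}" for p
  proof (rule lin_family_eqI [where f = "\<lambda>p t. case p of (i, a) \<Rightarrow> Rop q i j (Rop q a j t)" and
        g = "\<lambda>p t. case p of (i, a) \<Rightarrow> cst (inverse q) * Rop q a j (Rop q i j t)" and I = "{(i, a). i < a \<and> a < j}"])
    fix c t p
    assume "\<And>k. k \<in> {(i, a). i < a \<and> a < j} \<Longrightarrow> (case k of (i, a) \<Rightarrow> Rop q i j (Rop q a j t)) = (case k of (i, a) \<Rightarrow> cst (inverse q) * Rop q a j (Rop q i j t))"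
      and "\<And>k \<phi>. k \<in> {(i, a). i < a \<and> a < j} \<Longrightarrow> (case k of (i, a) \<Rightarrow> Rop q i j (Rop q a j (dg \<phi> t))) = (case k of (i, a) \<Rightarrow> cst (inverse q) * Rop q a j (Rop q i j (dg \<phi> t)))"
    then have IH: "\<And>i a. i < a \<Longrightarrow> a < j \<Longrightarrow> Rop q i j (Rop q a j t) = cst (inverse q) * Rop q a j (Rop q i j t)"
      and IH': "\<And>i a \<phi>. i < a \<Longrightarrow> a < j \<Longrightarrow> Rop q i j (Rop q a j (dg \<phi> t)) = cst (inverse q) * Rop q a j (Rop q i j (dg \<phi> t))"
      by auto
    assume p: "p \<in> {(i, a). i < a \<and> a < j}"
    obtain i a where pia: "p = (i, a)" "i < a" "a < j"
      using p by auto
    have kk: "dg (kap q i a) (dg (kap q a k) t) = dg (kap q i k) t" if "i < a" "a < k" for i a k t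
      using q that by (simp add: dg_dg kap_mult)
    have qq: "q * (inverse q * x) = x" "inverse q * (q * x) = x" for x
      using q by (simp_all flip: mult.assoc)
    consider "c = j" | "c = a" | "i < c" "c < a" | "a < c" "c < j" | "c \<le> i \<or> j < c"
      using pia(2,3) by linarith
    then have "Rop q i j (Rop q a j (gen c * t)) = cst (inverse q) * Rop q a j (Rop q i j (gen c * t))"
    proof cases
      case 1
      then show ?thesis
        using q pia(2,3) by (auto simp: Rpush IH IH' dg_Rop_kap kap_def [of q _ _ a] kap_def [of q _ _ i] kap_def [of q _ _ j] kk cst_diff divide_inverse algebra_simps)
    next
      case 2
      then show ?thesis
        using q pia(2,3) by (auto simp: Rpush IH IH' dg_Rop_kap kap_def [of q _ _ a] kap_def [of q _ _ i] kap_def [of q _ _ j] kk cst_diff algebra_simps)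
    next
      case 3
      then show ?thesis
        using q pia(2,3) by (auto simp: Rpush IH IH' dg_Rop_kap kap_def [of q _ _ a] kap_def [of q _ _ i] kap_def [of q _ _ j] kk cst_diff algebra_simps)
    next
      case 4
      then show ?thesis
        using q pia(2,3) by (auto simp: Rpush IH IH' dg_Rop_kap kap_def [of q _ _ a] kap_def [of q _ _ i] kap_def [of q _ _ j] kap_def [of q _ _ c] kk cst_diff qq algebra_simps)
    next
      case 5
      then show ?thesis
        using q pia(2,3) by (auto simp: Rpush IH)
    qed
    then show "(case p of (i, a) \<Rightarrow> Rop q i j (Rop q a j (gen c * t))) = (case p of (i, a) \<Rightarrow> cst (inverse q) * Rop q a j (Rop q i j (gen c * t)))"
      by (simp add: pia)
  qed (use that in \<open>auto intro!: lin_rules' simp: Rop_one linD [OF lin_Rop]\<close>)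
  from this [of "(i, a)"] show ?thesis
    using assms by simp
qed

locale v_or_inverse =
  fixes q :: qv
  assumes q_cases: "q = v \<or> q = inverse v"
begin

lemma q_nz [simp]: "q \<noteq> 0"
  using q_cases by auto

lemma q_powi_Laurent: "q powi k \<in> Laurent"
proof -
  have "inverse v powi k = v powi (- k)"
    by (simp add: power_int_minus power_int_inverse)
  then show ?thesis
    using q_cases Laurent_powi_v by metis
qed

lemma q_Laurent: "q \<in> Laurent" "inverse q \<in> Laurent"
  using q_cases Laurent_v by auto

lemma q_powi_unit: "Laurent_unit (q powi k)"
  using q_powi_Laurent [of "- k"] by (simp add: Laurent_unit_def q_powi_Laurent power_int_minus)

lemma kap_Laurent: "kap q i j c \<in> Laurent"
  by (simp add: kap_def q_Laurent Laurent_1)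

text \<open>Invariance under the exchange of \<open>v\<close> and v^-1 lets both choices of
  \<open>q\<close> share \<open>qint\<close> and \<open>qfact\<close>.\<close>

lemma qint_symmetric: "qint m = (q ^ m - inverse q ^ m) / (q - inverse q)"
proof -
  have "(inverse v ^ m - v ^ m) / (inverse v - v) = - (v ^ m - inverse v ^ m) / - (v - inverse v)"
    by simp
  also have "\<dots> = qint m"
    unfolding qint_def by (rule minus_divide_divide)
  finally show ?thesis
    using q_cases by (auto simp: qint_def)
qed

lemma qint_Suc: "qint (Suc m) = q ^ m + inverse q * qint m" "qint (Suc m) = inverse q ^ m + q * qint m"
proof -
  have d: "q - inverse q \<noteq> 0"
    using q_cases v_nonunit(2) by auto
  show "qint (Suc m) = q ^ m + inverse q * qint m" "qint (Suc m) = inverse q ^ m + q * qint m"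
    unfolding qint_symmetric using d by (simp_all add: field_simps)
qed

text \<open>At most one of the \<open>m\<close> factors acts on the first letter, since that letter
  then is \<open>i\<close> and is left alone afterwards. Summing over the factor that does so gives
  a geometric sum: steps of q^2 if \<open>a = j\<close>, where only the diagonal operator is moved;
  steps of \<open>q\<close> combined with q^-1 from \<open>Rop_Rop_commute\<close> if
  \<open>a\<close> is intermediate. Both sums contain \<open>qint m\<close>, which also kills these
  terms for \<open>m = 0\<close>, where \<open>m - 1\<close> is truncated.\<close>

lemma Rop_power_gen:
  assumes "i < j"
  shows "(Rop q i j ^^ m) (gen a * t) = gen a * (Rop q i j ^^ m) t
     + (if a = j then cst (q ^ (m - 1) * qint m) * (gen i * (Rop q i j ^^ (m - 1)) (dg (kap q i j) t)) else 0)
     + (if i < a \<and> a < j then cst ((inverse q - q) * qint m) * (gen i * Rop q a j ((Rop q i j ^^ (m - 1)) (dg (kap q i a) t))) else 0)"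
proof (induct m)
  case (Suc m)
  have dj: "dg (kap q i j) ((Rop q i j ^^ m) t) = cst (q ^ (2 * m)) * (Rop q i j ^^ m) (dg (kap q i j) t)" for m t
    by (induct m) (use assms in \<open>simp_all add: dg_Rop_kap linD [OF lin_Rop] cst_cst kap_def [of q i j i] kap_def [of q i j j] divide_inverse mult_ac\<close>)
  have da: "dg (kap q i a) ((Rop q i j ^^ m) t) = cst (q ^ m) * (Rop q i j ^^ m) (dg (kap q i a) t)" if "i < a" "a < j" for m t
    by (induct m) (use assms that in \<open>simp_all add: dg_Rop_kap linD [OF lin_Rop] cst_cst kap_def [of q i a i] kap_def [of q i a j] divide_inverse mult_ac\<close>)
  have 1: "(Rop q i j ^^ Suc m) (gen a * t) = Rop q i j ((Rop q i j ^^ m) (gen a * t))"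
    by simp
  consider (j) "a = j" | (a) "i < a" "a < j" | (none) "a \<le> i \<or> j < a"
    using assms by linarith
  then show ?case
  proof cases
    case j
    show ?thesis
    proof (cases m)
      case 0
      then show ?thesis
        using j assms by (simp add: Rpush Rop_gen)
    next
      case (Suc k)
      then have Rop: "Rop q i j ((Rop q i j ^^ (m - 1)) t) = (Rop q i j ^^ m) t" for t
        by simp
      have "q ^ (2 * m) + q ^ (m - 1) * qint m = q ^ m * qint (Suc m)"
        by (simp add: Suc qint_Suc(1) [of "Suc k"] algebra_simps power_mult power2_eq_square mult_2 power_add)
      then show ?thesis
        unfolding 1 Suc.hyps using j assms
        by (simp add: Rpush dj Rop [simplified] add.assoc flip: cst_add distrib_right)
    qed
  next
    case a
    show ?thesis
    proof (cases m)
      case 0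
      then show ?thesis
        using a assms by (simp add: Rpush Rop_gen)
    next
      case (Suc k)
      then have Rop: "Rop q i j ((Rop q i j ^^ (m - 1)) t) = (Rop q i j ^^ m) t" for t
        by simp
      have "(inverse q - q) * q ^ m + (inverse q - q) * qint m * inverse q = (inverse q - q) * qint (Suc m)"
        by (simp add: Suc qint_Suc(1) [of "Suc k"] algebra_simps)
      then show ?thesis
        unfolding 1 Suc.hyps using a assms
        by (simp add: Rpush da Rop_Rop_commute Rop [simplified] add.assoc flip: cst_add distrib_right)
    qed
  next
    case none
    then show ?thesis
      unfolding 1 Suc.hyps using assms by (auto simp: Rpush)
  qed
qed simp

section \<open>Integrality of the divided powers\<close>

definition Lat :: "'a free set" where
  "Lat = {t. \<forall>w. Poly_Mapping.lookup t w \<in> Laurent}"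

lemma Lat_closed:
  "0 \<in> Lat" "s \<in> Lat \<Longrightarrow> t \<in> Lat \<Longrightarrow> s + t \<in> Lat" "c \<in> Laurent \<Longrightarrow> t \<in> Lat \<Longrightarrow> cst c * t \<in> Lat" "monomial w \<in> Lat"
  by (auto simp: Lat_def lookup_add lookup_cst_mult monomial_def lookup_single when_def intro: Laurent_intros)

lemma Lat_sum: "(\<And>i. i \<in> I \<Longrightarrow> f i \<in> Lat) \<Longrightarrow> sum f I \<in> Lat"
  by (induct I rule: infinite_finite_induct) (simp_all add: Lat_closed)

lemma Lat_lin:
  assumes "lin f" "\<And>w. f (monomial w) \<in> Lat" "t \<in> Lat"
  shows "f t \<in> Lat"
proof -
  have "f t = (\<Sum>w\<in>Poly_Mapping.keys t. cst (Poly_Mapping.lookup t w) * f (monomial (letters w)))"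
    by (subst free_expand [of t]) (simp only: linD(2,6) [OF assms(1)])
  also have "\<dots> \<in> Lat"
    by (intro Lat_sum Lat_closed(3) assms(2)) (use assms(3) in \<open>simp add: Lat_def\<close>)
  finally show ?thesis .
qed

lemma Lat_gen: "t \<in> Lat \<Longrightarrow> gen a * t \<in> Lat"
  by (rule Lat_lin [where f = "\<lambda>t. gen a * t"]) (auto intro!: lin_rules Lat_closed simp flip: monomial_Cons)

lemma dg_kap_Lat: "t \<in> Lat \<Longrightarrow> dg (kap q i j) t \<in> Lat"
  by (rule Lat_lin [OF lin_dg])
     (auto simp: dg_monomial kap_Laurent intro!: Lat_closed Laurent_prod_list)

lemma Rop_Lat: "t \<in> Lat \<Longrightarrow> Rop q i j t \<in> Lat"
proof (rule Lat_lin [OF lin_Rop])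
  show "Rop q i j (monomial w) \<in> Lat" for w
  proof (induct w arbitrary: i)
    case (Cons a w)
    then have "Rop q k l (dg (kap q i' j') (monomial w)) \<in> Lat" if "l = j" for k l i' j'
      using that by (simp add: dg_monomial linD [OF lin_Rop]) (intro Lat_closed Laurent_prod_list; auto simp: kap_Laurent)
    then show ?case
      using Cons by (auto simp: monomial_Cons Rop_gen q_Laurent intro!: Lat_closed Lat_gen dg_kap_Lat Laurent_intros)
  qed (simp add: monomial_Nil Rop_one Lat_closed)
qed

lemma lin_Rop_power: "lin (Rop q i j ^^ m)"
proof (induct m)
  case 0
  then show ?case by (simp add: lin_def)
next
  case (Suc m)
  then show ?case using lin_Rc [OF Suc] by (simp add: comp_def)
qed

lemma Rop_divided_Lat:
  assumes "i < j" "t \<in> Lat"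
  shows "cst (1 / qfact m) * (Rop q i j ^^ m) t \<in> Lat"
proof (rule Lat_lin [where f = "\<lambda>t. cst (1 / qfact m) * (Rop q i j ^^ m) t", OF lin_cmult [OF lin_Rop_power] _ assms(2)])
  show "cst (1 / qfact m) * (Rop q i j ^^ m) (monomial w) \<in> Lat" for w
  proof (induct w arbitrary: m)
    case Nil
    show ?case
    proof (cases m)
      case (Suc k)
      have "(Rop q i j ^^ m) 1 = 0"
        unfolding Suc by (induct k) (simp_all add: Rop_one linD [OF lin_Rop])
      then show ?thesis by (simp add: monomial_Nil Lat_closed)
    qed (use Lat_closed(4) in simp)
  next
    case (Cons a w)
    show ?case
    proof (cases m)
      case 0
      then show ?thesis using Lat_closed(4) by simp
    next
      case (Suc k)
      have d: "cst (1 / qfact k) * (Rop q i j ^^ k) (dg (kap q i' j') (monomial w)) \<in> Lat" for i' j'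
      proof -
        have "cst (1 / qfact k) * (Rop q i j ^^ k) (dg (kap q i' j') (monomial w))
          = cst (prod_list (map (kap q i' j') w)) * (cst (1 / qfact k) * (Rop q i j ^^ k) (monomial w))"
          by (simp add: dg_monomial linD [OF lin_Rop_power] cst_cst mult.commute)
        also have "\<dots> \<in> Lat"
          by (intro Lat_closed(3) Cons Laurent_prod_list) (auto simp: kap_Laurent)
        finally show ?thesis .
      qed
      \<comment> \<open>The quantum integer from \<open>Rop_power_gen\<close> turns division by
        \<open>qfact (Suc k)\<close> into division by \<open>qfact k\<close>, so the induction
        hypothesis for the exponent \<open>k\<close> applies to the shorter word.\<close>
      have c: "x * qint (Suc k) / qfact (Suc k) = x / qfact k" for x
        using qfact_nz qint_nz by (simp add: qfact_Suc)
      define D where "D m t = cst (1 / qfact m) * (Rop q i j ^^ m) t" for m t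
      have "D m (monomial (a # w)) = gen a * D m (monomial w)
        + (if a = j then cst (q ^ k) * (gen i * D k (dg (kap q i j) (monomial w))) else 0)
        + (if i < a \<and> a < j then cst (inverse q - q) * (gen i * Rop q a j (D k (dg (kap q i a) (monomial w)))) else 0)"
        unfolding D_def Suc monomial_Cons Rop_power_gen [OF assms(1)]
        by (simp add: distrib_left cst_cst gen_cst linD [OF lin_Rop] c del: funpow.simps)
      moreover have "D m (monomial w) \<in> Lat" "D k (dg (kap q i' j') (monomial w)) \<in> Lat" for i' j'
        using Cons d unfolding D_def .
      ultimately have "D m (monomial (a # w)) \<in> Lat"
        by (auto intro!: Lat_closed Lat_gen Rop_Lat Laurent_intros q_Laurent)
      then show ?thesis
        by (simp add: D_def)
    qed
  qed
qed

end

section \<open>The Hecke operators\<close>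

text \<open>The Hecke generator at the positions \<open>k\<close> and \<open>Suc k\<close>, counted
  from 0, normalized by (T - q^-1)(T + q) = 0. Positions beyond the end of the word give the
  identity, so that commutation can be stated for all \<open>k\<close>.\<close>

fun Hecke_word :: "qv \<Rightarrow> nat \<Rightarrow> nat list \<Rightarrow> nat free" where
  "Hecke_word q 0 (a # b # w) = (if a = b then cst (inverse q) * monomial (a # b # w) else
     monomial (b # a # w) + (if a < b then cst (inverse q - q) * monomial (a # b # w) else 0))"
| "Hecke_word q (Suc k) (a # w) = gen a * Hecke_word q k w"
| "Hecke_word q k w = monomial w"

definition Hecke :: "qv \<Rightarrow> nat \<Rightarrow> nat free \<Rightarrow> nat free" where
  "Hecke q k = lin_ext (Hecke_word q k)"

lemma lin_Hecke: "lin (Hecke q k)"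
  by (simp add: Hecke_def lin_lin_ext)

lemma lin_Tc: "lin f \<Longrightarrow> lin (\<lambda>x. Hecke q k (f x))" for f :: "nat free \<Rightarrow> nat free"
  by (rule lin_comp [OF lin_Hecke])

lemmas lin_rules'' = lin_rules' lin_Tc

lemma Hecke_monomial: "Hecke q k (monomial w) = Hecke_word q k w"
  by (simp add: Hecke_def)

lemma Hecke_one: "Hecke q k 1 = 1"
  by (cases k) (simp_all add: Hecke_def monomial_Nil)

lemma Hecke_0_gen: "Hecke q 0 (gen a) = gen a"
  using Hecke_monomial [of q 0 "[a]"] by (simp add: monomial_Nil monomial_Cons)

lemma Hecke_Suc_gen: "Hecke q (Suc k) (gen a * t) = gen a * Hecke q k t"
  by (rule lin_ext_eqI [where t = t]) (auto intro!: lin_rules'' simp: Hecke_monomial simp flip: monomial_Cons)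

lemma Hecke_0_gen_gen: "Hecke q 0 (gen a * (gen b * t)) = (if a = b then cst (inverse q) * (gen a * (gen b * t)) else
     gen b * (gen a * t) + (if a < b then cst (inverse q - q) * (gen a * (gen b * t)) else 0))"
  by (rule lin_ext_eqI [where t = t]) (auto intro!: lin_rules'' simp: Hecke_monomial simp flip: monomial_Cons)

lemmas Hecke_push = Hecke_0_gen_gen Hecke_Suc_gen linD [OF lin_Hecke]

text \<open>The eigenvalue of \<open>dg\<close> on a word depends only on the multiset of its
  letters, which Hecke operators preserve.\<close>

lemma Hecke_dg: "Hecke q k (dg \<phi> t) = dg \<phi> (Hecke q k t)"
proof (rule lin_ext_eqI [where t = t])
  show "Hecke q k (dg \<phi> (monomial w)) = dg \<phi> (Hecke q k (monomial w))" for w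
    by (induct q k w rule: Hecke_word.induct)
       (auto simp: monomial_Nil monomial_Cons dg_one Hecke_one Hecke_0_gen Hecke_push Rpush dg_gen [where t = 1, simplified] mult.commute)
qed (intro lin_rules'')+

lemma E_gen: "Rop q i (Suc i) (gen a * t) = gen a * Rop q i (Suc i) t + (if a = Suc i then gen i * dg (kap q i a) t else 0)"
  by (auto simp: Rop_gen)

lemmas E_push = E_gen dg_gen gen_cst cst_cst distrib_left right_diff_distrib
  linD [OF lin_Rop] linD [OF lin_dg]

text \<open>After the letters before position \<open>k\<close> are peeled off, a simple root vector
  acts on the first letter, on the second, or on the rest of \<open>a # b # w\<close>. What remains
  is a finite check on how \<open>a\<close> and \<open>b\<close> compare with \<open>i\<close> and
  \<open>Suc i\<close>.\<close>

lemma Hecke_E: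
  assumes "q \<noteq> 0"
  shows "Hecke q k (Rop q i (Suc i) t) = Rop q i (Suc i) (Hecke q k t)"
proof (rule lin_ext_eqI [where t = t])
  have e: "Rop q i (Suc i) (gen a) = (if a = Suc i then gen i else 0)" for q a
    using Rop_gen [of q i "Suc i" a 1] by (auto simp: Rop_one dg_one)
  have "q \<noteq> 0 \<Longrightarrow> Hecke q k (Rop q i (Suc i) (monomial w)) = Rop q i (Suc i) (Hecke q k (monomial w))" for q w
  proof (induct q k w rule: Hecke_word.induct)
    case (1 q a b w)
    then show ?case
      by (cases "a = i"; cases "a = Suc i"; cases "b = i"; cases "b = Suc i")
         (simp_all add: monomial_Cons Hecke_push E_push kap_def [of q i "Suc i" a] kap_def [of q i "Suc i" b]
            kap_def [of q i "Suc i" i] kap_def [of q i "Suc i" "Suc i"] cst_diff algebra_simps)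
  qed (auto simp: monomial_Nil monomial_Cons e Rop_one Hecke_one Hecke_0_gen Hecke_push E_push Hecke_dg)
  then show "Hecke q k (Rop q i (Suc i) (monomial w)) = Rop q i (Suc i) (Hecke q k (monomial w))" for w
    using assms .
qed (intro lin_rules'')+

text \<open>By \<open>Rop_step\<close> every root vector is an iterated q-commutator of simple
  ones.\<close>

lemma Hecke_Rop:
  assumes "q \<noteq> 0" "i < j"
  shows "Hecke q k (Rop q i j t) = Rop q i j (Hecke q k t)"
  using assms(2)
proof (induct "j - i" arbitrary: i t rule: less_induct)
  case less
  show ?case
  proof (cases "Suc i = j")
    case True
    then show ?thesis using Hecke_E [OF assms(1)] by blast
  next
    case False
    then show ?thesis
      using less.prems assms(1) by (simp add: Rop_step Hecke_push Hecke_E less.hyps)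
  qed
qed

definition swap :: "nat \<Rightarrow> 'a list \<Rightarrow> 'a list" where
  "swap k w = w[k := w ! Suc k, Suc k := w ! k]"

lemma letters_eq: "letters u = w \<longleftrightarrow> u = Word w"
  by (cases u) simp

text \<open>A word with a descent at \<open>k\<close> arises only by exchanging the corresponding
  ascent: words with equal letters or with a descent there are sent to words without a descent at
  \<open>k\<close>.\<close>

lemma cf_Hecke:
  assumes "Suc k < length w" "w ! Suc k < w ! k"
  shows "cf (Hecke q k t) w = cf t (swap k w)"
proof -
  have "Suc k < length w \<longrightarrow> w ! Suc k < w ! k \<longrightarrow> cf (Hecke_word q k u) w = (if u = swap k w then 1 else 0)" for u
  proof (induct q k u arbitrary: w rule: Hecke_word.induct)
    case (1 q a b u)
    show ?case
      by (cases w; cases "tl w") (auto simp: cf_monomial cf_simps swap_def)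
  next
    case (2 q k a u)
    then show ?case
      by (cases w) (auto simp: cf_gen_Cons swap_def)
  qed (auto simp: cf_monomial swap_def Suc_length_conv dest!: arg_cong [where f = length])
  then have *: "cf (Hecke q k (monomial u)) w = (if u = swap k w then 1 else 0)" for u
    using assms by (simp add: Hecke_monomial)
  show ?thesis
    by (subst cf_lin [OF lin_Hecke]) (simp add: * letters_eq in_keys_iff if_distrib [of "\<lambda>x. _ * x"] cong: if_cong)
qed

section \<open>The filtration by moves\<close>

definition kprod :: "qv \<Rightarrow> nat \<Rightarrow> nat \<Rightarrow> nat list \<Rightarrow> qv" where
  "kprod q i j w = prod_list (map (kap q i j) w)"

lemma cf_Rop_Cons: "cf (Rop q i j (monomial (a # b))) (c # d) =
   (if a = c then cf (Rop q i j (monomial b)) d else 0) +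
   (if a = j \<and> c = i \<and> b = d then kprod q i j b else 0) +
   (if i < a \<and> a < j \<and> c = i then (inverse q - q) * kprod q i a b * cf (Rop q a j (monomial b)) d else 0)"
  by (auto simp: monomial_Cons Rop_gen dg_monomial linD [OF lin_Rop] cf_simps cf_gen_Cons cf_monomial kprod_def)

lemma cf_Rop_Nil: "cf (Rop q i j (monomial b)) [] = 0" "cf (Rop q i j (monomial [])) d = 0"
proof -
  show "cf (Rop q i j (monomial [])) d = 0" for d
    by (simp add: monomial_Nil Rop_one)
  then show "cf (Rop q i j (monomial b)) [] = 0"
    by (cases b) (auto simp: monomial_Cons Rop_gen cf_simps cf_gen_Nil)
qed

text \<open>The coproduct lets the operator move several letters along a chain from \<open>j\<close>
  down to \<open>i\<close>. Each move lowers a letter, and in total one \<open>j\<close> is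
  exchanged for one \<open>i\<close>.\<close>

lemma Rop_support:
  assumes "i < j" "cf (Rop q i j (monomial b)) b' \<noteq> 0"
  shows "list_all2 (\<le>) b' b" "j \<in> set b" "mset b' + {#j#} = mset b + {#i#}"
proof -
  have "list_all2 (\<le>) b' b \<and> j \<in> set b \<and> mset b' + {#j#} = mset b + {#i#}"
    using assms
  proof (induct b arbitrary: i b')
    case Nil
    then show ?case by (simp add: cf_Rop_Nil)
  next
    case (Cons a b)
    obtain c d where b': "b' = c # d"
      using Cons.prems(2) cf_Rop_Nil(1) by (cases b') auto
    from Cons.prems(2) consider
      "a = c" "cf (Rop q i j (monomial b)) d \<noteq> 0" | "a = j" "c = i" "b = d" |
      "i < a" "a < j" "c = i" "cf (Rop q a j (monomial b)) d \<noteq> 0"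
      by (auto simp: b' cf_Rop_Cons split: if_splits)
    then show ?case
    proof cases
      case 1
      then show ?thesis
        using Cons.hyps [OF Cons.prems(1), of d] by (auto simp: b')
    next
      case 2
      then show ?thesis
        using Cons.prems(1) by (auto simp: b' list_all2_refl)
    next
      case 3
      then show ?thesis
        using Cons.hyps [of a d] by (auto simp: b')
    qed
  qed
  then show "list_all2 (\<le>) b' b" "j \<in> set b" "mset b' + {#j#} = mset b + {#i#}"
    by auto
qed

text \<open>
  A word \<open>b\<close> below a descending word \<open>os\<close> is recorded by the multiset of the pairs \<open>(os ! p, b ! p)\<close>, that is,
  by a matrix. The weight of a pair is chosen so that moving a letter for the first time counts most, and, among
  these moves, shorter ones count more; strict concavity makes chains of moves strictly smaller
  than the direct move, unless they take place inside one block of equal letters of \<open>os\<close>.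
\<close>

definition move_weight :: "int \<Rightarrow> nat \<times> nat \<Rightarrow> int" where
  "move_weight C = (\<lambda>(x, c). if x = c then 0 else C - (int x - int c)\<^sup>2)"

definition stat :: "int \<Rightarrow> (nat \<times> nat) multiset \<Rightarrow> int" where
  "stat C P = (\<Sum>p\<in>#P. move_weight C p)"

abbreviation pair_mset :: "nat list \<Rightarrow> nat list \<Rightarrow> (nat \<times> nat) multiset" where
  "pair_mset os b \<equiv> mset (zip os b)"

lemma stat_add [simp]: "stat C (P + Q) = stat C P + stat C Q" "stat C (add_mset p P) = move_weight C p + stat C P" "stat C {#} = 0"
  by (simp_all add: stat_def)

lemma square_mono_int: "0 \<le> a \<Longrightarrow> a < b \<Longrightarrow> a\<^sup>2 < (b::int)\<^sup>2"
  by (simp add: power_strict_mono)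

text \<open>A letter \<open>j\<close> that sits in the block of \<open>x\<close> is moved on to
  \<open>i\<close>. If \<open>x\<close> differs from \<open>j\<close>, it has been moved before, so
  the pair gains no further \<open>C\<close>; the bound on the right gains C - (j-i)^2, which is
  positive because \<open>C\<close> exceeds n^2.\<close>

lemma move_weight_direct:
  assumes "int n ^ 2 < C" "i < j" "j \<le> x" "x \<le> n"
  shows "move_weight C (x, i) \<le> move_weight C (x, j) + move_weight C (j, i)"
    "move_weight C (x, i) = move_weight C (x, j) + move_weight C (j, i) \<Longrightarrow> x = j"
proof -
  have "move_weight C (x, i) < move_weight C (x, j) + move_weight C (j, i)" if "x \<noteq> j"
  proof -
    have "(int j - int i)\<^sup>2 \<le> (int n)\<^sup>2"
      using assms by (intro power_mono) auto
    moreover have "(int x - int j)\<^sup>2 < (int x - int i)\<^sup>2"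
      using assms by (intro square_mono_int) auto
    moreover have "move_weight C (x, i) = C - (int x - int i)\<^sup>2" "move_weight C (x, j) = C - (int x - int j)\<^sup>2" "move_weight C (j, i) = C - (int j - int i)\<^sup>2"
      using assms that by (auto simp: move_weight_def)
    ultimately show ?thesis
      using assms(1) by linarith
  qed
  then show "move_weight C (x, i) \<le> move_weight C (x, j) + move_weight C (j, i)" "move_weight C (x, i) = move_weight C (x, j) + move_weight C (j, i) \<Longrightarrow> x = j"
    using assms by (cases "x = j", auto simp: move_weight_def)+
qed

text \<open>All four pairs are off the diagonal, so \<open>C\<close> cancels and the difference of
  the two sides is the mixed second difference 2 (a-i) (x-j) of the squares.\<close>

lemma move_weight_chain:
  assumes "i < a" "a < j" "j \<le> x"
  shows "move_weight C (x, i) + move_weight C (j, a) \<le> move_weight C (x, a) + move_weight C (j, i)"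
    "move_weight C (x, i) + move_weight C (j, a) = move_weight C (x, a) + move_weight C (j, i) \<Longrightarrow> x = j"
proof -
  have "move_weight C (x, a) + move_weight C (j, i) - (move_weight C (x, i) + move_weight C (j, a)) = 2 * (int a - int i) * (int x - int j)"
    using assms by (simp add: move_weight_def) (simp add: power2_eq_square algebra_simps)
  moreover have "(int a - int i) * (int x - int j) \<ge> 0" "(int a - int i) * (int x - int j) = 0 \<Longrightarrow> x = j"
    using assms by auto
  ultimately show "move_weight C (x, i) + move_weight C (j, a) \<le> move_weight C (x, a) + move_weight C (j, i)"
    "move_weight C (x, i) + move_weight C (j, a) = move_weight C (x, a) + move_weight C (j, i) \<Longrightarrow> x = j"
    by linarith+
qed

text \<open>The peeled letter stays, moves directly, or is the last link of a chain; the last two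
  cases are bounded by \<open>move_weight_direct\<close> and \<open>move_weight_chain\<close>.
  Equality forces every change to lie in the block of \<open>j\<close>. The last clause remembers
  the first changed position: either it is the only change, or a letter larger than \<open>i\<close>
  was left further right in the same block. This will exclude chains when the leading coefficient is
  computed.\<close>

lemma Rop_stat:
  assumes "sorted_wrt (\<ge>) os" "list_all2 (\<le>) b os" "\<And>x. x \<in> set os \<Longrightarrow> x \<le> n" "int n ^ 2 < C"
    "i < j" "cf (Rop q i j (monomial b)) b' \<noteq> 0"
  shows "stat C (pair_mset os b') \<le> stat C (pair_mset os b) + move_weight C (j, i)"
    "stat C (pair_mset os b') = stat C (pair_mset os b) + move_weight C (j, i) \<Longrightarrow>
       pair_mset os b' + {#(j, j)#} = pair_mset os b + {#(j, i)#} \<and>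
       (\<exists>p<length os. os ! p = j \<and> b' ! p = i \<and> (b ! p = j \<and> b' = b[p := i] \<or>
          (\<exists>p'>p. p' < length os \<and> os ! p' = j \<and> i < b' ! p')))"
proof -
  have "stat C (pair_mset os b') \<le> stat C (pair_mset os b) + move_weight C (j, i) \<and>
    (stat C (pair_mset os b') = stat C (pair_mset os b) + move_weight C (j, i) \<longrightarrow>
       pair_mset os b' + {#(j, j)#} = pair_mset os b + {#(j, i)#} \<and>
       (\<exists>p<length os. os ! p = j \<and> b' ! p = i \<and> (b ! p = j \<and> b' = b[p := i] \<or>
          (\<exists>p'>p. p' < length os \<and> os ! p' = j \<and> i < b' ! p'))))"
    (is "?le os b' b i \<and> (?eq os b' b i \<longrightarrow> ?mset os b' b i \<and> ?ex os b' b i)")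
    using assms(1,2,3,5,6)
  proof (induct b arbitrary: i b' os)
    case Nil
    then show ?case by (simp add: cf_Rop_Nil)
  next
    case (Cons a b)
    obtain c d where b': "b' = c # d"
      using Cons.prems(5) cf_Rop_Nil(1) by (cases b') auto
    obtain x xs where os: "os = x # xs"
      using Cons.prems(2) by (cases os) auto
    have xs: "sorted_wrt (\<ge>) xs" "list_all2 (\<le>) b xs" "\<And>y. y \<in> set xs \<Longrightarrow> y \<le> n"
      and x: "a \<le> x" "x \<le> n" "\<And>y. y \<in> set xs \<Longrightarrow> y \<le> x"
      using Cons.prems by (auto simp: os)
    from Cons.prems(5) consider
      "a = c" "cf (Rop q i j (monomial b)) d \<noteq> 0" | "a = j" "c = i" "b = d" |
      "i < a" "a < j" "c = i" "cf (Rop q a j (monomial b)) d \<noteq> 0"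
      by (auto simp: b' cf_Rop_Cons split: if_splits)
    then show ?case
    proof cases
      case 1
      note IH = Cons.hyps [OF xs Cons.prems(4) 1(2)]
      have "?ex os b' (a # b) i" if "?ex xs d b i"
      proof -
        from that obtain p where p: "p < length xs" "xs ! p = j" "d ! p = i"
          "(b ! p = j \<and> d = b[p := i] \<or> (\<exists>p'>p. p' < length xs \<and> xs ! p' = j \<and> i < d ! p'))" by blast
        then show ?thesis
          by (intro exI [of _ "Suc p"]) (use 1 in \<open>auto simp: os b' intro: exI [of _ "Suc _"]\<close>)
      qed
      then show ?thesis
        using IH 1(1) by (auto simp: b' os simp del: ex_simps)
    next
      case 2
      note gwf = move_weight_direct [OF assms(4) Cons.prems(4) x(1)[unfolded 2] x(2)]
      have "?le os b' (a # b) i"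
        using gwf(1) by (simp add: b' os 2)
      moreover have "?mset os b' (a # b) i \<and> ?ex os b' (a # b) i" if "?eq os b' (a # b) i"
      proof
        have "x = j"
          using that gwf(2) by (simp add: b' os 2)
        then show "?mset os b' (a # b) i"
          by (simp add: b' os 2)
        show "?ex os b' (a # b) i"
          using \<open>x = j\<close> by (intro exI [of _ 0] conjI disjI1) (simp_all add: b' os 2)
      qed
      ultimately show ?thesis by blast
    next
      case 3
      note IH = Cons.hyps [OF xs 3(2,4)]
      \<comment> \<open>The chain ends at a letter \<open>j\<close> further right. Its block letter
        is at least \<open>j\<close>, and the block letters descend, so \<open>x\<close> is at least
        \<open>j\<close> too.\<close>
      have "j \<in> set b"
        using Rop_support(2) [OF 3(2,4)] .
      then obtain y where "y \<in> set xs" "j \<le> y"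
        using xs(2) unfolding in_set_conv_nth list_all2_conv_all_nth by metis
      then have jx: "j \<le> x"
        using x(3) by force
      note gwf = move_weight_chain [OF 3(1,2) jx, of C]
      have le: "?le os b' (a # b) i"
        using IH gwf(1) by (simp add: b' os 3)
      moreover have "?mset os b' (a # b) i \<and> ?ex os b' (a # b) i" if "?eq os b' (a # b) i"
      proof -
        have eq: "x = j" "?eq xs d b a"
          using that IH gwf by (auto simp: b' os 3)
        then have IH': "?mset xs d b a" "?ex xs d b a"
          using IH by auto
        from IH'(2) obtain p where "p < length xs" "xs ! p = j" "d ! p = a" by blast
        then have "?ex os b' (a # b) i"
          by (intro exI [of _ 0]) (use 3 eq in \<open>auto simp: os b' intro!: exI [of _ "Suc p"]\<close>)
        then show ?thesis
          using IH'(1) eq by (auto simp: os b' 3)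
      qed
      ultimately show ?thesis by blast
    qed
  qed
  then show "stat C (pair_mset os b') \<le> stat C (pair_mset os b) + move_weight C (j, i)"
    "stat C (pair_mset os b') = stat C (pair_mset os b) + move_weight C (j, i) \<Longrightarrow>
       pair_mset os b' + {#(j, j)#} = pair_mset os b + {#(j, i)#} \<and>
       (\<exists>p<length os. os ! p = j \<and> b' ! p = i \<and> (b ! p = j \<and> b' = b[p := i] \<or>
          (\<exists>p'>p. p' < length os \<and> os ! p' = j \<and> i < b' ! p')))"
    by auto
qed

text \<open>The two words differ in one place, so no chain contributes; what remains is the
  eigenvalue of K_i K_j^-1 on the letters to the right.\<close>

lemma cf_Rop_single_move:
  assumes "i < j"
  shows "cf (Rop q i j (monomial (u @ j # t))) (u @ i # t) = kprod q i j t"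
  using assms by (induct u) (auto simp: cf_Rop_Cons)

section \<open>Symmetry inside the blocks of equal letters\<close>

definition Hecke_symmetric :: "qv \<Rightarrow> nat list \<Rightarrow> nat free \<Rightarrow> bool" where
  "Hecke_symmetric q os y \<longleftrightarrow> (\<forall>k. Suc k < length os \<longrightarrow> os ! k = os ! Suc k \<longrightarrow> Hecke q k y = cst (inverse q) * y)"

text \<open>These words are the representatives modulo permutations of positions inside the blocks
  of \<open>os\<close>.\<close>

definition block_sorted :: "nat list \<Rightarrow> nat list \<Rightarrow> bool" where
  "block_sorted os b \<longleftrightarrow> (\<forall>k. Suc k < length os \<longrightarrow> os ! k = os ! Suc k \<longrightarrow> b ! Suc k \<le> b ! k)"

lemma Hecke_symmetric_swap:
  assumes "Hecke_symmetric q os y" "length w = length os" "Suc k < length os" "os ! k = os ! Suc k" "w ! Suc k < w ! k"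
  shows "cf y (swap k w) = inverse q * cf y w"
  using assms cf_Hecke [of k w q y] by (simp add: Hecke_symmetric_def cf_simps)

lemma length_swap [simp]: "length (swap k w) = length w"
  by (simp add: swap_def)

lemma swap_swap: "Suc k < length w \<Longrightarrow> swap k (swap k w) = w"
  by (rule nth_equalityI) (auto simp: swap_def nth_list_update)

lemma zip_swap:
  assumes "length w = length os" "Suc k < length os" "os ! k = os ! Suc k"
  shows "zip os (swap k w) = swap k (zip os w)"
  by (rule nth_equalityI) (use assms in \<open>auto simp: swap_def nth_list_update\<close>)

lemma mset_swap_adjacent: "Suc k < length w \<Longrightarrow> mset (swap k w) = mset w"
  unfolding swap_def using mset_swap [of "Suc k" w k] by simp

text \<open>The termination measure for sorting into descending order: exchanging an ascent puts the
  larger letter at the smaller position.\<close>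

definition wsum :: "nat list \<Rightarrow> nat" where
  "wsum b = (\<Sum>p<length b. p * b ! p)"

lemma wsum_swap:
  assumes "Suc k < length b" "b ! k < b ! Suc k"
  shows "wsum (swap k b) < wsum b"
proof -
  let ?r = "{..<length b} - {k, Suc k}"
  have s: "(\<Sum>p<length b. f p) = f k + f (Suc k) + (\<Sum>p\<in>?r. f p)" for f :: "nat \<Rightarrow> nat"
    using assms(1) by (subst sum.subset_diff [of "{k, Suc k}"]) auto
  have "(\<Sum>p\<in>?r. p * swap k b ! p) = (\<Sum>p\<in>?r. p * b ! p)"
    by (rule sum.cong) (auto simp: swap_def)
  then show ?thesis
    using assms by (simp add: wsum_def s) (simp add: swap_def)
qed

text \<open>Bubble sort inside the blocks, where each exchange costs one factor q^-1 by
  \<open>Hecke_symmetric_swap\<close>. The sorted word is chosen before \<open>y\<close>, so one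
  representative serves all symmetric elements.\<close>

lemma to_block_sorted:
  assumes "length b = length os" "q \<noteq> 0"
  shows "\<exists>b0. length b0 = length os \<and> block_sorted os b0 \<and> pair_mset os b0 = pair_mset os b \<and>
    (\<forall>y. Hecke_symmetric q os y \<longrightarrow> (\<exists>k. cf y b = q powi k * cf y b0))"
  using assms(1)
proof (induct "wsum b" arbitrary: b rule: less_induct)
  case less
  show ?case
  proof (cases "block_sorted os b")
    case True
    then show ?thesis
      using less.prems by (intro exI [of _ b]) (auto intro: exI [of _ 0])
  next
    case False
    then obtain k where k: "Suc k < length os" "os ! k = os ! Suc k" "b ! k < b ! Suc k"
      by (auto simp: block_sorted_def not_le)
    obtain b0 where b0: "length b0 = length os" "block_sorted os b0" "pair_mset os b0 = pair_mset os (swap k b)"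
      "\<And>y. Hecke_symmetric q os y \<Longrightarrow> \<exists>k'. cf y (swap k b) = q powi k' * cf y b0"
      using less.hyps [of "swap k b"] wsum_swap [of k b] k less.prems by auto
    have "\<exists>k. cf y b = q powi k * cf y b0" if y: "Hecke_symmetric q os y" for y
    proof -
      obtain k' where "cf y (swap k b) = q powi k' * cf y b0"
        using b0(4) y by blast
      moreover have "cf y (swap k (swap k b)) = inverse q * cf y (swap k b)"
        by (rule Hecke_symmetric_swap [OF y]) (use k less.prems in \<open>auto simp: swap_def\<close>)
      ultimately have "cf y b = q powi (k' - 1) * cf y b0"
        using k less.prems assms(2) by (simp add: swap_swap power_int_diff divide_inverse)
      then show ?thesis by blast
    qed
    then show ?thesis
      using b0(1-3) k less.prems
      by (intro exI [of _ b0]) (simp add: zip_swap mset_swap_adjacent)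
  qed
qed

text \<open>Zipped with \<open>os\<close>, such a word becomes lexicographically descending, and a
  sorted list is determined by its multiset.\<close>

lemma block_sorted_unique:
  assumes "sorted_wrt (\<ge>) os" "block_sorted os b" "block_sorted os b'"
    "length b = length os" "length b' = length os" "pair_mset os b = pair_mset os b'"
  shows "b = b'"
proof -
  have "sorted (rev (zip os b))" if "block_sorted os b" "length b = length os" for b
    unfolding sorted_rev_iff_nth_Suc
  proof (intro allI impI)
    fix k assume "Suc k < length (zip os b)"
    then show "zip os b ! Suc k \<le> zip os b ! k"
      using that assms(1) sorted_wrt_nth_less [OF assms(1), of k "Suc k"]
      by (auto simp: block_sorted_def less_le)
  qed
  then have "rev (zip os b) = rev (zip os b')"
    using assms by (metis mset_rev properties_for_sort)
  then show ?thesis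
    using assms(4,5) by (metis map_snd_zip rev_rev_ident)
qed

lemma cf_rearrange:
  assumes "sorted_wrt (\<ge>) os" "Hecke_symmetric q os y" "q \<noteq> 0"
    "length b = length os" "length b' = length os" "pair_mset os b = pair_mset os b'"
  shows "\<exists>k. cf y b = q powi k * cf y b'"
proof -
  obtain b0 k where b0: "length b0 = length os" "block_sorted os b0" "pair_mset os b0 = pair_mset os b" "cf y b = q powi k * cf y b0"
    using to_block_sorted [OF assms(4,3)] assms(2) by blast
  obtain b1 l where b1: "length b1 = length os" "block_sorted os b1" "pair_mset os b1 = pair_mset os b'" "cf y b' = q powi l * cf y b1"
    using to_block_sorted [OF assms(5,3)] assms(2) by blast
  have "b0 = b1"
    by (rule block_sorted_unique [OF assms(1) b0(2) b1(2)]) (use b0 b1 assms in auto)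
  then have "cf y b = q powi (k - l) * cf y b'"
    using b0 b1 assms(3) by (simp add: power_int_diff)
  then show ?thesis by blast
qed

section \<open>Leading coefficients\<close>

lemma block_decomp:
  assumes "sorted_wrt (\<ge>) os" "length b = length os"
  obtains o1 b1 l o2 b2 where "os = o1 @ replicate (length l) (j::nat) @ o2" "b = b1 @ l @ b2"
    "length b1 = length o1" "length b2 = length o2" "j \<notin> set o1" "j \<notin> set o2"
proof -
  let ?o1 = "filter (\<lambda>x. x > j) os" and ?o2 = "filter (\<lambda>x. x < j) os"
  have os: "os = ?o1 @ filter (\<lambda>x. x = j) os @ ?o2"
    using assms(1)
  proof (induct os)
    case (Cons x xs)
    consider "x > j" | "x = j" | "x < j" by linarith
    then show ?case
    proof cases
      case 1
      then show ?thesis using Cons by simp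
    next
      case 2
      then have "filter (\<lambda>x. x > j) xs = []"
        using Cons.prems by (auto simp: filter_empty_conv)
      then show ?thesis using Cons 2 by simp
    next
      case 3
      then have "filter (\<lambda>x. x > j) xs = []" "filter (\<lambda>x. x = j) xs = []"
        using Cons.prems by (fastforce simp: filter_empty_conv)+
      then show ?thesis using Cons 3 by simp
    qed
  qed simp
  have r: "filter (\<lambda>x. x = j) os = replicate (length (filter (\<lambda>x. x = j) os)) j"
    by (rule replicate_length_same [symmetric]) simp
  let ?n1 = "length ?o1" and ?n = "length (filter (\<lambda>x. x = j) os)"
  have len: "length os = ?n1 + ?n + length ?o2"
    by (subst os) simp
  let ?l = "take ?n (drop ?n1 b)"
  have l: "length ?l = ?n"
    using assms(2) len by simp
  show thesis
  proof (rule that [of ?o1 ?l ?o2 "take ?n1 b" "drop ?n (drop ?n1 b)"])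
    show "os = ?o1 @ replicate (length ?l) j @ ?o2"
      using os unfolding l by (simp flip: r)
    show "b = take ?n1 b @ ?l @ drop ?n (drop ?n1 b)"
      by (metis append_take_drop_id)
  qed (use assms(2) len in auto)
qed

text \<open>\<open>P\<close> is the strictly highest matrix in \<open>y\<close>. Its coefficient
  depends on the arrangement inside the blocks, by \<open>cf_rearrange\<close> only through a power
  of \<open>q\<close>; the exponent is left open since only invertibility will matter.\<close>

definition leading :: "qv \<Rightarrow> int \<Rightarrow> nat list \<Rightarrow> nat free \<Rightarrow> (nat \<times> nat) multiset \<Rightarrow> qv \<Rightarrow> bool" where
  "leading q C os y P c \<longleftrightarrow> Hecke_symmetric q os y \<and>
     (\<forall>b. cf y b \<noteq> 0 \<longrightarrow> list_all2 (\<le>) b os \<and> (stat C (pair_mset os b) < stat C P \<or> pair_mset os b = P)) \<and>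
     (\<exists>b. length b = length os \<and> pair_mset os b = P) \<and>
     (\<forall>b. length b = length os \<longrightarrow> pair_mset os b = P \<longrightarrow> (\<exists>k. cf y b = c * q powi k))"

lemma kprod_powi: "q \<noteq> 0 \<Longrightarrow> \<exists>k. kprod q i j w = q powi k"
proof (induct w)
  case (Cons a w)
  then obtain k where k: "kprod q i j w = q powi k" by blast
  have "kap q i j a = q powi (if a = i then 1 else if a = j then - 1 else 0)"
    by (simp add: kap_def power_int_minus)
  then have "kprod q i j (a # w) = q powi ((if a = i then 1 else if a = j then - 1 else 0) + k)"
    using k Cons.prems by (simp add: kprod_def power_int_add)
  then show ?case by blast
qed (auto simp: kprod_def intro: exI [of _ 0])

lemma kprod_append: "kprod q i j (u @ w) = kprod q i j u * kprod q i j w"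
  and kprod_replicate: "kprod q i j (replicate s i) = q ^ s"
  by (induct s) (simp_all add: kprod_def kap_def)

lemma swap_append: "swap (length u) (u @ x # y # t) = u @ y # x # t"
  by (simp add: swap_def nth_append list_update_append)

context v_or_inverse
begin

lemma qint_sum: "(\<Sum>r\<le>a. inverse q ^ r * q ^ (a - r)) = qint (Suc a)"
proof (induct a)
  case (Suc a)
  have "(\<Sum>r\<le>Suc a. inverse q ^ r * q ^ (Suc a - r)) = q * (\<Sum>r\<le>a. inverse q ^ r * q ^ (a - r)) + inverse q ^ Suc a"
    by (simp add: sum_distrib_left Suc_diff_le mult_ac)
  then show ?case
    unfolding Suc by (simp only: qint_Suc(2) [of "Suc a"] add.commute)
qed simp

text \<open>By the equality case of \<open>Rop_stat\<close> the new top matrix comes only from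
  \<open>P\<close>, by turning one (j, j) into (j, i). Its coefficient is computed at one convenient
  word \<open>b'\<close> and carried to the others by \<open>cf_rearrange\<close>.\<close>

lemma leading_Rop:
  assumes os: "sorted_wrt (\<ge>) os" and n: "\<And>x. x \<in> set os \<Longrightarrow> x \<le> n" and C: "int n ^ 2 < C"
    and ij: "i < j" and y: "leading q C os y P c" and jj: "(j, j) \<in># P"
  shows "leading q C os (Rop q i j y) (add_mset (j, i) (P - {#(j, j)#})) (c * qint (Suc (count P (j, i))))"
proof -
  let ?P = "add_mset (j, i) (P - {#(j, j)#})"
  have P': "Q + {#(j, j)#} = P + {#(j, i)#} \<longleftrightarrow> Q = ?P" for Q
  proof -
    obtain Q0 where "P = add_mset (j, j) Q0"
      using jj by (rule mset_add)
    then show ?thesis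
      by (simp add: add_mset_commute [of "(j, i)"])
  qed
  have "stat C P = stat C (P - {#(j, j)#})"
    using arg_cong [OF insert_DiffM [OF jj], of "stat C"] by (simp add: move_weight_def)
  then have st: "stat C ?P = stat C P + move_weight C (j, i)"
    by simp
  have sym: "Hecke_symmetric q os y"
    and supp: "\<And>b. cf y b \<noteq> 0 \<Longrightarrow> list_all2 (\<le>) b os \<and> (stat C (pair_mset os b) < stat C P \<or> pair_mset os b = P)"
    and ex: "\<exists>b. length b = length os \<and> pair_mset os b = P"
    and coef: "\<And>b. length b = length os \<Longrightarrow> pair_mset os b = P \<Longrightarrow> (\<exists>k. cf y b = c * q powi k)"
    using y unfolding leading_def by auto
  have sym': "Hecke_symmetric q os (Rop q i j y)"
    using sym ij by (simp add: Hecke_symmetric_def Hecke_Rop linD [OF lin_Rop])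
  have le: "list_all2 (\<le>) b' os" if "cf (Rop q i j (monomial b)) b' \<noteq> 0" "cf y b \<noteq> 0" for b b'
    using Rop_support(1) [OF ij that(1)] supp [OF that(2)] by (auto intro: list_all2_trans [of "(\<le>)" "(\<le>)"])
  have step: "stat C (pair_mset os b') < stat C ?P \<or> (pair_mset os b' = ?P \<and> pair_mset os b = P \<and>
      (\<exists>p<length os. os ! p = j \<and> b' ! p = i \<and> (b ! p = j \<and> b' = b[p := i] \<or>
          (\<exists>p'>p. p' < length os \<and> os ! p' = j \<and> i < b' ! p'))))"
    if "cf (Rop q i j (monomial b)) b' \<noteq> 0" "cf y b \<noteq> 0" for b b'
  proof (cases "stat C (pair_mset os b') < stat C ?P")
    case False
    have b: "list_all2 (\<le>) b os" "stat C (pair_mset os b) < stat C P \<or> pair_mset os b = P"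
      using supp [OF that(2)] by auto
    note rs = Rop_stat [OF os b(1) n C ij that(1)]
    have "stat C (pair_mset os b') = stat C (pair_mset os b) + move_weight C (j, i)" "pair_mset os b = P"
      using False rs(1) b(2) unfolding st by auto
    then show ?thesis
      using rs(2) P' [of "pair_mset os b'"] by auto
  qed auto
  obtain bb where bb: "length bb = length os" "pair_mset os bb = P"
    using ex by blast
  obtain o1 b1 l o2 b2 where dec: "os = o1 @ replicate (length l) j @ o2" "bb = b1 @ l @ b2"
    "length b1 = length o1" "length b2 = length o2" "j \<notin> set o1" "j \<notin> set o2"
    using block_decomp [OF os bb(1)] .
  have zdec: "pair_mset os (b1 @ l' @ b2) = pair_mset o1 b1 + image_mset (Pair j) (mset l') + pair_mset o2 b2" if "length l' = length l" for l'
  proof -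
    have "zip (replicate (length l) j) l' = map (Pair j) l'"
      using that by (simp add: zip_replicate1)
    then show ?thesis
      unfolding dec(1) using dec(3) that by (simp add: add.assoc)
  qed
  have notin: "(j, k) \<notin># pair_mset o1 b1" "(j, k) \<notin># pair_mset o2 b2" for k
    using dec(5,6) by (auto dest: set_zip_leftD)
  have cnt: "count P (j, k) = count (mset l) k" for k
  proof -
    have "count (image_mset (Pair j) M) (j, k) = count M k" for M
      by (induct M) auto
    then show ?thesis
      using notin [of k] unfolding bb(2) [symmetric] dec(2) zdec [OF refl]
      by (simp add: not_in_iff)
  qed
  define a where "a = count P (j, i)"
  have "j \<in># mset l"
    using jj cnt [of j] by (metis count_greater_zero_iff)
  \<comment> \<open>The letters of the block other than \<open>i\<close>, with one \<open>j\<close>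
    removed. Putting them first makes all letters \<open>i\<close> of \<open>b'\<close> stand
    together at the end of the block; \<open>W r s\<close> is \<open>b'\<close> with the letter
    after the first \<open>r\<close> of these restored to \<open>j\<close>.\<close>
  define cc where "cc = filter (\<lambda>x. x \<noteq> i) (remove1 j l)"
  have "mset (remove1 j l) = replicate_mset a i + mset cc"
  proof -
    have "count (mset (remove1 j l)) i = a"
      using ij cnt [of i] by (simp add: a_def)
    then have "filter_mset (\<lambda>x. x = i) (mset (remove1 j l)) = replicate_mset a i"
      by (simp add: filter_eq_replicate_mset)
    then show ?thesis
      unfolding cc_def mset_filter by (metis multiset_partition)
  qed
  then have ml: "mset l = add_mset j (replicate_mset a i + mset cc)"
    using \<open>j \<in># mset l\<close> by (metis insert_DiffM mset_remove1)
  define W where "W r s = b1 @ (cc @ replicate r i @ j # replicate s i) @ b2" for r s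
  define b' where "b' = b1 @ (cc @ replicate (Suc a) i) @ b2"
  have ll: "length l = Suc (a + length cc)"
    using arg_cong [OF ml, of size] by simp
  have W_len: "length (W r s) = length os" "pair_mset os (W r s) = P" if "r + s = a" for r s
  proof -
    have "mset (cc @ replicate r i @ j # replicate s i) = mset l"
      using that ml by (intro multiset_eqI) auto
    moreover have "length (cc @ replicate r i @ j # replicate s i) = length l"
      using that ll by simp
    ultimately show "pair_mset os (W r s) = P" "length (W r s) = length os"
      unfolding W_def by (simp_all only: zdec bb(2) [symmetric] dec(2)) (use dec in simp)
  qed
  have b'_len: "length b' = length os" and b'_P: "pair_mset os b' = ?P"
  proof -
    have l': "length (cc @ replicate (Suc a) i) = length l"
      using ll by simp
    then show "length b' = length os"
      unfolding b'_def using dec by simp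
    have "pair_mset os b' + {#(j, j)#} = P + {#(j, i)#}"
      unfolding b'_def zdec [OF l'] unfolding bb(2) [symmetric] dec(2) zdec [OF refl] ml by simp
    then show "pair_mset os b' = ?P"
      using P' by simp
  qed
  have osj: "os ! p = j" if "length b1 \<le> p" "p < length b1 + length l" for p
    unfolding dec(1) using dec(3) that by (auto simp: nth_append)
  have W_swap: "cf y (W r s) = inverse q ^ r * cf y (W 0 a)" if "r + s = a" for r s
    using that
  proof (induct r arbitrary: s)
    case (Suc r)
    let ?k = "length b1 + length cc + r"
    have nth: "W r (Suc s) ! ?k = j" "W r (Suc s) ! Suc ?k = i"
      by (simp_all add: W_def nth_append)
    have "os ! ?k = j" "os ! Suc ?k = j"
      using Suc.prems ll by (auto intro!: osj)
    moreover have "Suc ?k < length os"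
      using Suc.prems ll by (simp add: dec(1,3))
    ultimately have "cf y (swap ?k (W r (Suc s))) = inverse q * cf y (W r (Suc s))"
      using Suc.prems nth ij by (intro Hecke_symmetric_swap [OF sym]) (simp_all add: W_len)
    moreover have "swap ?k (W r (Suc s)) = W (Suc r) s"
      using swap_append [of "b1 @ cc @ replicate r i" j i "replicate s i @ b2"]
      by (simp add: W_def replicate_app_Cons_same add.assoc)
    ultimately show ?case
      using Suc.hyps [of "Suc s"] Suc.prems by simp
  qed simp
  have W_Rop: "cf (Rop q i j (monomial (W r s))) b' = q ^ s * kprod q i j b2" if "r + s = a" for r s
  proof -
    have "b' = (b1 @ cc @ replicate r i) @ i # replicate s i @ b2"
      using replicate_add [of r "Suc s" i] that by (auto simp: b'_def)
    moreover have "W r s = (b1 @ cc @ replicate r i) @ j # replicate s i @ b2"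
      by (simp add: W_def)
    ultimately show ?thesis
      by (simp only: cf_Rop_single_move [OF ij] kprod_append kprod_replicate)
  qed
  \<comment> \<open>In \<open>b'\<close> every position of the block to the right of an
    \<open>i\<close> also carries \<open>i\<close>, so the chain alternative of
    \<open>Rop_stat\<close> is impossible and the preimage differs from \<open>b'\<close> in a
    single letter \<open>j\<close>.\<close>
  have only_W: "\<exists>r\<le>a. w = W r (a - r)" if w: "cf (Rop q i j (monomial w)) b' \<noteq> 0" "cf y w \<noteq> 0" for w
  proof -
    obtain p where p: "p < length os" "os ! p = j" "b' ! p = i"
      "w ! p = j \<and> b' = w[p := i] \<or> (\<exists>p'>p. p' < length os \<and> os ! p' = j \<and> i < b' ! p')"
      using step [OF w] b'_P by auto
    have block: "length b1 \<le> p' \<and> p' < length b1 + length l" if "p' < length os" "os ! p' = j" for p'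
    proof -
      have "\<not> p' < length o1"
        using dec(1,5) that(2) by (auto simp: nth_append)
      moreover have "\<not> length o1 + length l \<le> p'"
      proof
        assume ge: "length o1 + length l \<le> p'"
        then have "os ! p' = o2 ! (p' - length o1 - length l)"
          unfolding dec(1) by (auto simp: nth_append)
        moreover have "p' - length o1 - length l < length o2"
          using ge that(1) arg_cong [OF dec(1), of length] by simp
        ultimately show False
          using dec(6) that(2) by (metis nth_mem)
      qed
      ultimately show ?thesis using dec(3) by simp
    qed
    have "i \<notin> set cc"
      by (simp add: cc_def)
    have cc: "length b1 + length cc \<le> p"
    proof (rule ccontr)
      assume "\<not> ?thesis"
      then have "b' ! p = cc ! (p - length b1)" "p - length b1 < length cc"
        using block [OF p(1,2)] by (auto simp: b'_def nth_append)
      then show False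
        using p(3) \<open>i \<notin> set cc\<close> by auto
    qed
    have "b' ! p' = i" if "p < p'" "p' < length os" "os ! p' = j" for p'
      using cc that block [OF that(2,3)] ll by (auto simp: b'_def nth_append simp del: replicate_Suc)
    then have wp: "w ! p = j" "b' = w[p := i]"
      using p(4) by auto
    define r where "r = p - (length b1 + length cc)"
    have r: "p = length b1 + length cc + r" "r \<le> a"
      using cc block [OF p(1,2)] ll by (auto simp: r_def)
    have "w = b'[p := j]"
      using wp by (metis list_update_id list_update_overwrite)
    also have "\<dots> = W r (a - r)"
    proof -
      have "replicate (Suc a) i = replicate r i @ i # replicate (a - r) i"
        using r(2) by (metis le_add_diff_inverse replicate_Suc replicate_add add_Suc_right)
      then show ?thesis
        unfolding r(1) by (simp add: b'_def W_def list_update_append del: replicate_Suc)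
    qed
    finally show ?thesis
      using r(2) by blast
  qed
  have "cf (Rop q i j y) b' = (\<Sum>r\<le>a. cf y (W r (a - r)) * cf (Rop q i j (monomial (W r (a - r)))) b')"
  proof -
    have inj: "inj_on (\<lambda>r. Word (W r (a - r))) {..a}"
    proof (rule linorder_inj_onI')
      fix r r' :: nat assume "r < r'"
      then have "W r (a - r) ! (length b1 + length cc + r) = j" "W r' (a - r') ! (length b1 + length cc + r) = i"
        by (simp_all add: W_def nth_append)
      then show "Word (W r (a - r)) \<noteq> Word (W r' (a - r'))"
        using ij by auto
    qed
    let ?f = "\<lambda>u. Poly_Mapping.lookup y u * cf (Rop q i j (monomial (letters u))) b'"
    have "cf (Rop q i j y) b' = (\<Sum>u\<in>Poly_Mapping.keys y. ?f u)"
      by (rule cf_lin [OF lin_Rop])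
    also have "\<dots> = (\<Sum>u\<in>(\<lambda>r. Word (W r (a - r))) ` {..a}. ?f u)"
    proof (rule sum.mono_neutral_cong)
      fix u assume u: "u \<in> Poly_Mapping.keys y - (\<lambda>r. Word (W r (a - r))) ` {..a}"
      show "?f u = 0"
      proof (rule ccontr)
        assume "?f u \<noteq> 0"
        then obtain r where "r \<le> a" "letters u = W r (a - r)"
          using only_W [of "letters u"] by auto
        then show False using u by (auto simp: letters_eq)
      qed
    qed (auto simp: in_keys_iff)
    finally show ?thesis
      by (simp add: sum.reindex [OF inj])
  qed
  \<comment> \<open>Moving the \<open>j\<close> past \<open>r\<close> letters \<open>i\<close>
    contributes q^-r, and the \<open>a - r\<close> letters \<open>i\<close> to its right contribute
    q^(a-r).\<close>
  also have "\<dots> = (\<Sum>r\<le>a. inverse q ^ r * q ^ (a - r)) * (cf y (W 0 a) * kprod q i j b2)"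
    unfolding sum_distrib_right
  proof (rule sum.cong [OF refl])
    fix r assume "r \<in> {..a}"
    then have "r + (a - r) = a" by simp
    from W_swap [OF this] W_Rop [OF this]
    show "cf y (W r (a - r)) * cf (Rop q i j (monomial (W r (a - r)))) b' = inverse q ^ r * q ^ (a - r) * (cf y (W 0 a) * kprod q i j b2)"
      by (simp add: mult_ac)
  qed
  finally have cb': "cf (Rop q i j y) b' = qint (Suc a) * (cf y (W 0 a) * kprod q i j b2)"
    by (simp only: qint_sum)
  obtain k where "cf y (W 0 a) = c * q powi k"
    using coef [OF W_len, of 0 a] by auto
  moreover obtain k' where "kprod q i j b2 = q powi k'"
    using kprod_powi [OF q_nz] by blast
  ultimately have cb': "cf (Rop q i j y) b' = c * qint (Suc a) * q powi (k + k')"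
    unfolding cb' by (simp add: power_int_add mult_ac)
  have "\<exists>k. cf (Rop q i j y) b = c * qint (Suc a) * q powi k" if b: "length b = length os" "pair_mset os b = ?P" for b
  proof -
    obtain k'' where "cf (Rop q i j y) b = q powi k'' * cf (Rop q i j y) b'"
      using cf_rearrange [OF os sym' q_nz b(1) b'_len] b'_P b(2) by auto
    then have "cf (Rop q i j y) b = c * qint (Suc a) * q powi (k'' + (k + k'))"
      unfolding cb' by (simp add: power_int_add mult_ac)
    then show ?thesis by blast
  qed
  moreover have "list_all2 (\<le>) b os \<and> (stat C (pair_mset os b) < stat C ?P \<or> pair_mset os b = ?P)"
    if nz: "cf (Rop q i j y) b \<noteq> 0" for b
  proof -
    obtain w where "cf y w \<noteq> 0" "cf (Rop q i j (monomial w)) b \<noteq> 0"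
      using cf_lin_nz [OF lin_Rop nz] .
    then show ?thesis
      using le step by blast
  qed
  ultimately show ?thesis
    unfolding leading_def a_def [symmetric] using sym' b'_len b'_P by auto
qed

end

section \<open>Divided powers and their products on descending words\<close>

definition Xop :: "qv \<Rightarrow> nat \<Rightarrow> nat \<Rightarrow> nat \<Rightarrow> nat free \<Rightarrow> nat free" where
  "Xop q i j m t = cst (inverse q ^ ((j - i - 1) * m) / qfact m) * (Rop q i j ^^ m) t"

definition Eop :: "qv \<Rightarrow> (nat \<times> nat) list \<Rightarrow> (nat \<times> nat \<Rightarrow> nat) \<Rightarrow> nat free \<Rightarrow> nat free" where
  "Eop q \<beta>s A t = foldr (\<lambda>\<alpha>. Xop q (fst \<alpha>) (snd \<alpha>) (A \<alpha>)) \<beta>s t"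

lemma Eop_simps: "Eop q [] A t = t" "Eop q (\<alpha> # \<beta>s) A t = Xop q (fst \<alpha>) (snd \<alpha>) (A \<alpha>) (Eop q \<beta>s A t)"
  by (simp_all add: Eop_def)

text \<open>The entry of the root (i, j) is recorded at the pair (j, i): block letter first, lowered
  letter second. The diagonal completes the column sums to \<open>\<mu>\<close>; its truncated
  subtraction is exact when the content is below \<open>\<mu>\<close>.\<close>

definition matrix_mset :: "nat \<Rightarrow> (nat \<times> nat \<Rightarrow> nat) \<Rightarrow> (nat \<Rightarrow> nat) \<Rightarrow> (nat \<times> nat) multiset" where
  "matrix_mset n A \<mu> = (\<Sum>(i, j)\<in>Phi_pos n. replicate_mset (A (i, j)) (j, i))
     + (\<Sum>j\<in>{1..n}. replicate_mset (\<mu> j - content n A j) (j, j))"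

definition dom_word :: "nat \<Rightarrow> (nat \<Rightarrow> nat) \<Rightarrow> nat list" where
  "dom_word n \<mu> = rev (sorted_list_of_multiset (\<Sum>j\<in>{1..n}. replicate_mset (\<mu> j) j))"

lemma finite_Phi_pos: "finite (Phi_pos n)"
  by (rule finite_subset [of _ "{1..n} \<times> {1..n}"]) (auto simp: Phi_pos_def)

lemma count_matrix_mset: "count (matrix_mset n A \<mu>) (x, c) = (if (c, x) \<in> Phi_pos n then A (c, x) else 0)
    + (if x = c \<and> x \<in> {1..n} then \<mu> x - content n A x else 0)"
proof -
  have "count (\<Sum>(i, j)\<in>Phi_pos n. replicate_mset (A (i, j)) (j, i)) (x, c)
      = (\<Sum>p\<in>Phi_pos n. if p = (c, x) then A p else 0)"
    unfolding count_sum by (rule sum.cong) (auto split: if_splits)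
  moreover have "count (\<Sum>j\<in>{1..n}. replicate_mset (\<mu> j - content n A j) (j, j)) (x, c)
      = (\<Sum>j\<in>{1..n}. if j = x then (if x = c then \<mu> x - content n A x else 0) else 0)"
    unfolding count_sum by (rule sum.cong) auto
  ultimately show ?thesis
    by (simp add: matrix_mset_def finite_Phi_pos)
qed

lemma mset_dom_word: "mset (dom_word n \<mu>) = (\<Sum>j\<in>{1..n}. replicate_mset (\<mu> j) j)"
  by (simp add: dom_word_def)

lemma count_dom_word: "count_list (dom_word n \<mu>) x = (if x \<in> {1..n} then \<mu> x else 0)"
  unfolding count_mset [symmetric] mset_dom_word count_sum by (simp add: sum.delta')

lemma sorted_dom_word: "sorted_wrt (\<ge>) (dom_word n \<mu>)"
  by (simp add: dom_word_def sorted_wrt_rev)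

lemma set_dom_word: "set (dom_word n \<mu>) \<subseteq> {1..n}"
  using count_dom_word [of n \<mu>] by (metis count_list_0_iff subsetI)

lemma length_dom_word: "\<mu> \<in> Lambda n d \<Longrightarrow> length (dom_word n \<mu>) = d"
  unfolding size_mset [symmetric] mset_dom_word by (simp add: Lambda_def size_multiset_sum)

lemma content_update:
  assumes "(i, j) \<in> Phi_pos n" "A (i, j) = 0"
  shows "content n (A((i, j) := m)) x = content n A x + (if x = j then m else 0)"
proof -
  have "content n B x = (case (i, j) of (i, j) \<Rightarrow> if j = x then B (i, j) else 0)
     + (\<Sum>p\<in>Phi_pos n - {(i, j)}. case p of (i, j) \<Rightarrow> if j = x then B (i, j) else 0)" for B
    unfolding content_def by (rule sum.remove [OF finite_Phi_pos assms(1)])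
  moreover have "(\<Sum>p\<in>Phi_pos n - {(i, j)}. case p of (i', j') \<Rightarrow> if j' = x then (A((i, j) := m)) (i', j') else 0)
     = (\<Sum>p\<in>Phi_pos n - {(i, j)}. case p of (i, j) \<Rightarrow> if j = x then A (i, j) else 0)"
    by (rule sum.cong) (auto split: if_splits)
  ultimately show ?thesis
    using assms(2) by auto
qed

lemma content_mono: "(\<And>p. A p \<le> B p) \<Longrightarrow> content n A x \<le> content n B x"
  unfolding content_def by (rule sum_mono) auto

lemma Hecke_equal:
  assumes "Suc k < length w" "w ! k = w ! Suc k"
  shows "Hecke q k (monomial w) = cst (inverse q) * monomial w"
proof -
  have "Hecke_word q k w = cst (inverse q) * monomial w"
    using assms
  proof (induct k arbitrary: w)
    case 0
    then obtain a b u where "w = a # b # u"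
      by (cases w; cases "tl w") auto
    then show ?case using 0 by simp
  next
    case (Suc k)
    then obtain a u where "w = a # u"
      by (cases w) auto
    then show ?case using Suc by (simp add: monomial_Cons gen_cst)
  qed
  then show ?thesis
    by (simp add: Hecke_monomial)
qed

lemma zip_diag:
  assumes "length b = length w" "pair_mset w b = pair_mset w w"
  shows "b = w"
proof -
  have "set (zip w b) = set (zip w w)"
    using arg_cong [OF assms(2), of set_mset] by simp
  then have "\<forall>p\<in>set (zip w b). fst p = snd p"
    by (auto simp: zip_same)
  then have *: "fst (zip w b ! p) = snd (zip w b ! p)" if "p < length w" for p
    using that assms(1) by (metis length_zip min.idem nth_mem)
  show ?thesis
    by (rule nth_equalityI) (use assms(1) * in auto)
qed

context v_or_inverse
begin

lemma lin_Xop: "lin (Xop q i j m)"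
  unfolding Xop_def [abs_def] by (intro lin_cmult lin_Rop_power)

lemma lin_Eop: "lin (Eop q \<beta>s A)"
proof (induct \<beta>s)
  case Nil
  then show ?case by (simp add: Eop_simps lin_id)
next
  case (Cons \<alpha> \<beta>s)
  then show ?case
    using lin_comp [OF lin_Xop Cons] by (simp add: Eop_simps)
qed

text \<open>Since the entry at (j, i) starts at 0, the successive factors of
  \<open>leading_Rop\<close> are the quantum integers from 1 to \<open>m\<close>. Their product is
  the \<open>qfact m\<close> by which the divided power divides, so \<open>leading_Xop\<close>
  obtains a unit.\<close>

lemma leading_power:
  assumes "sorted_wrt (\<ge>) os" "\<And>x. x \<in> set os \<Longrightarrow> x \<le> n" "int n ^ 2 < C" "i < j" "leading q C os y P c"
    "count P (j, i) = 0" "m \<le> count P (j, j)"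
  shows "leading q C os ((Rop q i j ^^ m) y) (P - replicate_mset m (j, j) + replicate_mset m (j, i)) (c * qfact m)"
  using assms(7)
proof (induct m)
  case 0
  then show ?case using assms(5) by simp
next
  case (Suc m)
  let ?P = "P - replicate_mset m (j, j) + replicate_mset m (j, i)"
  have "leading q C os (Rop q i j ((Rop q i j ^^ m) y)) (add_mset (j, i) (?P - {#(j, j)#})) (c * qfact m * qint (Suc (count ?P (j, i))))"
    by (rule leading_Rop [OF assms(1-4)]) (use Suc assms in \<open>simp_all flip: count_greater_zero_iff\<close>)
  moreover have "add_mset (j, i) (?P - {#(j, j)#}) = P - replicate_mset (Suc m) (j, j) + replicate_mset (Suc m) (j, i)"
    using assms(4) Suc.prems by (intro multiset_eqI) auto
  moreover have "count ?P (j, i) = m"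
    using assms(4,6) by simp
  ultimately show ?case
    by (simp add: qfact_Suc mult_ac)
qed

lemma leading_scale: "leading q C os y P c \<Longrightarrow> leading q C os (cst a * y) P (a * c)"
  by (auto simp: leading_def Hecke_symmetric_def linD [OF lin_Hecke] cf_simps cst_cst mult_ac)

lemma leading_Xop:
  assumes "sorted_wrt (\<ge>) os" "\<And>x. x \<in> set os \<Longrightarrow> x \<le> n" "int n ^ 2 < C" "i < j" "leading q C os y P c"
    "count P (j, i) = 0" "m \<le> count P (j, j)" "Laurent_unit c"
  shows "\<exists>c. Laurent_unit c \<and> leading q C os (Xop q i j m y) (P - replicate_mset m (j, j) + replicate_mset m (j, i)) c"
proof -
  let ?e = "(j - i - 1) * m"
  have "leading q C os (Xop q i j m y) (P - replicate_mset m (j, j) + replicate_mset m (j, i)) (inverse q ^ ?e / qfact m * (c * qfact m))"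
    unfolding Xop_def by (intro leading_scale leading_power [OF assms(1-7)])
  moreover have "inverse q ^ ?e / qfact m * (c * qfact m) = q powi (- int ?e) * c"
    using qfact_nz by (simp add: power_int_minus power_inverse power_int_of_nat del: of_nat_mult)
  moreover have "Laurent_unit (q powi (- int ?e) * c)"
    by (intro Laurent_unit_mult q_powi_unit assms)
  ultimately show ?thesis by metis
qed

text \<open>The rightmost factor acts first. When the turn of a root (i, j) comes, distinctness
  makes its entry still 0, and content below \<open>\<mu>\<close> leaves at least
  \<open>A (i, j)\<close> unmoved letters \<open>j\<close> in their own block. Neither depends on
  the order of the roots.\<close>

lemma leading_Eop:
  assumes "distinct \<beta>s" "set \<beta>s \<subseteq> Phi_pos n" "wt_le n (content n A) \<mu>"
  shows "\<exists>c. Laurent_unit c \<and> leading q (int n ^ 2 + 1) (dom_word n \<mu>) (Eop q \<beta>s A (monomial (dom_word n \<mu>)))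
     (matrix_mset n (\<lambda>\<alpha>. if \<alpha> \<in> set \<beta>s then A \<alpha> else 0) \<mu>) c"
  using assms(1,2)
proof (induct \<beta>s)
  case Nil
  have "pair_mset (dom_word n \<mu>) (dom_word n \<mu>) = image_mset (\<lambda>x. (x, x)) (mset (dom_word n \<mu>))"
    by (simp add: zip_same_conv_map)
  also have "\<dots> = (\<Sum>j\<in>{1..n}. replicate_mset (\<mu> j) (j, j))"
    unfolding mset_dom_word by (induct n) simp_all
  also have "\<dots> = matrix_mset n (\<lambda>_. 0) \<mu>"
    by (simp add: matrix_mset_def content_def case_prod_unfold)
  finally have P: "matrix_mset n (\<lambda>_. 0) \<mu> = pair_mset (dom_word n \<mu>) (dom_word n \<mu>)" ..
  have "leading q (int n ^ 2 + 1) (dom_word n \<mu>) (monomial (dom_word n \<mu>)) (matrix_mset n (\<lambda>_. 0) \<mu>) 1"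
    unfolding leading_def Hecke_symmetric_def P
    by (auto simp: Hecke_equal cf_monomial list_all2_refl dest: zip_diag intro: exI [of _ 0] split: if_splits)
  then show ?case
    by (intro exI [of _ 1]) (simp add: Eop_simps Laurent_unit_def Laurent_1)
next
  case (Cons \<alpha> \<beta>s)
  obtain i j where ij: "\<alpha> = (i, j)" by (cases \<alpha>)
  let ?A = "\<lambda>\<alpha>. if \<alpha> \<in> set \<beta>s then A \<alpha> else 0"
  let ?A' = "\<lambda>\<alpha>'. if \<alpha>' \<in> set (\<alpha> # \<beta>s) then A \<alpha>' else 0"
  obtain c where c: "Laurent_unit c" "leading q (int n ^ 2 + 1) (dom_word n \<mu>) (Eop q \<beta>s A (monomial (dom_word n \<mu>))) (matrix_mset n ?A \<mu>) c"
    using Cons by auto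
  have phi: "(i, j) \<in> Phi_pos n" and "i < j" and jn: "j \<in> {1..n}" and "(j, j) \<notin> Phi_pos n"
    using Cons.prems by (auto simp: ij Phi_pos_def)
  have A': "?A' = ?A((i, j) := A \<alpha>)"
    using ij by auto
  have A0: "?A (i, j) = 0"
    using Cons.prems ij by simp
  note cu = content_update [of i j n ?A "A \<alpha>", OF phi A0, folded A']
  have "content n ?A' j \<le> content n A j"
    by (rule content_mono) auto
  then have le: "content n ?A j + A \<alpha> \<le> \<mu> j"
    using assms(3) jn cu [of j] by (force simp: wt_le_def)
  have "count (matrix_mset n ?A \<mu>) (j, i) = 0" "A \<alpha> \<le> count (matrix_mset n ?A \<mu>) (j, j)"
    using A0 le \<open>i < j\<close> jn by (simp_all add: count_matrix_mset)
  from leading_Xop [OF sorted_dom_word _ _ \<open>i < j\<close> c(2) this c(1), of n]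
  have "\<exists>c. Laurent_unit c \<and> leading q (int n ^ 2 + 1) (dom_word n \<mu>) (Eop q (\<alpha> # \<beta>s) A (monomial (dom_word n \<mu>)))
     (matrix_mset n ?A \<mu> - replicate_mset (A \<alpha>) (j, j) + replicate_mset (A \<alpha>) (j, i)) c"
    using set_dom_word [of n \<mu>] by (force simp: Eop_simps ij)
  moreover have "matrix_mset n ?A \<mu> - replicate_mset (A \<alpha>) (j, j) + replicate_mset (A \<alpha>) (j, i) = matrix_mset n ?A' \<mu>"
  proof (rule multiset_eqI)
    fix p :: "nat \<times> nat"
    obtain x c where p: "p = (x, c)" by (cases p)
    have "?A' (c, x) = (if (c, x) = (i, j) then A \<alpha> else ?A (c, x))"
      using ij by auto
    then show "count (matrix_mset n ?A \<mu> - replicate_mset (A \<alpha>) (j, j) + replicate_mset (A \<alpha>) (j, i)) p = count (matrix_mset n ?A' \<mu>) p"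
      unfolding p count_matrix_mset count_union count_diff count_replicate_mset cu
      using le phi A0 jn \<open>i < j\<close> \<open>(j, j) \<notin> Phi_pos n\<close> by auto
  qed
  ultimately show ?case by simp
qed

lemma matrix_mset_inj:
  assumes "A \<in> Phi_pos n \<rightarrow>\<^sub>E UNIV" "B \<in> Phi_pos n \<rightarrow>\<^sub>E UNIV" "matrix_mset n A \<mu> = matrix_mset n B \<mu>"
  shows "A = B"
proof (rule PiE_ext [OF assms(1,2)])
  fix p assume "p \<in> Phi_pos n"
  then show "A p = B p"
    using arg_cong [OF assms(3), of "\<lambda>M. count M (snd p, fst p)"] by (auto simp: count_matrix_mset Phi_pos_def)
qed

end

section \<open>Matrix coefficients of endomorphisms of tensor space\<close>

definition words :: "nat \<Rightarrow> nat \<Rightarrow> nat list set" where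
  "words n d = {w. length w = d \<and> set w \<subseteq> {1..n}}"

abbreviation entry :: "(nat free \<Rightarrow> nat free) \<Rightarrow> nat list \<Rightarrow> nat list \<Rightarrow> qv" where
  "entry f u w \<equiv> cf (f (monomial w)) u"

lemma finite_words: "finite (words n d)"
  using finite_lists_length_eq [of "{1..n}" d] by (simp add: words_def conj_commute)

lemma rev_words [simp]: "rev w \<in> words n d \<longleftrightarrow> w \<in> words n d"
  by (simp add: words_def)

lemma monomial_tensor: "w \<in> words n d \<Longrightarrow> monomial w \<in> tensor n d"
  by (simp add: words_def tensor_def monomial_def)

lemma tensor_iff: "t \<in> tensor n d \<longleftrightarrow> (\<forall>w. cf t w \<noteq> 0 \<longrightarrow> w \<in> words n d)"
proof -
  have "(\<forall>w\<in>Poly_Mapping.keys t. letters w \<in> words n d) \<longleftrightarrow> (\<forall>w. cf t w \<noteq> 0 \<longrightarrow> w \<in> words n d)"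
    by (metis in_keys_iff word.collapse word.sel)
  then show ?thesis
    by (simp add: tensor_def words_def)
qed

lemma tensor_expand:
  assumes "t \<in> tensor n d"
  shows "t = (\<Sum>w\<in>words n d. cst (cf t w) * monomial w)"
proof (rule free_eqI)
  fix u
  show "cf t u = cf (\<Sum>w\<in>words n d. cst (cf t w) * monomial w) u"
    using assms finite_words [of n d]
    by (auto simp: lookup_sum cf_simps cf_monomial if_distrib [of "\<lambda>x. _ * x"] tensor_iff cong: if_cong)
qed

lemma tensor_sum: "(\<And>i. i \<in> I \<Longrightarrow> f i \<in> tensor n d) \<Longrightarrow> sum f I \<in> tensor n d"
  by (induct I rule: infinite_finite_induct) (simp_all add: tensor_closed)

lemma End_apply:
  assumes "f \<in> carrier (End_tensor n d)"
  shows "t \<in> tensor n d \<Longrightarrow> f t = (\<Sum>w\<in>words n d. cst (cf t w) * f (monomial w))"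
    "t \<in> tensor n d \<Longrightarrow> f t \<in> tensor n d"
proof -
  have f: "\<And>s t. s \<in> tensor n d \<Longrightarrow> t \<in> tensor n d \<Longrightarrow> f (s + t) = f s + f t"
    "\<And>c t. t \<in> tensor n d \<Longrightarrow> f (cst c * t) = cst c * f t"
    using assms by (auto simp: End_carrier)
  have f0: "f 0 = 0"
    using f(2) [of 0 0] by (simp add: tensor_closed)
  have "f (\<Sum>w\<in>W. cst (c w) * monomial w) = (\<Sum>w\<in>W. cst (c w) * f (monomial w))" if "finite W" "W \<subseteq> words n d" for W c
    using that by (induct W) (auto simp: f0 f monomial_tensor tensor_closed tensor_sum subset_iff)
  then show "f t = (\<Sum>w\<in>words n d. cst (cf t w) * f (monomial w))" if "t \<in> tensor n d" for t
    by (subst tensor_expand [OF that]) (simp add: finite_words)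
  show "t \<in> tensor n d \<Longrightarrow> f t \<in> tensor n d"
    using assms by (simp add: End_carrier)
qed

lemma entry_apply:
  assumes "f \<in> carrier (End_tensor n d)" "t \<in> tensor n d"
  shows "cf (f t) u = (\<Sum>w\<in>words n d. cf t w * entry f u w)"
  by (subst End_apply(1) [OF assms]) (simp only: lookup_sum cf_simps)

lemma entry_outside: "f \<in> carrier (End_tensor n d) \<Longrightarrow> w \<in> words n d \<Longrightarrow> entry f u w \<noteq> 0 \<Longrightarrow> u \<in> words n d"
  using End_apply(2) [OF _ monomial_tensor, of f n d w] unfolding tensor_iff by blast

lemma entry_eqI:
  assumes "f \<in> carrier (End_tensor n d)" "g \<in> carrier (End_tensor n d)"
    "\<And>u w. u \<in> words n d \<Longrightarrow> w \<in> words n d \<Longrightarrow> entry f u w = entry g u w"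
  shows "f = g"
proof (rule End_eqI [of f n d g])
  fix t assume t: "t \<in> tensor n d"
  have "f (monomial w) = g (monomial w)" if "w \<in> words n d" for w
  proof (rule free_eqI)
    fix u show "entry f u w = entry g u w"
      using entry_outside [OF assms(1) that, of u] entry_outside [OF assms(2) that, of u] assms(3) [OF _ that, of u]
      by metis
  qed
  then show "f t = g t"
    using End_apply(1) [OF assms(1) t] End_apply(1) [OF assms(2) t] by simp
qed (use assms in \<open>auto simp: End_carrier\<close>)

lemma End_smult: "c \<odot>\<^bsub>End_tensor n d\<^esub> f = (\<lambda>t\<in>tensor n d. cst c * f t)"
  by (simp add: End_tensor_def)

lemma End_closed:
  assumes "f \<in> carrier (End_tensor n d)" "g \<in> carrier (End_tensor n d)"
  shows "f \<otimes>\<^bsub>End_tensor n d\<^esub> g \<in> carrier (End_tensor n d)" "f \<oplus>\<^bsub>End_tensor n d\<^esub> g \<in> carrier (End_tensor n d)"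
    "c \<odot>\<^bsub>End_tensor n d\<^esub> f \<in> carrier (End_tensor n d)" "\<one>\<^bsub>End_tensor n d\<^esub> \<in> carrier (End_tensor n d)"
    "\<zero>\<^bsub>End_tensor n d\<^esub> \<in> carrier (End_tensor n d)"
proof -
  interpret E: ring "End_tensor n d" by (rule ring_End_tensor)
  show "f \<otimes>\<^bsub>End_tensor n d\<^esub> g \<in> carrier (End_tensor n d)" "f \<oplus>\<^bsub>End_tensor n d\<^esub> g \<in> carrier (End_tensor n d)"
    "\<one>\<^bsub>End_tensor n d\<^esub> \<in> carrier (End_tensor n d)" "\<zero>\<^bsub>End_tensor n d\<^esub> \<in> carrier (End_tensor n d)"
    using assms by auto
  show "c \<odot>\<^bsub>End_tensor n d\<^esub> f \<in> carrier (End_tensor n d)"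
    using assms(1) by (simp add: End_carrier End_smult tensor_closed distrib_left cst_cst mult.commute)
qed

lemma entry_ops:
  assumes "w \<in> words n d"
  shows "entry (f \<oplus>\<^bsub>End_tensor n d\<^esub> g) u w = entry f u w + entry g u w"
    "entry (c \<odot>\<^bsub>End_tensor n d\<^esub> f) u w = c * entry f u w"
    "entry \<zero>\<^bsub>End_tensor n d\<^esub> u w = 0"
    "entry \<one>\<^bsub>End_tensor n d\<^esub> u w = (if u = w then 1 else 0)"
  using monomial_tensor [OF assms] by (auto simp: End_ops End_smult cf_simps cf_monomial)

lemma entry_mult:
  assumes "f \<in> carrier (End_tensor n d)" "g \<in> carrier (End_tensor n d)" "w \<in> words n d"
  shows "entry (f \<otimes>\<^bsub>End_tensor n d\<^esub> g) u w = (\<Sum>x\<in>words n d. entry f u x * entry g x w)"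
proof -
  have "entry (f \<otimes>\<^bsub>End_tensor n d\<^esub> g) u w = cf (f (g (monomial w))) u"
    using monomial_tensor [OF assms(3)] by (simp add: End_ops)
  also have "\<dots> = (\<Sum>x\<in>words n d. entry g x w * entry f u x)"
    by (rule entry_apply [OF assms(1) End_apply(2) [OF assms(2) monomial_tensor [OF assms(3)]]])
  finally show ?thesis
    by (simp only: mult.commute)
qed

lemma entry_A_comb:
  assumes "finite J" "\<And>i. i \<in> J \<Longrightarrow> b i \<in> carrier (End_tensor n d)"
  shows "A_comb (End_tensor n d) J c b \<in> carrier (End_tensor n d)"
    "w \<in> words n d \<Longrightarrow> entry (A_comb (End_tensor n d) J c b) u w = (\<Sum>i\<in>J. c i * entry (b i) u w)"
proof -
  interpret E: ring "End_tensor n d" by (rule ring_End_tensor)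
  have cl: "c i \<odot>\<^bsub>End_tensor n d\<^esub> b i \<in> carrier (End_tensor n d)" if "i \<in> J" for i
    using End_closed(3) assms(2) that by blast
  have "A_comb (End_tensor n d) J' c b \<in> carrier (End_tensor n d) \<and>
    (w \<in> words n d \<longrightarrow> entry (A_comb (End_tensor n d) J' c b) u w = (\<Sum>i\<in>J'. c i * entry (b i) u w))" if "J' \<subseteq> J" for J'
    using finite_subset [OF that assms(1)] that
  proof (induct J')
    case empty
    then show ?case
      using entry_ops(3) by (simp add: A_comb_def E.finsum_empty)
  next
    case (insert i J')
    have "A_comb (End_tensor n d) (insert i J') c b = c i \<odot>\<^bsub>End_tensor n d\<^esub> b i \<oplus>\<^bsub>End_tensor n d\<^esub> A_comb (End_tensor n d) J' c b"
      unfolding A_comb_def using insert cl by (intro E.finsum_insert) auto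
    then show ?case
      using insert cl by (auto simp: entry_ops)
  qed
  from this [of J] show "A_comb (End_tensor n d) J c b \<in> carrier (End_tensor n d)"
    "w \<in> words n d \<Longrightarrow> entry (A_comb (End_tensor n d) J c b) u w = (\<Sum>i\<in>J. c i * entry (b i) u w)"
    by auto
qed

lemma A_span_mono: "X \<subseteq> Y \<Longrightarrow> A_span M X \<subseteq> A_span M Y"
  unfolding A_span_def by blast

section \<open>Submodules and triangular systems over the Laurent polynomials\<close>

definition A_submodule :: "nat \<Rightarrow> nat \<Rightarrow> (nat free \<Rightarrow> nat free) set \<Rightarrow> bool" where
  "A_submodule n d N \<longleftrightarrow> N \<subseteq> carrier (End_tensor n d) \<and> \<zero>\<^bsub>End_tensor n d\<^esub> \<in> N \<and>
     (\<forall>f\<in>N. \<forall>g\<in>N. f \<oplus>\<^bsub>End_tensor n d\<^esub> g \<in> N) \<and> (\<forall>c\<in>Laurent. \<forall>f\<in>N. c \<odot>\<^bsub>End_tensor n d\<^esub> f \<in> N)"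

lemma A_comb_submodule:
  assumes "A_submodule n d N" "finite J" "\<And>i. i \<in> J \<Longrightarrow> b i \<in> N" "\<And>i. i \<in> J \<Longrightarrow> c i \<in> Laurent"
  shows "A_comb (End_tensor n d) J c b \<in> N"
proof -
  interpret E: ring "End_tensor n d" by (rule ring_End_tensor)
  have cl: "c i \<odot>\<^bsub>End_tensor n d\<^esub> b i \<in> N" if "i \<in> J" for i
    using assms that by (auto simp: A_submodule_def)
  have N: "N \<subseteq> carrier (End_tensor n d)"
    using assms(1) by (simp add: A_submodule_def)
  have "A_comb (End_tensor n d) J' c b \<in> N" if "J' \<subseteq> J" for J'
    using finite_subset [OF that assms(2)] that
  proof (induct J')
    case empty
    then show ?case
      using assms(1) by (simp add: A_comb_def E.finsum_empty A_submodule_def)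
  next
    case (insert i J')
    have "A_comb (End_tensor n d) (insert i J') c b = c i \<odot>\<^bsub>End_tensor n d\<^esub> b i \<oplus>\<^bsub>End_tensor n d\<^esub> A_comb (End_tensor n d) J' c b"
      unfolding A_comb_def using insert cl N by (intro E.finsum_insert) auto
    then show ?case
      using insert cl assms(1) by (auto simp: A_submodule_def)
  qed
  then show ?thesis by simp
qed

lemma triangular_max:
  fixes st :: "'i \<Rightarrow> int"
  assumes "finite I" "I \<noteq> {}"
  obtains i0 where "i0 \<in> I" "\<And>i. i \<in> I \<Longrightarrow> st i \<le> st i0"
proof -
  have "Max (st ` I) \<in> st ` I"
    using assms by (intro Max_in) auto
  then obtain i0 where "i0 \<in> I" "st i0 = Max (st ` I)" by auto
  then show thesis
    using that [of i0] assms by simp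
qed

text \<open>An index with the largest \<open>st\<close> can only meet its own column, because
  another row reaching that column would have a larger \<open>st\<close>. So its coefficient is
  found first and the rest follows by induction; ties in \<open>st\<close> do no harm.\<close>

lemma triangular_solve:
  fixes st :: "'i \<Rightarrow> int" and m :: "'i \<Rightarrow> 'i \<Rightarrow> qv"
  assumes "finite I" "\<And>i k. i \<in> I \<Longrightarrow> k \<in> I \<Longrightarrow> m i k \<noteq> 0 \<Longrightarrow> k = i \<or> st k < st i"
    "\<And>i. i \<in> I \<Longrightarrow> Laurent_unit (m i i)" "\<And>i k. i \<in> I \<Longrightarrow> k \<in> I \<Longrightarrow> m i k \<in> Laurent"
    "\<And>k. k \<in> I \<Longrightarrow> y k \<in> Laurent"
  shows "\<exists>c. (\<forall>i\<in>I. c i \<in> Laurent) \<and> (\<forall>k\<in>I. y k = (\<Sum>i\<in>I. c i * m i k))"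
  using assms
proof (induct "card I" arbitrary: I y)
  case (Suc l)
  then have "I \<noteq> {}" by auto
  then obtain i0 where i0: "i0 \<in> I" "\<And>i. i \<in> I \<Longrightarrow> st i \<le> st i0"
    using triangular_max [OF Suc.prems(1)] by blast
  have m0: "m i i0 = 0" if "i \<in> I - {i0}" for i
    using Suc.prems(2) [of i i0] i0 that by fastforce
  have u: "m i0 i0 \<noteq> 0" "inverse (m i0 i0) \<in> Laurent"
    using Suc.prems(3) [OF i0(1)] by (auto simp: Laurent_unit_def)
  define c0 where "c0 = y i0 * inverse (m i0 i0)"
  have c0: "c0 \<in> Laurent"
    using u Suc.prems(5) [OF i0(1)] by (simp add: c0_def Laurent_mult)
  have "\<exists>c. (\<forall>i\<in>I - {i0}. c i \<in> Laurent) \<and> (\<forall>k\<in>I - {i0}. y k - c0 * m i0 k = (\<Sum>i\<in>I - {i0}. c i * m i k))"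
    using Suc.hyps(2) Suc.prems i0(1) c0
    by (intro Suc.hyps(1)) (auto intro!: Laurent_diff Laurent_mult)
  then obtain c where c: "\<And>i. i \<in> I - {i0} \<Longrightarrow> c i \<in> Laurent"
    "\<And>k. k \<in> I - {i0} \<Longrightarrow> y k - c0 * m i0 k = (\<Sum>i\<in>I - {i0}. c i * m i k)" by blast
  have s: "(\<Sum>i\<in>I. (c(i0 := c0)) i * m i k) = c0 * m i0 k + (\<Sum>i\<in>I - {i0}. c i * m i k)" for k
  proof -
    have "(\<Sum>i\<in>I - {i0}. (c(i0 := c0)) i * m i k) = (\<Sum>i\<in>I - {i0}. c i * m i k)"
      by (rule sum.cong) auto
    then show ?thesis
      by (simp add: sum.remove [OF Suc.prems(1) i0(1)])
  qed
  have "y k = (\<Sum>i\<in>I. (c(i0 := c0)) i * m i k)" if "k \<in> I" for k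
  proof (cases "k = i0")
    case True
    then show ?thesis unfolding s using m0 u by (simp add: c0_def)
  next
    case False
    then show ?thesis unfolding s using c(2) [of k] that by (simp add: algebra_simps)
  qed
  moreover have "\<forall>i\<in>I. (c(i0 := c0)) i \<in> Laurent"
    using c(1) c0 by auto
  ultimately show ?case by blast
qed auto

lemma triangular_unique:
  fixes st :: "'i \<Rightarrow> int" and m :: "'i \<Rightarrow> 'i \<Rightarrow> qv"
  assumes "finite I" "\<And>i k. i \<in> I \<Longrightarrow> k \<in> I \<Longrightarrow> m i k \<noteq> 0 \<Longrightarrow> k = i \<or> st k < st i"
    "\<And>i. i \<in> I \<Longrightarrow> m i i \<noteq> 0" "\<And>k. k \<in> I \<Longrightarrow> (\<Sum>i\<in>I. c i * m i k) = 0"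
  shows "\<forall>i\<in>I. c i = 0"
  using assms
proof (induct "card I" arbitrary: I)
  case (Suc l)
  then have "I \<noteq> {}" by auto
  then obtain i0 where i0: "i0 \<in> I" "\<And>i. i \<in> I \<Longrightarrow> st i \<le> st i0"
    using triangular_max [OF Suc.prems(1)] by blast
  have m0: "m i i0 = 0" if "i \<in> I - {i0}" for i
    using Suc.prems(2) [of i i0] i0 that by fastforce
  have "c i0 = 0"
    using Suc.prems(4) [OF i0(1)] Suc.prems(3) [OF i0(1)] m0 by (simp add: sum.remove [OF Suc.prems(1) i0(1)])
  moreover have "\<forall>i\<in>I - {i0}. c i = 0"
    using Suc.hyps(2) Suc.prems i0(1) \<open>c i0 = 0\<close>
    by (intro Suc.hyps(1)) (auto simp: sum.remove [OF Suc.prems(1) i0(1)])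
  ultimately show ?case by auto
qed auto

text \<open>The sandwich: the \<open>b i\<close> lie in \<open>P\<close>, \<open>P\<close> lies in
  \<open>N\<close>, and the entries at the sites (x i, y i) detect elements of \<open>N\<close>.
  Solving the triangular system puts \<open>N\<close> inside the span of the \<open>b i\<close>, so
  the span of \<open>P\<close> is identified without any reduction of its elements.\<close>

lemma A_basis_triangular:
  fixes st :: "'i \<Rightarrow> int" and n d :: nat
  defines "M \<equiv> End_tensor n d"
  assumes I: "finite I" and N: "A_submodule n d N" and b: "\<And>i. i \<in> I \<Longrightarrow> b i \<in> P" and P: "P \<subseteq> N"
    and sites: "\<And>i. i \<in> I \<Longrightarrow> x i \<in> words n d" "\<And>i. i \<in> I \<Longrightarrow> y i \<in> words n d"
    and Laurent: "\<And>f u w. f \<in> N \<Longrightarrow> u \<in> words n d \<Longrightarrow> w \<in> words n d \<Longrightarrow> entry f u w \<in> Laurent"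
    and tri: "\<And>i k. i \<in> I \<Longrightarrow> k \<in> I \<Longrightarrow> entry (b i) (x k) (y k) \<noteq> 0 \<Longrightarrow> k = i \<or> st k < st i"
    and unit: "\<And>i. i \<in> I \<Longrightarrow> Laurent_unit (entry (b i) (x i) (y i))"
    and inj: "\<And>f u w. f \<in> N \<Longrightarrow> (\<And>i. i \<in> I \<Longrightarrow> entry f (x i) (y i) = 0) \<Longrightarrow> u \<in> words n d \<Longrightarrow> w \<in> words n d \<Longrightarrow> entry f u w = 0"
  shows "A_basis M I b (A_span M P)"
proof -
  have bN: "b i \<in> N" if "i \<in> I" for i
    using b P that by blast
  have NM: "N \<subseteq> carrier M"
    using N by (simp add: A_submodule_def M_def)
  have ind: "A_independent M I b"
    unfolding A_independent_def
  proof (intro allI impI)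
    fix J c assume J: "finite J \<and> J \<subseteq> I \<and> c \<in> J \<rightarrow> Laurent \<and> A_comb M J c b = \<zero>\<^bsub>M\<^esub>"
    let ?c = "\<lambda>i. if i \<in> J then c i else 0"
    have "(\<Sum>i\<in>I. ?c i * entry (b i) (x k) (y k)) = 0" if "k \<in> I" for k
    proof -
      have "(\<Sum>i\<in>J. c i * entry (b i) (x k) (y k)) = entry (A_comb M J c b) (x k) (y k)"
        unfolding M_def using J bN NM sites(2) [OF that] by (intro entry_A_comb(2) [symmetric]) (auto simp: M_def)
      also have "\<dots> = 0"
        using J sites(2) [OF that] by (simp add: M_def entry_ops)
      finally have "(\<Sum>i\<in>J. c i * entry (b i) (x k) (y k)) = 0" .
      moreover have "(\<Sum>i\<in>I. ?c i * entry (b i) (x k) (y k)) = (\<Sum>i\<in>J. c i * entry (b i) (x k) (y k))"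
        by (rule sum.mono_neutral_cong_right) (use I J in auto)
      ultimately show ?thesis by simp
    qed
    then have "\<forall>i\<in>I. ?c i = 0"
      using tri unit by (intro triangular_unique [OF I, of "\<lambda>i k. entry (b i) (x k) (y k)" st]) (auto simp: Laurent_unit_def)
    then show "\<forall>i\<in>J. c i = 0"
      using J by (metis subsetD)
  qed
  have "N \<subseteq> A_span M (b ` I)"
  proof
    fix f assume f: "f \<in> N"
    have "\<exists>c. (\<forall>i\<in>I. c i \<in> Laurent) \<and> (\<forall>k\<in>I. entry f (x k) (y k) = (\<Sum>i\<in>I. c i * entry (b i) (x k) (y k)))"
      by (rule triangular_solve [OF I tri unit]) (simp_all add: Laurent bN f sites)
    then obtain c where c: "\<And>i. i \<in> I \<Longrightarrow> c i \<in> Laurent"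
      "\<And>k. k \<in> I \<Longrightarrow> entry f (x k) (y k) = (\<Sum>i\<in>I. c i * entry (b i) (x k) (y k))"
      by blast
    let ?g = "A_comb M I c b"
    have gN: "?g \<in> N"
      unfolding M_def by (rule A_comb_submodule [OF N I]) (use bN c in auto)
    have cog: "entry ?g u w = (\<Sum>i\<in>I. c i * entry (b i) u w)" if "w \<in> words n d" for u w
      unfolding M_def using I bN NM that by (intro entry_A_comb(2)) (auto simp: M_def)
    \<comment> \<open>The difference lies in \<open>N\<close> and vanishes at all sites, hence
      everywhere.\<close>
    let ?h = "f \<oplus>\<^bsub>M\<^esub> ((- 1) \<odot>\<^bsub>M\<^esub> ?g)"
    have "- 1 \<in> Laurent"
      by (intro Laurent_intros)
    then have hN: "?h \<in> N"
      using N f gN by (auto simp: A_submodule_def M_def)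
    have coh: "entry ?h u w = entry f u w - entry ?g u w" if "w \<in> words n d" for u w
      using that by (simp add: M_def entry_ops)
    have "entry ?h u w = 0" if "u \<in> words n d" "w \<in> words n d" for u w
      by (rule inj [OF hN _ that]) (simp add: coh sites c(2) cog)
    then have fg: "entry f u w = entry ?g u w" if "u \<in> words n d" "w \<in> words n d" for u w
      using that coh by simp
    \<comment> \<open>\<open>A_span\<close> attaches coefficients to elements instead of indices, so
      the coefficients are added up over each fibre of \<open>b\<close>.\<close>
    define e where "e z = (\<Sum>i\<in>{i\<in>I. b i = z}. c i)" for z
    have "f = A_comb M (b ` I) e (\<lambda>z. z)"
      unfolding M_def
    proof (rule entry_eqI)
      show "f \<in> carrier (End_tensor n d)"
        using f NM by (auto simp: M_def)
      show "A_comb (End_tensor n d) (b ` I) e (\<lambda>z. z) \<in> carrier (End_tensor n d)"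
        using I bN NM by (intro entry_A_comb) (auto simp: M_def)
      fix u w assume uw: "u \<in> words n d" "w \<in> words n d"
      have "entry (A_comb (End_tensor n d) (b ` I) e (\<lambda>z. z)) u w = (\<Sum>z\<in>b ` I. e z * entry z u w)"
        using I bN NM uw by (intro entry_A_comb(2)) (auto simp: M_def)
      also have "\<dots> = (\<Sum>z\<in>b ` I. \<Sum>i\<in>{i\<in>I. b i = z}. c i * entry (b i) u w)"
        unfolding e_def sum_distrib_right by (intro sum.cong) auto
      also have "\<dots> = (\<Sum>i\<in>I. c i * entry (b i) u w)"
        by (rule sum.image_gen [OF I, symmetric])
      finally show "entry f u w = entry (A_comb (End_tensor n d) (b ` I) e (\<lambda>z. z)) u w"
        using fg [OF uw] cog [OF uw(2)] by simp
    qed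
    moreover have "e \<in> b ` I \<rightarrow> Laurent"
      using c(1) by (auto simp: e_def intro!: Laurent_sum)
    ultimately show "f \<in> A_span M (b ` I)"
      unfolding A_span_def using I by blast
  qed
  moreover have "A_span M (b ` I) \<subseteq> A_span M P"
    using b by (intro A_span_mono) auto
  moreover have "A_span M P \<subseteq> N"
    unfolding A_span_def M_def using P by (auto intro!: A_comb_submodule [OF N])
  ultimately show ?thesis
    unfolding A_basis_def using ind bN NM by blast
qed

section \<open>The module of Hecke-equivariant, integral, upper triangular endomorphisms\<close>

lemma lin_restrict_End:
  assumes "lin F" "\<And>t. t \<in> tensor n d \<Longrightarrow> F t \<in> tensor n d"
  shows "restrict F (tensor n d) \<in> carrier (End_tensor n d)"
  using assms(2) by (simp add: End_carrier tensor_closed linD [OF assms(1)])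

lemma lin_tensor:
  assumes "lin F" "\<And>w. w \<in> words n d \<Longrightarrow> F (monomial w) \<in> tensor n d" "t \<in> tensor n d"
  shows "F t \<in> tensor n d"
  by (subst tensor_expand [OF assms(3)])
     (auto simp: linD [OF assms(1)] intro!: tensor_sum tensor_closed assms(2))

lemma lin_cong_words:
  assumes "lin F" "lin G" "\<And>w. w \<in> words n d \<Longrightarrow> F (monomial w) = G (monomial w)" "t \<in> tensor n d"
  shows "F t = G t"
  by (subst (1 2) tensor_expand [OF assms(4)]) (simp add: linD [OF assms(1)] linD [OF assms(2)] assms(3))

lemma cf_lin_words:
  assumes "lin F" "t \<in> tensor n d"
  shows "cf (F t) u = (\<Sum>w\<in>words n d. cf t w * cf (F (monomial w)) u)"
proof -
  have "F t = (\<Sum>w\<in>words n d. cst (cf t w) * F (monomial w))"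
    by (subst tensor_expand [OF assms(2)]) (simp only: linD(2,6) [OF assms(1)])
  then show ?thesis
    by (simp only: lookup_sum cf_simps)
qed

lemma Hecke_two_terms:
  "\<exists>w' a b. mset w' = mset w \<and> Hecke q k (monomial w) = cst a * monomial w + cst b * monomial w'"
proof -
  have triv: "\<exists>w' a b. mset w' = mset w \<and> Hecke_word q k w = cst a * monomial w + cst b * monomial w'"
    if "Hecke_word q k w = monomial w" for q k w
    using that by (intro exI [of _ w] exI [of _ 1] exI [of _ 0]) simp
  have "\<exists>w' a b. mset w' = mset w \<and> Hecke_word q k w = cst a * monomial w + cst b * monomial w'"
  proof (induct q k w rule: Hecke_word.induct)
    case (1 q x y w)
    consider "x = y" | "x < y" | "y < x" by linarith
    then show ?case
    proof cases
      case 1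
      then show ?thesis
        by (intro exI [of _ "x # y # w"] exI [of _ "inverse q"] exI [of _ 0]) simp
    next
      case 2
      then show ?thesis
        by (intro exI [of _ "y # x # w"] exI [of _ "inverse q - q"] exI [of _ 1]) simp
    next
      case 3
      then show ?thesis
        by (intro exI [of _ "y # x # w"] exI [of _ 0] exI [of _ 1]) simp
    qed
  next
    case (2 q k x w)
    then obtain w' a b where "mset w' = mset w" "Hecke_word q k w = cst a * monomial w + cst b * monomial w'"
      by blast
    then show ?case
      by (intro exI [of _ "x # w'"] exI [of _ a] exI [of _ b]) (simp add: monomial_Cons distrib_left gen_cst)
  qed (rule triv; simp)+
  then show ?thesis
    by (simp add: Hecke_monomial)
qed

lemma words_mset: "w \<in> words n d \<Longrightarrow> mset w' = mset w \<Longrightarrow> w' \<in> words n d"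
  unfolding words_def by (metis (mono_tags, lifting) mem_Collect_eq mset_eq_length mset_eq_setD)

lemma Hecke_tensor: "t \<in> tensor n d \<Longrightarrow> Hecke q k t \<in> tensor n d"
proof (rule lin_tensor [OF lin_Hecke])
  fix w assume "w \<in> words n d"
  moreover obtain w' a b where "mset w' = mset w" "Hecke q k (monomial w) = cst a * monomial w + cst b * monomial w'"
    using Hecke_two_terms by blast
  ultimately show "Hecke q k (monomial w) \<in> tensor n d"
    using words_mset by (simp add: tensor_closed monomial_tensor)
qed

lemma Rop_tensor:
  assumes "(i, j) \<in> Phi_pos n" "t \<in> tensor n d"
  shows "Rop q i j t \<in> tensor n d"
proof (rule lin_tensor [OF lin_Rop _ assms(2)])
  fix w assume w: "w \<in> words n d"
  have ij: "i < j" "i \<in> {1..n}"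
    using assms(1) by (auto simp: Phi_pos_def)
  have "u \<in> words n d" if "cf (Rop q i j (monomial w)) u \<noteq> 0" for u
  proof -
    note s = Rop_support [OF ij(1) that]
    have "set u \<subseteq> insert i (set w)"
      using arg_cong [OF s(3), of set_mset] by auto
    moreover have "length u = length w"
      using s(1) by (rule list_all2_lengthD)
    ultimately show ?thesis
      using w ij by (auto simp: words_def)
  qed
  then show "Rop q i j (monomial w) \<in> tensor n d"
    by (auto simp: tensor_iff)
qed

context v_or_inverse
begin

definition Hecke_upper :: "nat \<Rightarrow> nat \<Rightarrow> (nat free \<Rightarrow> nat free) set" where
  "Hecke_upper n d = {f \<in> carrier (End_tensor n d).
     (\<forall>u\<in>words n d. \<forall>w\<in>words n d. entry f u w \<in> Laurent \<and> (entry f u w \<noteq> 0 \<longrightarrow> list_all2 (\<le>) u w)) \<and>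
     (\<forall>k. \<forall>t\<in>tensor n d. f (Hecke q k t) = Hecke q k (f t))}"

lemma Hecke_upper_subalgebra: "A_subalgebra (End_tensor n d) (Hecke_upper n d)"
  unfolding A_subalgebra_def
proof (intro conjI ballI)
  show "Hecke_upper n d \<subseteq> carrier (End_tensor n d)"
    by (auto simp: Hecke_upper_def)
  have 1: "\<one>\<^bsub>End_tensor n d\<^esub> \<in> carrier (End_tensor n d)"
    using ring.ring_simprules(6) [OF ring_End_tensor] .
  then show "\<one>\<^bsub>End_tensor n d\<^esub> \<in> Hecke_upper n d"
    by (auto simp: Hecke_upper_def entry_ops Laurent_intros list_all2_refl) (simp add: End_ops Hecke_tensor)
  fix f assume f: "f \<in> Hecke_upper n d"
  then have fc: "f \<in> carrier (End_tensor n d)"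
    by (simp add: Hecke_upper_def)
  {
    fix g assume g: "g \<in> Hecke_upper n d"
    then have gc: "g \<in> carrier (End_tensor n d)"
      by (simp add: Hecke_upper_def)
    show "f \<oplus>\<^bsub>End_tensor n d\<^esub> g \<in> Hecke_upper n d"
      unfolding Hecke_upper_def mem_Collect_eq
    proof (intro conjI ballI allI)
      show "f \<oplus>\<^bsub>End_tensor n d\<^esub> g \<in> carrier (End_tensor n d)"
        by (rule End_closed [OF fc gc])
      fix u w assume "u \<in> words n d" "w \<in> words n d"
      then show "entry (f \<oplus>\<^bsub>End_tensor n d\<^esub> g) u w \<in> Laurent" "entry (f \<oplus>\<^bsub>End_tensor n d\<^esub> g) u w \<noteq> 0 \<longrightarrow> list_all2 (\<le>) u w"
        using f g by (auto simp: entry_ops Hecke_upper_def Laurent_add) (metis add.right_neutral)+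
    next
      fix k t assume "t \<in> tensor n d"
      then show "(f \<oplus>\<^bsub>End_tensor n d\<^esub> g) (Hecke q k t) = Hecke q k ((f \<oplus>\<^bsub>End_tensor n d\<^esub> g) t)"
        using f g by (simp add: End_ops Hecke_tensor Hecke_upper_def linD [OF lin_Hecke])
    qed
    show "f \<otimes>\<^bsub>End_tensor n d\<^esub> g \<in> Hecke_upper n d"
      unfolding Hecke_upper_def mem_Collect_eq
    proof (intro conjI ballI allI)
      show "f \<otimes>\<^bsub>End_tensor n d\<^esub> g \<in> carrier (End_tensor n d)"
        by (rule End_closed [OF fc gc])
      fix u w assume u: "u \<in> words n d" and w: "w \<in> words n d"
      show "entry (f \<otimes>\<^bsub>End_tensor n d\<^esub> g) u w \<in> Laurent"
        unfolding entry_mult [OF fc gc w] using f g u w by (auto intro!: Laurent_sum Laurent_mult simp: Hecke_upper_def)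
      show "entry (f \<otimes>\<^bsub>End_tensor n d\<^esub> g) u w \<noteq> 0 \<longrightarrow> list_all2 (\<le>) u w"
      proof
        assume "entry (f \<otimes>\<^bsub>End_tensor n d\<^esub> g) u w \<noteq> 0"
        then obtain x where x: "x \<in> words n d" "entry f u x * entry g x w \<noteq> 0"
          unfolding entry_mult [OF fc gc w] by (rule sum.not_neutral_contains_not_neutral)
        then have "list_all2 (\<le>) u x" "list_all2 (\<le>) x w"
          using f g u w by (auto simp: Hecke_upper_def)
        then show "list_all2 (\<le>) u w"
          by (rule list_all2_trans [rotated]) auto
      qed
    next
      fix k t assume "t \<in> tensor n d"
      then show "(f \<otimes>\<^bsub>End_tensor n d\<^esub> g) (Hecke q k t) = Hecke q k ((f \<otimes>\<^bsub>End_tensor n d\<^esub> g) t)"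
        using f g End_apply(2) [OF gc] by (simp add: End_ops Hecke_tensor Hecke_upper_def)
    qed
  }
  fix c assume c: "c \<in> Laurent"
  show "c \<odot>\<^bsub>End_tensor n d\<^esub> f \<in> Hecke_upper n d"
    unfolding Hecke_upper_def mem_Collect_eq
  proof (intro conjI ballI allI)
    show "c \<odot>\<^bsub>End_tensor n d\<^esub> f \<in> carrier (End_tensor n d)"
      by (rule End_closed [OF fc fc])
    fix u w assume "u \<in> words n d" "w \<in> words n d"
    then show "entry (c \<odot>\<^bsub>End_tensor n d\<^esub> f) u w \<in> Laurent" "entry (c \<odot>\<^bsub>End_tensor n d\<^esub> f) u w \<noteq> 0 \<longrightarrow> list_all2 (\<le>) u w"
      using f c by (auto simp: entry_ops Hecke_upper_def Laurent_mult)
  next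
    fix k t assume "t \<in> tensor n d"
    then show "(c \<odot>\<^bsub>End_tensor n d\<^esub> f) (Hecke q k t) = Hecke q k ((c \<odot>\<^bsub>End_tensor n d\<^esub> f) t)"
      using f by (simp add: End_smult Hecke_tensor Hecke_upper_def linD [OF lin_Hecke])
  qed
qed

text \<open>Hecke operators map a word to a combination of words of the same weight, on all of which
  \<open>G\<close> acts by the same scalar. This covers the generators of S^0 for both choices of
  \<open>q\<close>.\<close>

lemma Hecke_upper_diag:
  assumes G: "lin G" and h: "\<And>w. w \<in> words n d \<Longrightarrow> G (monomial w) = cst (h (mset w)) * monomial w"
    and L: "\<And>w. w \<in> words n d \<Longrightarrow> h (mset w) \<in> Laurent"
  shows "restrict G (tensor n d) \<in> Hecke_upper n d"
  unfolding Hecke_upper_def mem_Collect_eq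
proof (intro conjI ballI allI)
  have t: "G t \<in> tensor n d" if "t \<in> tensor n d" for t
    by (rule lin_tensor [OF G _ that]) (simp add: h tensor_closed monomial_tensor)
  then show "restrict G (tensor n d) \<in> carrier (End_tensor n d)"
    by (rule lin_restrict_End [OF G])
  fix u w assume "u \<in> words n d" "w \<in> words n d"
  then show "entry (restrict G (tensor n d)) u w \<in> Laurent" "entry (restrict G (tensor n d)) u w \<noteq> 0 \<longrightarrow> list_all2 (\<le>) u w"
    using L by (auto simp: monomial_tensor h cf_simps cf_monomial list_all2_refl Laurent_0)
next
  fix k t assume "t \<in> tensor n d"
  have "G (Hecke q k t) = Hecke q k (G t)"
  proof (rule lin_cong_words [OF _ _ _ \<open>t \<in> tensor n d\<close>])
    show "lin (\<lambda>t. G (Hecke q k t))" "lin (\<lambda>t. Hecke q k (G t))"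
      by (rule lin_comp [OF G lin_Hecke], rule lin_comp [OF lin_Hecke G])
    fix w assume w: "w \<in> words n d"
    obtain w' a b where w': "mset w' = mset w" "Hecke q k (monomial w) = cst a * monomial w + cst b * monomial w'"
      using Hecke_two_terms by blast
    show "G (Hecke q k (monomial w)) = Hecke q k (G (monomial w))"
      using h [OF w] h [OF words_mset [OF w w'(1)]] w'(1)
      by (simp add: w'(2) linD [OF G] linD [OF lin_Hecke] cst_cst distrib_left mult.commute)
  qed
  then show "restrict G (tensor n d) (Hecke q k t) = Hecke q k (restrict G (tensor n d) t)"
    using \<open>t \<in> tensor n d\<close> by (simp add: Hecke_tensor)
qed

lemma Rop_power_support:
  assumes "i < j"
  shows "cf ((Rop q i j ^^ m) (monomial w)) u \<noteq> 0 \<Longrightarrow> list_all2 (\<le>) u w"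
proof (induct m arbitrary: u)
  case 0
  then show ?case by (simp add: cf_monomial list_all2_refl split: if_splits)
next
  case (Suc m)
  then have "cf (Rop q i j ((Rop q i j ^^ m) (monomial w))) u \<noteq> 0" by simp
  then obtain x where x: "cf ((Rop q i j ^^ m) (monomial w)) x \<noteq> 0" "cf (Rop q i j (monomial x)) u \<noteq> 0"
    by (rule cf_lin_nz [OF lin_Rop])
  then show ?case
    using Rop_support(1) [OF assms x(2)] Suc.hyps [OF x(1)] by (auto intro: list_all2_trans [of "(\<le>)" "(\<le>)"])
qed

lemma Xop_tensor: "(i, j) \<in> Phi_pos n \<Longrightarrow> t \<in> tensor n d \<Longrightarrow> Xop q i j m t \<in> tensor n d"
proof -
  assume ij: "(i, j) \<in> Phi_pos n" and t: "t \<in> tensor n d"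
  have "(Rop q i j ^^ m) t \<in> tensor n d"
    using t by (induct m) (simp_all add: Rop_tensor [OF ij])
  then show ?thesis by (simp add: Xop_def tensor_closed)
qed

lemma Hecke_upper_Xop:
  assumes ij: "(i, j) \<in> Phi_pos n"
  shows "restrict (Xop q i j m) (tensor n d) \<in> Hecke_upper n d"
  unfolding Hecke_upper_def mem_Collect_eq
proof (intro conjI ballI allI)
  have "i < j" using ij by (simp add: Phi_pos_def)
  show "restrict (Xop q i j m) (tensor n d) \<in> carrier (End_tensor n d)"
    by (rule lin_restrict_End [OF lin_Xop Xop_tensor [OF ij]])
  fix u w assume "u \<in> words n d" "w \<in> words n d"
  then have r: "entry (restrict (Xop q i j m) (tensor n d)) u w = cf (Xop q i j m (monomial w)) u"
    by (simp add: monomial_tensor)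
  have "Xop q i j m (monomial w) = cst (inverse q ^ ((j - i - 1) * m)) * (cst (1 / qfact m) * (Rop q i j ^^ m) (monomial w))"
    by (simp add: Xop_def cst_cst)
  also have "\<dots> \<in> Lat"
    by (intro Lat_closed(3) Rop_divided_Lat Lat_closed(4) \<open>i < j\<close> Laurent_power q_Laurent)
  finally show "entry (restrict (Xop q i j m) (tensor n d)) u w \<in> Laurent"
    unfolding r by (simp add: Lat_def)
  show "entry (restrict (Xop q i j m) (tensor n d)) u w \<noteq> 0 \<longrightarrow> list_all2 (\<le>) u w"
    unfolding r Xop_def cf_simps using Rop_power_support [OF \<open>i < j\<close>] by auto
next
  fix k t assume t: "t \<in> tensor n d"
  have "i < j" using ij by (simp add: Phi_pos_def)
  have "Hecke q k ((Rop q i j ^^ m) t) = (Rop q i j ^^ m) (Hecke q k t)"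
    by (induct m) (simp_all add: Hecke_Rop \<open>i < j\<close>)
  then show "restrict (Xop q i j m) (tensor n d) (Hecke q k t) = Hecke q k (restrict (Xop q i j m) (tensor n d) t)"
    using t by (simp add: Hecke_tensor Xop_def linD [OF lin_Hecke])
qed

end

section \<open>Triangularity\<close>

lemma Hecke_desc:
  assumes "Suc k < length w" "w ! Suc k < w ! k"
  shows "Hecke q k (monomial w) = monomial (swap k w)"
proof -
  have "Hecke_word q k w = monomial (swap k w)"
    using assms
  proof (induct k arbitrary: w)
    case 0
    then obtain a b u where "w = a # b # u"
      by (cases w; cases "tl w") auto
    then show ?case using 0 by (simp add: swap_def)
  next
    case (Suc k)
    then obtain a u where "w = a # u"
      by (cases w) auto
    then show ?case using Suc by (simp add: swap_def flip: monomial_Cons)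
  qed
  then show ?thesis
    by (simp add: Hecke_monomial)
qed

text \<open>The site belonging to a matrix. It does not mention \<open>q\<close>, so the upper and
  the lower algebra can share it; existence comes from \<open>to_block_sorted\<close>, and
  \<open>block_sorted_unique\<close> makes the choice harmless.\<close>

definition block_word :: "nat \<Rightarrow> (nat \<times> nat \<Rightarrow> nat) \<Rightarrow> (nat \<Rightarrow> nat) \<Rightarrow> nat list" where
  "block_word n A \<mu> = (SOME u. length u = length (dom_word n \<mu>) \<and> pair_mset (dom_word n \<mu>) u = matrix_mset n A \<mu> \<and> block_sorted (dom_word n \<mu>) u)"

lemma block_word:
  assumes "length b = length (dom_word n \<mu>)" "pair_mset (dom_word n \<mu>) b = matrix_mset n A \<mu>"
  shows "length (block_word n A \<mu>) = length (dom_word n \<mu>)" "pair_mset (dom_word n \<mu>) (block_word n A \<mu>) = matrix_mset n A \<mu>" "block_sorted (dom_word n \<mu>) (block_word n A \<mu>)"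
proof -
  have "\<exists>u. length u = length (dom_word n \<mu>) \<and> pair_mset (dom_word n \<mu>) u = matrix_mset n A \<mu> \<and> block_sorted (dom_word n \<mu>) u"
    using to_block_sorted [OF assms(1) v_nz] assms(2) by metis
  from someI_ex [OF this] show "length (block_word n A \<mu>) = length (dom_word n \<mu>)"
    "pair_mset (dom_word n \<mu>) (block_word n A \<mu>) = matrix_mset n A \<mu>" "block_sorted (dom_word n \<mu>) (block_word n A \<mu>)"
    unfolding block_word_def by auto
qed

lemma matrix_mset_cong: "(\<And>p. p \<in> Phi_pos n \<Longrightarrow> A p = B p) \<Longrightarrow> matrix_mset n A \<mu> = matrix_mset n B \<mu>"
proof -
  assume *: "\<And>p. p \<in> Phi_pos n \<Longrightarrow> A p = B p"
  have "content n A x = content n B x" for x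
    unfolding content_def by (rule sum.cong) (auto simp: *)
  then show ?thesis
    by (intro multiset_eqI) (auto simp: count_matrix_mset * split_paired_all)
qed

lemma dom_word_in_words: "\<mu> \<in> Lambda n d \<Longrightarrow> dom_word n \<mu> \<in> words n d"
  using set_dom_word length_dom_word by (simp add: words_def)

lemma content_column: "x \<in> {1..n} \<Longrightarrow> content n A x = (\<Sum>c\<in>{1..<x}. A (c, x))"
proof -
  assume x: "x \<in> {1..n}"
  have "content n A x = (\<Sum>p\<in>(\<lambda>c. (c, x)) ` {1..<x}. A p)"
    unfolding content_def
    by (rule sum.mono_neutral_cong_right [OF finite_Phi_pos]) (use x in \<open>auto simp: Phi_pos_def split: if_splits\<close>)
  then show ?thesis
    by (simp add: sum.reindex inj_on_def)
qed

text \<open>Each occurrence of \<open>x\<close> in the descending word has exactly one partner in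
  \<open>u\<close>, so the pairs with first entry \<open>x\<close> number \<open>\<mu> x\<close>.
  Their off-diagonal part is the content at \<open>x\<close>, which is therefore at most
  \<open>\<mu> x\<close>.\<close>

lemma matrix_of_word:
  assumes \<mu>: "\<mu> \<in> Lambda n d" and u: "u \<in> words n d" "list_all2 (\<le>) u (dom_word n \<mu>)"
  defines "A \<equiv> \<lambda>p\<in>Phi_pos n. count (pair_mset (dom_word n \<mu>) u) (snd p, fst p)"
  shows "(A, \<mu>) \<in> Borel_index n d" "pair_mset (dom_word n \<mu>) u = matrix_mset n A \<mu>"
proof -
  let ?M = "pair_mset (dom_word n \<mu>) u"
  have len: "length u = length (dom_word n \<mu>)"
    using u(2) by (rule list_all2_lengthD)
  have M: "x \<in> {1..n} \<and> c \<in> {1..n} \<and> c \<le> x" if "(x, c) \<in># ?M" for x c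
  proof -
    have "(x, c) \<in> set (zip (dom_word n \<mu>) u)"
      using that by simp
    then obtain p where "p < length u" "x = dom_word n \<mu> ! p" "c = u ! p"
      using len by (auto simp: set_zip)
    then show ?thesis
      using u len set_dom_word [of n \<mu>] by (auto simp: words_def list_all2_conv_all_nth subset_iff)
  qed
  have M0: "count ?M (x, c) = 0" if "\<not> (x \<in> {1..n} \<and> c \<in> {1..n} \<and> c \<le> x)" for x c
    using M [of x c] that by (auto simp: not_in_iff)
  have col: "\<mu> x = count ?M (x, x) + content n A x" if x: "x \<in> {1..n}" for x
  proof -
    have "\<mu> x = count (mset (map fst (zip (dom_word n \<mu>) u))) x"
      using count_dom_word [of n \<mu> x] x len by (simp add: count_mset)
    also have "\<dots> = count (image_mset fst ?M) x"
      by simp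
    also have "\<dots> = (\<Sum>p\<in>fst -` {x} \<inter> set_mset ?M. count ?M p)"
      by (rule count_image_mset)
    also have "\<dots> = (\<Sum>p\<in>Pair x ` {1..x}. count ?M p)"
      by (rule sum.mono_neutral_cong_left) (use M in \<open>auto simp: not_in_iff\<close>)
    also have "\<dots> = (\<Sum>c\<in>{1..x}. count ?M (x, c))"
      by (simp add: sum.reindex inj_on_def)
    also have "{1..x} = insert x {1..<x}"
      using x by auto
    also have "(\<Sum>c\<in>insert x {1..<x}. count ?M (x, c)) = count ?M (x, x) + (\<Sum>c\<in>{1..<x}. count ?M (x, c))"
      by simp
    also have "(\<Sum>c\<in>{1..<x}. count ?M (x, c)) = (\<Sum>c\<in>{1..<x}. A (c, x))"
      by (rule sum.cong) (use x in \<open>auto simp: A_def Phi_pos_def\<close>)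
    finally show ?thesis
      by (simp add: content_column [OF x])
  qed
  show "(A, \<mu>) \<in> Borel_index n d"
    using \<mu> col by (auto simp: Borel_index_def A_def wt_le_def)
  show "?M = matrix_mset n A \<mu>"
  proof (rule multiset_eqI)
    fix p :: "nat \<times> nat"
    obtain x c where p: "p = (x, c)" by (cases p)
    show "count ?M p = count (matrix_mset n A \<mu>) p"
      unfolding p count_matrix_mset using M0 [of x c] col [of x] by (auto simp: A_def Phi_pos_def)
  qed
qed

lemma finite_Borel_index: "finite (Borel_index n d)"
proof (rule finite_subset)
  show "Borel_index n d \<subseteq> (Phi_pos n \<rightarrow>\<^sub>E {0..d}) \<times> ({1..n} \<rightarrow>\<^sub>E {0..d})"
  proof
    fix i assume "i \<in> Borel_index n d"
    then obtain A \<mu> where i: "i = (A, \<mu>)" "A \<in> Phi_pos n \<rightarrow>\<^sub>E UNIV" "\<mu> \<in> {1..n} \<rightarrow>\<^sub>E UNIV"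
      "(\<Sum>i=1..n. \<mu> i) = d" "wt_le n (content n A) \<mu>"
      by (auto simp: Borel_index_def Lambda_def)
    have \<mu>: "\<mu> x \<le> d" if "x \<in> {1..n}" for x
      unfolding i(4) [symmetric] by (rule member_le_sum) (use that in auto)
    have "A (c, x) \<le> d" if "(c, x) \<in> Phi_pos n" for c x
    proof -
      have x: "x \<in> {1..n}" "c \<in> {1..<x}"
        using that by (auto simp: Phi_pos_def)
      have "A (c, x) \<le> content n A x"
        unfolding content_column [OF x(1)] by (rule member_le_sum) (use x in auto)
      then show ?thesis
        using i(5) \<mu> [OF x(1)] x(1) by (force simp: wt_le_def)
    qed
    then show "i \<in> (Phi_pos n \<rightarrow>\<^sub>E {0..d}) \<times> ({1..n} \<rightarrow>\<^sub>E {0..d})"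
      using i \<mu> by (auto simp: PiE_def)
  qed
  show "finite ((Phi_pos n \<rightarrow>\<^sub>E {0..d}) \<times> ({1..n} \<rightarrow>\<^sub>E {0..d}))"
    by (intro finite_cartesian_product finite_PiE finite_Phi_pos) auto
qed

definition wt_indicator :: "nat \<Rightarrow> (nat \<Rightarrow> nat) \<Rightarrow> nat list \<Rightarrow> qv" where
  "wt_indicator n \<mu> w = (if \<forall>i\<in>{1..n}. count_list w i = \<mu> i then 1 else 0)"

lemma wt_indicator_rev [simp]: "wt_indicator n \<mu> (rev w) = wt_indicator n \<mu> w"
  by (simp add: wt_indicator_def)

lemma wt_indicator_dom_word: "\<mu> \<in> Lambda n d \<Longrightarrow> \<nu> \<in> Lambda n d \<Longrightarrow> wt_indicator n \<mu> (dom_word n \<nu>) = (if \<mu> = \<nu> then 1 else 0)"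
proof -
  assume *: "\<mu> \<in> Lambda n d" "\<nu> \<in> Lambda n d"
  have "\<mu> = \<nu>" if "\<forall>i\<in>{1..n}. \<nu> i = \<mu> i"
    by (rule PiE_ext [of _ "{1..n}" "\<lambda>_. UNIV"]) (use * that in \<open>auto simp: Lambda_def\<close>)
  then show ?thesis
    by (auto simp: wt_indicator_def count_dom_word)
qed

context v_or_inverse
begin

text \<open>At a descending word the image of \<open>f\<close> is block symmetric, because the word
  itself is; so \<open>cf_rearrange\<close> reduces every coefficient to a site. Any other word is
  reached from a descending one by Hecke operators, with which \<open>f\<close> commutes.\<close>

lemma Hecke_upper_zero_sites:
  assumes f: "f \<in> Hecke_upper n d" and z: "\<And>A \<mu>. (A, \<mu>) \<in> Borel_index n d \<Longrightarrow> entry f (block_word n A \<mu>) (dom_word n \<mu>) = 0"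
    and w: "w \<in> words n d"
  shows "f (monomial w) = 0"
proof -
  have fc: "f \<in> carrier (End_tensor n d)"
    and fT: "\<And>k t. t \<in> tensor n d \<Longrightarrow> f (Hecke q k t) = Hecke q k (f t)"
    and up: "\<And>u w. u \<in> words n d \<Longrightarrow> w \<in> words n d \<Longrightarrow> entry f u w \<noteq> 0 \<Longrightarrow> list_all2 (\<le>) u w"
    using f by (auto simp: Hecke_upper_def)
  have fs: "f (cst c * t) = cst c * f t" if "t \<in> tensor n d" for c t
    using fc that by (simp add: End_carrier)
  have dom: "f (monomial (dom_word n \<mu>)) = 0" if \<mu>: "\<mu> \<in> Lambda n d" for \<mu>
  proof (rule free_eqI)
    fix u
    let ?w = "dom_word n \<mu>"
    have w: "?w \<in> words n d"
      by (rule dom_word_in_words [OF \<mu>])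
    have sym: "Hecke_symmetric q ?w (f (monomial ?w))"
      unfolding Hecke_symmetric_def
    proof (intro allI impI)
      fix k assume "Suc k < length ?w" "?w ! k = ?w ! Suc k"
      then have "f (Hecke q k (monomial ?w)) = cst (inverse q) * f (monomial ?w)"
        by (simp add: Hecke_equal fs [OF monomial_tensor [OF w]])
      then show "Hecke q k (f (monomial ?w)) = cst (inverse q) * f (monomial ?w)"
        by (simp add: fT [OF monomial_tensor [OF w]])
    qed
    show "cf (f (monomial ?w)) u = cf 0 u"
    proof (rule ccontr)
      assume "cf (f (monomial ?w)) u \<noteq> cf 0 u"
      then have nz: "entry f u ?w \<noteq> 0" by simp
      then have u: "u \<in> words n d"
        by (rule entry_outside [OF fc w])
      have le: "list_all2 (\<le>) u ?w"
        by (rule up [OF u w nz])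
      define A where "A = (\<lambda>p\<in>Phi_pos n. count (pair_mset ?w u) (snd p, fst p))"
      note A = matrix_of_word [OF \<mu> u le, folded A_def]
      note s = block_word [OF list_all2_lengthD [OF le] A(2)]
      obtain k where "entry f u ?w = q powi k * entry f (block_word n A \<mu>) ?w"
        using cf_rearrange [OF sorted_dom_word sym q_nz list_all2_lengthD [OF le] s(1)] s(2) A(2) by auto
      then show False
        using nz z [OF A(1)] by simp
    qed
  qed
  show ?thesis
    using w
  proof (induct "wsum w" arbitrary: w rule: less_induct)
    case less
    show ?case
    proof (cases "\<exists>k. Suc k < length w \<and> w ! k < w ! Suc k")
      case True
      then obtain k where k: "Suc k < length w" "w ! k < w ! Suc k" by blast
      have sw: "swap k w \<in> words n d"
        by (rule words_mset [OF less.prems mset_swap_adjacent [OF k(1)]])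
      \<comment> \<open>On the word with the descent, the Hecke operator is the plain exchange,
        without a second term.\<close>
      have "monomial w = Hecke q k (monomial (swap k w))"
        using k by (subst Hecke_desc) (auto simp: swap_swap, auto simp: swap_def)
      then have "f (monomial w) = Hecke q k (f (monomial (swap k w)))"
        using fT [OF monomial_tensor [OF sw]] by simp
      then show ?thesis
        using less.hyps [OF wsum_swap [OF k] sw] by (simp add: linD [OF lin_Hecke])
    next
      case False
      then have sorted: "sorted (rev w)"
        unfolding sorted_rev_iff_nth_Suc by (meson not_less)
      define \<mu> where "\<mu> = (\<lambda>i\<in>{1..n}. count_list w i)"
      have "(\<Sum>i=1..n. count_list w i) = length w"
        using less.prems sum_count_set [of w "{1..n}"] by (simp add: words_def)
      then have \<mu>: "\<mu> \<in> Lambda n d"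
        using less.prems by (simp add: Lambda_def \<mu>_def words_def)
      have "mset (dom_word n \<mu>) = mset w"
      proof (rule multiset_eqI)
        fix x
        show "count (mset (dom_word n \<mu>)) x = count (mset w) x"
          using less.prems by (auto simp: count_mset count_dom_word \<mu>_def words_def count_list_0_iff)
      qed
      moreover have "sorted (rev (dom_word n \<mu>))"
        by (simp add: dom_word_def)
      ultimately have "rev (dom_word n \<mu>) = rev w"
        using sorted by (metis mset_rev properties_for_sort)
      then show ?thesis
        using dom [OF \<mu>] by simp
    qed
  qed
qed

lemma Eop_sites:
  assumes \<beta>s: "distinct \<beta>s" "set \<beta>s = Phi_pos n" and A: "(A, \<mu>) \<in> Borel_index n d"
  shows "block_word n A \<mu> \<in> words n d" "pair_mset (dom_word n \<mu>) (block_word n A \<mu>) = matrix_mset n A \<mu>"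
    "Laurent_unit (cf (Eop q \<beta>s A (monomial (dom_word n \<mu>))) (block_word n A \<mu>))"
    "\<And>u. cf (Eop q \<beta>s A (monomial (dom_word n \<mu>))) u \<noteq> 0 \<Longrightarrow> pair_mset (dom_word n \<mu>) u = matrix_mset n A \<mu> \<or>
        stat (int n ^ 2 + 1) (pair_mset (dom_word n \<mu>) u) < stat (int n ^ 2 + 1) (matrix_mset n A \<mu>)"
proof -
  let ?w = "dom_word n \<mu>" and ?C = "int n ^ 2 + 1"
  have wt: "wt_le n (content n A) \<mu>" and \<mu>: "\<mu> \<in> Lambda n d"
    using A by (auto simp: Borel_index_def)
  have P: "matrix_mset n (\<lambda>\<alpha>. if \<alpha> \<in> set \<beta>s then A \<alpha> else 0) \<mu> = matrix_mset n A \<mu>"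
    by (rule matrix_mset_cong) (simp add: \<beta>s)
  obtain c where c: "Laurent_unit c" "leading q ?C ?w (Eop q \<beta>s A (monomial ?w)) (matrix_mset n A \<mu>) c"
    using leading_Eop [OF \<beta>s(1) _ wt] P \<beta>s(2) by auto
  then obtain b where b: "length b = length ?w" "pair_mset ?w b = matrix_mset n A \<mu>"
    by (auto simp: leading_def)
  note s = block_word [OF b]
  show "pair_mset ?w (block_word n A \<mu>) = matrix_mset n A \<mu>"
    by (rule s(2))
  obtain k where "cf (Eop q \<beta>s A (monomial ?w)) (block_word n A \<mu>) = c * q powi k"
    using c(2) s unfolding leading_def by blast
  then show unit: "Laurent_unit (cf (Eop q \<beta>s A (monomial ?w)) (block_word n A \<mu>))"
    using Laurent_unit_mult [OF c(1) q_powi_unit] by simp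
  show "pair_mset ?w u = matrix_mset n A \<mu> \<or> stat ?C (pair_mset ?w u) < stat ?C (matrix_mset n A \<mu>)"
    if "cf (Eop q \<beta>s A (monomial ?w)) u \<noteq> 0" for u
    using c(2) that unfolding leading_def by blast
  have "set (block_word n A \<mu>) \<subseteq> {1..n}"
  proof
    fix y assume "y \<in> set (block_word n A \<mu>)"
    then obtain p where "p < length (block_word n A \<mu>)" "y = block_word n A \<mu> ! p"
      by (auto simp: in_set_conv_nth)
    then have "(?w ! p, y) \<in># pair_mset ?w (block_word n A \<mu>)"
      using s(1) by (auto simp: set_zip)
    then have "count (matrix_mset n A \<mu>) (?w ! p, y) > 0"
      unfolding s(2) by simp
    then show "y \<in> {1..n}"
      by (auto simp: count_matrix_mset Phi_pos_def split: if_splits)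
  qed
  then show "block_word n A \<mu> \<in> words n d"
    using s(1) length_dom_word [OF \<mu>] by (simp add: words_def)
qed

text \<open>The indicator forces equal weights. Then \<open>block_word n B \<nu>\<close> has matrix
  \<open>B\<close>, which must be the top matrix \<open>A\<close> or have a smaller
  statistic.\<close>

lemma Eop_basis_facts:
  assumes \<beta>s: "distinct \<beta>s" "set \<beta>s = Phi_pos n"
    and A: "(A, \<mu>) \<in> Borel_index n d" and B: "(B, \<nu>) \<in> Borel_index n d"
    and nz: "wt_indicator n \<mu> (dom_word n \<nu>) * cf (Eop q \<beta>s A (monomial (dom_word n \<nu>))) (block_word n B \<nu>) \<noteq> 0"
  shows "(B, \<nu>) = (A, \<mu>) \<or> stat (int n ^ 2 + 1) (matrix_mset n B \<nu>) < stat (int n ^ 2 + 1) (matrix_mset n A \<mu>)"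
proof -
  have "\<mu> = \<nu>"
    using nz A B wt_indicator_dom_word [of \<mu> n d \<nu>] by (auto simp: Borel_index_def split: if_splits)
  have "matrix_mset n B \<nu> = matrix_mset n A \<mu> \<or> stat (int n ^ 2 + 1) (matrix_mset n B \<nu>) < stat (int n ^ 2 + 1) (matrix_mset n A \<mu>)"
    using Eop_sites(4) [OF \<beta>s A, of "block_word n B \<nu>"] Eop_sites(2) [OF \<beta>s B] nz \<open>\<mu> = \<nu>\<close> by auto
  moreover have "B = A" if "matrix_mset n B \<nu> = matrix_mset n A \<mu>"
    using matrix_mset_inj [of B n A \<mu>] A B that \<open>\<mu> = \<nu>\<close> by (auto simp: Borel_index_def)
  ultimately show ?thesis
    using \<open>\<mu> = \<nu>\<close> by auto
qed

end

section \<open>The action of the generators\<close>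

lemma opK_dg: "opK i t = dg (\<lambda>c. if c = i then v else 1) t"
  and opKinv_dg: "opKinv i t = dg (\<lambda>c. if c = i then inverse v else 1) t"
  by (rule lin_eqI [where t = t]; auto intro!: lins lin_dg simp: dg_one opK_gen opKinv_gen dg_gen)+

lemma opE_Rop: "opE i t = Rop v i (Suc i) t"
proof (rule lin_eqI [where t = t])
  have "kap v i (Suc i) c = (if c = i then v else 1) * (if c = Suc i then inverse v else 1)" for c
    by (simp add: kap_def)
  then show "opE i (gen a * t) = Rop v i (Suc i) (gen a * t)" if "opE i t = Rop v i (Suc i) t" for a t
    using that by (simp add: opE_gen E_gen opK_dg opKinv_dg dg_dg kap_def [abs_def] cong: if_cong)
qed (simp_all add: lin_op lin_Rop Rop_one)

lemma full_act_power: "full_act (x ^ m) t = (full_act x ^^ m) t"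
  by (induct m arbitrary: t) (simp_all add: full_act_one full_act_mult)

text \<open>The defining recursion of the root vectors is \<open>Rop_step\<close> divided by
  v^(j-i-1).\<close>

lemma full_act_Xpos: "i < j \<Longrightarrow> full_act (Xpos i j) t = cst (inverse v ^ (j - i - 1)) * Rop v i j t"
proof (induct i j arbitrary: t rule: Xpos.induct)
  case (1 i j)
  show ?case
  proof (cases "j \<le> i + 1")
    case True
    then have "j = Suc i" using "1.prems" by simp
    then show ?thesis
      by (simp add: Xpos.simps full_act_gen opE_Rop)
  next
    case False
    then have j: "j - i - 1 = Suc (j - (i + 1) - 1)" by simp
    have IH: "full_act (Xpos (Suc i) j) t = cst (inverse v ^ (j - (i + 1) - 1)) * Rop v (Suc i) j t" for t
      using "1.hyps" [OF False] False by simp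
    have "full_act (Xpos i j) t = cst (inverse v * inverse v ^ (j - (i + 1) - 1)) * Rop v i (Suc i) (Rop v (Suc i) j t)
        - cst (inverse v ^ (j - (i + 1) - 1)) * Rop v (Suc i) j (Rop v i (Suc i) t)"
      using False by (subst Xpos.simps) (simp add: full_act_left full_act_mult full_act_gen full_act_cst opE_Rop IH linD [OF lin_Rop] cst_cst)
    also have "cst (inverse v ^ (j - (i + 1) - 1)) * Rop v (Suc i) j (Rop v i (Suc i) t)
        = cst (inverse v * inverse v ^ (j - (i + 1) - 1)) * (cst v * Rop v (Suc i) j (Rop v i (Suc i) t))"
    proof -
      have "inverse v * x * v = x" for x
        by (simp add: field_simps)
      then show ?thesis by (simp only: cst_cst)
    qed
    finally show ?thesis
      unfolding j using False by (simp only: right_diff_distrib [symmetric] Rop_step [OF v_nz, of i j] power_Suc)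
  qed
qed

lemma funpow_cst: "lin F \<Longrightarrow> ((\<lambda>t. cst c * F t) ^^ m) t = cst (c ^ m) * (F ^^ m) t" for F :: "nat free \<Rightarrow> nat free"
  by (induct m) (simp_all add: linD cst_cst)

lemma full_act_Xpos_div: "i < j \<Longrightarrow> full_act (Xpos_div (i, j) m) t = Xop v i j m t"
proof -
  assume "i < j"
  then have "full_act (Xpos i j) = (\<lambda>t. cst (inverse v ^ (j - i - 1)) * Rop v i j t)"
    by (simp add: fun_eq_iff full_act_Xpos)
  then show ?thesis
    by (simp add: Xpos_div_def Xop_def full_act_left full_act_power funpow_cst lin_Rop cst_cst flip: power_mult)
qed

lemma full_act_E_mon: "set \<beta>s \<subseteq> Phi_pos n \<Longrightarrow> full_act (E_mon \<beta>s A) t = Eop v \<beta>s A t"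
  by (induct \<beta>s) (auto simp: E_mon_def Eop_simps full_act_one full_act_mult full_act_Xpos_div Phi_pos_def split_paired_all)

lemma dg_count: "dg (\<lambda>c. if c = i then a else 1) (monomial w) = cst (a ^ count_list w i) * monomial w"
proof -
  have "prod_list (map (\<lambda>c. if c = i then a else 1) w) = a ^ count_list w i"
    by (induct w) auto
  then show ?thesis by (simp add: dg_monomial)
qed

lemma full_act_K: "full_act (UK i) (monomial w) = cst (v ^ count_list w i) * monomial w"
  "full_act (UKinv i) (monomial w) = cst (inverse v ^ count_list w i) * monomial w"
  by (simp_all add: full_act_gen opK_dg opKinv_dg dg_count)

lemma full_act_prod_list:
  assumes "\<And>x. x \<in> set xs \<Longrightarrow> full_act (X x) t = cst (c x) * t"
  shows "full_act (prod_list (map X xs)) t = cst (prod_list (map c xs)) * t"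
  using assms
  by (induct xs) (simp_all add: full_act_one full_act_mult linD [OF lin_full_act] cst_cst mult.commute)

lemma prod_list_upt: "prod_list (map f [1..<t+1]) = (\<Prod>s\<in>{1..t}. f s)" for f :: "nat \<Rightarrow> qv"
  by (induct t) simp_all

lemma full_act_Kbinom: "full_act (Kbinom i t) (monomial w) = cst (qbinom (count_list w i) t) * monomial w"
proof -
  let ?c = "count_list w i"
  have "full_act (Kbinom i t) (monomial w) = cst (prod_list (map (\<lambda>s.
      (v powi (int ?c - int s + 1) - v powi (int s - 1 - int ?c)) / (v ^ s - inverse v ^ s)) [1..<t+1])) * monomial w"
    unfolding Kbinom_def
  proof (rule full_act_prod_list)
    fix s
    have 1: "v powi (1 - int s) * v ^ ?c = v powi (int ?c - int s + 1)"
      by (simp flip: power_int_of_nat power_int_add) (simp add: algebra_simps)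
    have 2: "v powi (int s - 1) * inverse v ^ ?c = v powi (int s - 1 - int ?c)"
      by (simp add: power_int_diff power_inverse divide_inverse)
    show "full_act (cst (1 / (v ^ s - inverse v ^ s)) * (cst (v powi (1 - int s)) * UK i - cst (v powi (int s - 1)) * UKinv i)) (monomial w)
      = cst ((v powi (int ?c - int s + 1) - v powi (int s - 1 - int ?c)) / (v ^ s - inverse v ^ s)) * monomial w"
      by (simp only: full_act_left full_act_K cst_cst 1 2 left_diff_distrib [symmetric] cst_diff [symmetric] times_divide_eq_left mult_1)
  qed
  also have "prod_list (map f [1..<t+1]) = (\<Prod>s\<in>{1..t}. f s)" for f :: "nat \<Rightarrow> qv"
    by (rule prod_list_upt)
  finally show ?thesis
    by (simp add: qbinom_def)
qed

lemma full_act_one_wt: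
  assumes "\<mu> \<in> Lambda n d" "w \<in> words n d"
  shows "full_act (one_wt n \<mu>) (monomial w) = cst (wt_indicator n \<mu> w) * monomial w"
proof -
  have "full_act (one_wt n \<mu>) (monomial w) = cst (prod_list (map (\<lambda>i. qbinom (count_list w i) (\<mu> i)) [1..<n+1])) * monomial w"
    unfolding one_wt_def by (rule full_act_prod_list) (rule full_act_Kbinom)
  also have "prod_list (map (\<lambda>i. qbinom (count_list w i) (\<mu> i)) [1..<n+1]) = (\<Prod>i\<in>{1..n}. qbinom (count_list w i) (\<mu> i))"
    by (rule prod_list_upt)
  also have "\<dots> = wt_indicator n \<mu> w"
  proof (cases "\<forall>i\<in>{1..n}. count_list w i = \<mu> i")
    case True
    then show ?thesis by (simp add: wt_indicator_def qbinom_self)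
  next
    case False
    \<comment> \<open>Both weights have sum \<open>d\<close>, so a different weight is somewhere
      strictly smaller, and there the binomial vanishes by \<open>qbinom_less\<close>.\<close>
    have "\<exists>i\<in>{1..n}. count_list w i < \<mu> i"
    proof (rule ccontr)
      assume "\<not> ?thesis"
      then have le: "\<And>i. i \<in> {1..n} \<Longrightarrow> \<mu> i \<le> count_list w i"
        by (auto simp: not_less)
      have "(\<Sum>i=1..n. count_list w i) = (\<Sum>i=1..n. \<mu> i)"
        using assms sum_count_set [of w "{1..n}"] by (simp add: words_def Lambda_def)
      then have "\<forall>i\<in>{1..n}. count_list w i = \<mu> i"
        using sum_mono_inv [of \<mu> "{1..n}" "count_list w"] le by auto
      then show False using False by blast
    qed
    then have "(\<Prod>i\<in>{1..n}. qbinom (count_list w i) (\<mu> i)) = 0"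
      by (meson finite_atLeastAtMost prod_zero qbinom_less)
    moreover have "wt_indicator n \<mu> w = 0"
      unfolding wt_indicator_def by (rule if_not_P [OF False])
    ultimately show ?thesis by simp
  qed
  finally show ?thesis .
qed

lemma cf_one_wt:
  assumes "\<mu> \<in> Lambda n d" "t \<in> tensor n d"
  shows "cf (full_act (one_wt n \<mu>) t) u = wt_indicator n \<mu> u * cf t u"
proof -
  have "cf (full_act (one_wt n \<mu>) t) u = (\<Sum>w\<in>words n d. cf t w * cf (cst (wt_indicator n \<mu> w) * monomial w) u)"
    unfolding cf_lin_words [OF lin_full_act assms(2)] by (rule sum.cong) (simp_all add: full_act_one_wt [OF assms(1)])
  also have "\<dots> = (\<Sum>w\<in>words n d. if w = u then wt_indicator n \<mu> u * cf t u else 0)"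
    by (rule sum.cong) (auto simp: cf_simps cf_monomial)
  also have "\<dots> = wt_indicator n \<mu> u * cf t u"
    using assms(2) finite_words [of n d] by (auto simp: tensor_iff)
  finally show ?thesis .
qed

section \<open>Carriers and generated subalgebras\<close>

lemma Xpos_carrier: "(i, j) \<in> Phi_pos n \<Longrightarrow> Xpos i j \<in> carrier (Ufree n)"
proof (induct i j rule: Xpos.induct)
  case (1 i j)
  have "UE i \<in> carrier (Ufree n)"
    using "1.prems" by (intro Ufree_closed) (auto simp: ugens_def Phi_pos_def)
  then show ?case
    using 1 by (subst Xpos.simps) (auto intro!: Ufree_closed simp: Phi_pos_def)
qed

lemma Xneg_carrier: "(i, j) \<in> Phi_pos n \<Longrightarrow> Xneg i j \<in> carrier (Ufree n)"
proof (induct i j rule: Xneg.induct)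
  case (1 i j)
  have "UF i \<in> carrier (Ufree n)"
    using "1.prems" by (intro Ufree_closed) (auto simp: ugens_def Phi_pos_def)
  then show ?case
    using 1 by (subst Xneg.simps) (auto intro!: Ufree_closed simp: Phi_pos_def)
qed

lemma power_carrier: "x \<in> carrier (Ufree n) \<Longrightarrow> x ^ m \<in> carrier (Ufree n)"
  by (induct m) (auto intro: Ufree_closed)

lemma prod_list_carrier: "(\<And>x. x \<in> set xs \<Longrightarrow> x \<in> carrier (Ufree n)) \<Longrightarrow> prod_list xs \<in> carrier (Ufree n)"
  by (induct xs) (auto intro: Ufree_closed)

lemma Xpos_div_carrier: "\<alpha> \<in> Phi_pos n \<Longrightarrow> Xpos_div \<alpha> m \<in> carrier (Ufree n)"
  and Xneg_div_carrier: "\<alpha> \<in> Phi_pos n \<Longrightarrow> Xneg_div \<alpha> m \<in> carrier (Ufree n)"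
  unfolding Xpos_div_def Xneg_div_def
  by (cases \<alpha>, auto intro!: Ufree_closed power_carrier Xpos_carrier Xneg_carrier)+

lemma UK_carrier: "i \<in> {1..n} \<Longrightarrow> UK i \<in> carrier (Ufree n)" "i \<in> {1..n} \<Longrightarrow> UKinv i \<in> carrier (Ufree n)"
  by (auto intro!: Ufree_closed simp: ugens_def)

lemma Kbinom_carrier: "i \<in> {1..n} \<Longrightarrow> Kbinom i t \<in> carrier (Ufree n)"
  unfolding Kbinom_def by (rule prod_list_carrier) (auto intro!: Ufree_closed UK_carrier)

lemma one_wt_carrier: "one_wt n \<mu> \<in> carrier (Ufree n)"
  unfolding one_wt_def by (rule prod_list_carrier) (auto intro!: Kbinom_carrier)

lemma mon_carrier:
  assumes "set \<beta>s \<subseteq> Phi_pos n"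
  shows "E_mon \<beta>s A \<in> carrier (Ufree n)" "F_mon \<beta>s A \<in> carrier (Ufree n)"
  unfolding E_mon_def F_mon_def
  using assms by (auto intro!: prod_list_carrier Xpos_div_carrier Xneg_div_carrier)

lemma free_act_End: "x \<in> carrier (Ufree n) \<Longrightarrow> free_act n d x \<in> carrier (End_tensor n d)"
  by (rule ring_hom_closed [OF free_act_hom])

lemma free_act_mult:
  "x \<in> carrier (Ufree n) \<Longrightarrow> y \<in> carrier (Ufree n) \<Longrightarrow> free_act n d (x * y) = free_act n d x \<otimes>\<^bsub>End_tensor n d\<^esub> free_act n d y"
  using ring_hom_mult [OF free_act_hom, of x n y d] by (simp add: Ufree_def)

lemma free_act_one: "free_act n d 1 = \<one>\<^bsub>End_tensor n d\<^esub>"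
  using ring_hom_one [OF free_act_hom, of n d] by (simp add: Ufree_def)

lemma entry_free_act: "w \<in> words n d \<Longrightarrow> entry (free_act n d x) u w = cf (full_act x (monomial w)) u"
  by (simp add: free_act_full_act monomial_tensor)

lemma Schur_subalgebra: "A_subalgebra (End_tensor n d) (Schur n d)"
  unfolding A_subalgebra_def
proof (intro conjI ballI)
  show "Schur n d \<subseteq> carrier (End_tensor n d)"
    by (auto simp: Schur_eq free_act_End)
  show "\<one>\<^bsub>End_tensor n d\<^esub> \<in> Schur n d"
    unfolding Schur_eq free_act_one [symmetric] by (intro imageI Ufree_closed)
  fix f assume "f \<in> Schur n d"
  then obtain x where x: "x \<in> carrier (Ufree n)" "f = free_act n d x"
    by (auto simp: Schur_eq)
  {
    fix g assume "g \<in> Schur n d"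
    then obtain y where y: "y \<in> carrier (Ufree n)" "g = free_act n d y"
      by (auto simp: Schur_eq)
    have "f \<oplus>\<^bsub>End_tensor n d\<^esub> g = free_act n d (x + y)"
      unfolding x(2) y(2) using ring_hom_add [OF free_act_hom x(1) y(1), of d] by (simp add: Ufree_def)
    then show "f \<oplus>\<^bsub>End_tensor n d\<^esub> g \<in> Schur n d"
      unfolding Schur_eq using x(1) y(1) by (auto intro: Ufree_closed)
    show "f \<otimes>\<^bsub>End_tensor n d\<^esub> g \<in> Schur n d"
      unfolding x(2) y(2) free_act_mult [OF x(1) y(1), symmetric] Schur_eq
      using x(1) y(1) by (auto intro: Ufree_closed)
  }
  fix c
  have "c \<odot>\<^bsub>End_tensor n d\<^esub> f = free_act n d (cst c * x)"
    by (auto simp: End_smult x(2) free_act_full_act full_act_left fun_eq_iff)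
  then show "c \<odot>\<^bsub>End_tensor n d\<^esub> f \<in> Schur n d"
    unfolding Schur_eq using x(1) by (auto intro: Ufree_closed)
qed

text \<open>The generated algebra is an intersection of subalgebras of \<open>Schur n d\<close>, so
  \<open>B\<close> is first cut down to that algebra.\<close>

lemma Schur_generated_least:
  assumes "A_subalgebra (End_tensor n d) B" "G \<subseteq> B" "G \<subseteq> Schur n d"
  shows "Schur_A_generated n d G \<subseteq> B"
proof -
  have "A_subalgebra (End_tensor n d) (B \<inter> Schur n d)"
    using assms(1) Schur_subalgebra [of n d] unfolding A_subalgebra_def by blast
  then show ?thesis
    unfolding Schur_A_generated_def using assms(2,3) by blast
qed

lemma Schur_generated_closed:
  "G \<subseteq> Schur_A_generated n d G"
  "\<one>\<^bsub>End_tensor n d\<^esub> \<in> Schur_A_generated n d G"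
  "f \<in> Schur_A_generated n d G \<Longrightarrow> g \<in> Schur_A_generated n d G \<Longrightarrow> f \<otimes>\<^bsub>End_tensor n d\<^esub> g \<in> Schur_A_generated n d G"
  unfolding Schur_A_generated_def by (auto simp: A_subalgebra_def)

lemma generated_prod_list:
  assumes "\<And>x. x \<in> set xs \<Longrightarrow> x \<in> carrier (Ufree n) \<and> free_act n d x \<in> Schur_A_generated n d G"
  shows "free_act n d (prod_list xs) \<in> Schur_A_generated n d G"
  using assms
  by (induct xs) (auto simp: free_act_one free_act_mult prod_list_carrier intro: Schur_generated_closed)

lemma Xpos_div_SA_plus: "\<alpha> \<in> Phi_pos n \<Longrightarrow> free_act n d (Xpos_div \<alpha> m) \<in> SA_plus n d"
  unfolding SA_plus_def Simg_eq [OF Xpos_div_carrier, symmetric]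
  by (rule subsetD [OF Schur_generated_closed(1)]) blast

lemma E_mon_SA_plus: "set \<beta>s \<subseteq> Phi_pos n \<Longrightarrow> free_act n d (E_mon \<beta>s A) \<in> SA_plus n d"
  unfolding E_mon_def SA_plus_def
  by (rule generated_prod_list, fold SA_plus_def) (auto simp: Xpos_div_carrier intro!: Xpos_div_SA_plus)

lemma Xneg_div_SA_minus: "\<alpha> \<in> Phi_pos n \<Longrightarrow> free_act n d (Xneg_div \<alpha> m) \<in> SA_minus n d"
  unfolding SA_minus_def Simg_eq [OF Xneg_div_carrier, symmetric]
  by (rule subsetD [OF Schur_generated_closed(1)]) blast

lemma F_mon_SA_minus: "set \<beta>s \<subseteq> Phi_pos n \<Longrightarrow> free_act n d (F_mon \<beta>s A) \<in> SA_minus n d"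
  unfolding F_mon_def SA_minus_def
  by (rule generated_prod_list, fold SA_minus_def) (auto simp: Xneg_div_carrier intro!: Xneg_div_SA_minus)

lemma Kbinom_SA_zero: "i \<in> {1..n} \<Longrightarrow> free_act n d (Kbinom i t) \<in> SA_zero n d"
  unfolding SA_zero_def Simg_eq [OF Kbinom_carrier, symmetric]
  by (rule subsetD [OF Schur_generated_closed(1)]) blast

lemma one_wt_SA_zero: "free_act n d (one_wt n \<mu>) \<in> SA_zero n d"
  unfolding one_wt_def SA_zero_def
  by (rule generated_prod_list, fold SA_zero_def) (auto simp: Kbinom_carrier intro!: Kbinom_SA_zero)

lemma free_act_Schur: "x \<in> carrier (Ufree n) \<Longrightarrow> free_act n d x \<in> Schur n d"
  by (simp add: Schur_eq)

lemma SA_plus_least: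
  assumes "A_subalgebra (End_tensor n d) B" "\<And>\<alpha> m. \<alpha> \<in> Phi_pos n \<Longrightarrow> free_act n d (Xpos_div \<alpha> m) \<in> B"
  shows "SA_plus n d \<subseteq> B"
  unfolding SA_plus_def
  by (rule Schur_generated_least) (auto simp: assms Simg_eq Xpos_div_carrier free_act_Schur)

lemma SA_minus_least:
  assumes "A_subalgebra (End_tensor n d) B" "\<And>\<alpha> m. \<alpha> \<in> Phi_pos n \<Longrightarrow> free_act n d (Xneg_div \<alpha> m) \<in> B"
  shows "SA_minus n d \<subseteq> B"
  unfolding SA_minus_def
  by (rule Schur_generated_least) (auto simp: assms Simg_eq Xneg_div_carrier free_act_Schur)

text \<open>All generators of \<open>\<^bold>S\<^sup>0\<close> are diagonal, with entries depending only on the weight.\<close>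

lemma SA_zero_least:
  assumes "A_subalgebra (End_tensor n d) B"
    "\<And>x h. x \<in> carrier (Ufree n) \<Longrightarrow> (\<And>w. w \<in> words n d \<Longrightarrow> full_act x (monomial w) = cst (h (mset w)) * monomial w) \<Longrightarrow>
       (\<And>w. w \<in> words n d \<Longrightarrow> h (mset w) \<in> Laurent) \<Longrightarrow> free_act n d x \<in> B"
  shows "SA_zero n d \<subseteq> B"
proof -
  have "free_act n d (UK i) \<in> B" if "i \<in> {1..n}" for i
    by (rule assms(2) [of _ "\<lambda>M. v ^ count M i"]) (use that in \<open>auto simp: UK_carrier full_act_K count_mset intro!: Laurent_intros\<close>)
  moreover have "free_act n d (UKinv i) \<in> B" if "i \<in> {1..n}" for i
    by (rule assms(2) [of _ "\<lambda>M. inverse v ^ count M i"]) (use that in \<open>auto simp: UK_carrier full_act_K count_mset intro!: Laurent_power Laurent_v\<close>)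
  moreover have "free_act n d (Kbinom i t) \<in> B" if "i \<in> {1..n}" for i t
    by (rule assms(2) [of _ "\<lambda>M. qbinom (count M i) t"]) (use that in \<open>auto simp: Kbinom_carrier full_act_Kbinom count_mset qbinom_Laurent\<close>)
  ultimately show ?thesis
    unfolding SA_zero_def
    by (intro Schur_generated_least assms(1)) (auto simp: Simg_eq UK_carrier Kbinom_carrier free_act_Schur)
qed

section \<open>The upper Borel algebra\<close>

lemma A_subalgebra_submodule: "A_subalgebra (End_tensor n d) N \<Longrightarrow> A_submodule n d N"
proof -
  assume N: "A_subalgebra (End_tensor n d) N"
  then have "0 \<odot>\<^bsub>End_tensor n d\<^esub> \<one>\<^bsub>End_tensor n d\<^esub> \<in> N"
    using Laurent_0 by (auto simp: A_subalgebra_def)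
  moreover have "0 \<odot>\<^bsub>End_tensor n d\<^esub> \<one>\<^bsub>End_tensor n d\<^esub> = \<zero>\<^bsub>End_tensor n d\<^esub>"
    by (simp add: End_smult End_ops cong: restrict_cong)
  ultimately show ?thesis
    using N by (simp add: A_subalgebra_def A_submodule_def)
qed

lemma Rop_power_weight: "i < j \<Longrightarrow> cf ((Rop q i j ^^ m) t) u \<noteq> 0 \<Longrightarrow>
    \<exists>w. cf t w \<noteq> 0 \<and> mset u + replicate_mset m j = mset w + replicate_mset m i"
proof (induct m arbitrary: u)
  case (Suc m)
  from Suc.prems(2) have "cf (Rop q i j ((Rop q i j ^^ m) t)) u \<noteq> 0" by simp
  then obtain x where x: "cf ((Rop q i j ^^ m) t) x \<noteq> 0" "cf (Rop q i j (monomial x)) u \<noteq> 0"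
    by (rule cf_lin_nz [OF lin_Rop])
  obtain w where w: "cf t w \<noteq> 0" "mset x + replicate_mset m j = mset w + replicate_mset m i"
    using Suc.hyps [OF Suc.prems(1) x(1)] by blast
  have "mset u + replicate_mset (Suc m) j = (mset u + {#j#}) + replicate_mset m j"
    by simp
  also have "\<dots> = (mset x + replicate_mset m j) + {#i#}"
    unfolding Rop_support(3) [OF Suc.prems(1) x(2)] by simp
  finally show ?case
    using w by auto
qed auto

text \<open>The weight shift is the same for all inputs: the multisets \<open>I\<close> and
  \<open>J\<close> are chosen before \<open>t\<close> and \<open>u\<close>. Adding on both sides
  avoids multiset subtraction.\<close>

lemma Eop_weight:
  assumes "set \<beta>s \<subseteq> Phi_pos n"
  shows "\<exists>I J. \<forall>t u. cf (Eop q \<beta>s A t) u \<noteq> 0 \<longrightarrow> (\<exists>w. cf t w \<noteq> 0 \<and> mset u + J = mset w + I)"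
  using assms
proof (induct \<beta>s)
  case Nil
  show ?case
    by (intro exI [of _ "{#}"]) (auto simp: Eop_simps)
next
  case (Cons \<alpha> \<beta>s)
  obtain i j where ij: "\<alpha> = (i, j)" "i < j"
    using Cons.prems by (cases \<alpha>) (auto simp: Phi_pos_def)
  obtain I J where IJ: "\<And>t u. cf (Eop q \<beta>s A t) u \<noteq> 0 \<Longrightarrow> \<exists>w. cf t w \<noteq> 0 \<and> mset u + J = mset w + I"
    using Cons by auto
  have "\<exists>w. cf t w \<noteq> 0 \<and> mset u + (replicate_mset (A \<alpha>) j + J) = mset w + (replicate_mset (A \<alpha>) i + I)"
    if "cf (Eop q (\<alpha> # \<beta>s) A t) u \<noteq> 0" for t u
  proof -
    have "cf ((Rop q i j ^^ A \<alpha>) (Eop q \<beta>s A t)) u \<noteq> 0"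
      using that by (simp add: Eop_simps Xop_def ij cf_simps)
    then obtain x where x: "cf (Eop q \<beta>s A t) x \<noteq> 0" "mset u + replicate_mset (A \<alpha>) j = mset x + replicate_mset (A \<alpha>) i"
      using Rop_power_weight [OF ij(2)] by blast
    obtain w where w: "cf t w \<noteq> 0" "mset x + J = mset w + I"
      using IJ [OF x(1)] by blast
    have "mset u + (replicate_mset (A \<alpha>) j + J) = (mset x + J) + replicate_mset (A \<alpha>) i"
      using x(2) by (simp flip: add.assoc)
    then show ?thesis
      using w by (auto simp: ac_simps)
  qed
  then show ?case by blast
qed

lemma wt_indicator_mset:
  assumes "w \<in> words n d" "u \<in> words n d" "\<And>i. i \<in> {1..n} \<Longrightarrow> \<mu> i = count_list u i"
  shows "wt_indicator n \<mu> w = (if mset w = mset u then 1 else 0)"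
proof -
  have "mset w = mset u" if "\<forall>i\<in>{1..n}. count_list w i = count_list u i"
  proof (rule multiset_eqI)
    fix i
    show "count (mset w) i = count (mset u) i"
    proof (cases "i \<in> {1..n}")
      case False
      then have "i \<notin> set w" "i \<notin> set u"
        using assms(1,2) by (auto simp: words_def)
      then show ?thesis
        by (metis count_eq_zero_iff set_mset_mset)
    qed (use that in \<open>simp add: count_mset\<close>)
  qed
  then show ?thesis
    using assms(3) by (auto simp: wt_indicator_def count_mset [symmetric])
qed

interpretation E_side: v_or_inverse v
  by standard simp

interpretation F_side: v_or_inverse "inverse v"
  by standard simp

lemma Eop_tensor: "set \<beta>s \<subseteq> Phi_pos n \<Longrightarrow> t \<in> tensor n d \<Longrightarrow> Eop v \<beta>s A t \<in> tensor n d"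
  by (induct \<beta>s) (auto simp: Eop_simps intro!: E_side.Xop_tensor)

lemma entry_E_one_wt:
  assumes "set \<beta>s \<subseteq> Phi_pos n" "\<mu> \<in> Lambda n d" "w \<in> words n d"
  shows "entry (free_act n d (E_mon \<beta>s A * one_wt n \<mu>)) u w = wt_indicator n \<mu> w * cf (Eop v \<beta>s A (monomial w)) u"
  using assms by (simp add: entry_free_act full_act_mult full_act_one_wt full_act_E_mon linD [OF E_side.lin_Eop] cf_simps)

text \<open>\<open>Borel_ge\<close> has S^0 on the left while the idempotent stands on the right. As
  E_A shifts weights by a fixed amount, E_A 1_\<mu> = 1_\<nu> E_A, where \<nu> is the weight of the
  site word, at which E_A has a nonzero coefficient.\<close>

lemma E_one_wt_in_product:
  assumes \<beta>s: "distinct \<beta>s" "set \<beta>s = Phi_pos n" and A: "(A, \<mu>) \<in> Borel_index n d"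
  shows "free_act n d (E_mon \<beta>s A * one_wt n \<mu>) \<in>
    {x \<otimes>\<^bsub>End_tensor n d\<^esub> y | x y. x \<in> SA_zero n d \<and> y \<in> SA_plus n d}"
proof -
  let ?w = "dom_word n \<mu>" and ?u = "block_word n A \<mu>"
  have \<mu>: "\<mu> \<in> Lambda n d"
    using A by (simp add: Borel_index_def)
  have w: "?w \<in> words n d"
    by (rule dom_word_in_words [OF \<mu>])
  note s = E_side.Eop_sites [OF \<beta>s A]
  have nz: "cf (Eop v \<beta>s A (monomial ?w)) ?u \<noteq> 0"
    using s(3) by (simp add: Laurent_unit_def)
  define \<nu> where "\<nu> = (\<lambda>i\<in>{1..n}. count_list ?u i)"
  have "(\<Sum>i=1..n. count_list ?u i) = d"
    using s(1) sum_count_set [of ?u "{1..n}"] by (simp add: words_def)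
  then have \<nu>: "\<nu> \<in> Lambda n d"
    by (simp add: Lambda_def \<nu>_def)
  obtain I J where IJ: "\<And>t u. cf (Eop v \<beta>s A t) u \<noteq> 0 \<Longrightarrow> \<exists>w. cf t w \<noteq> 0 \<and> mset u + J = mset w + I"
    using Eop_weight [of \<beta>s n v A] \<beta>s(2) by auto
  have IJ': "mset u + J = mset w + I" if "cf (Eop v \<beta>s A (monomial w)) u \<noteq> 0" for u w
    using IJ [OF that] by (auto simp: cf_monomial split: if_splits)
  note c = mon_carrier(1) [of \<beta>s n A] one_wt_carrier
  have "free_act n d (E_mon \<beta>s A * one_wt n \<mu>) = free_act n d (one_wt n \<nu> * E_mon \<beta>s A)"
  proof (rule entry_eqI)
    show "free_act n d (E_mon \<beta>s A * one_wt n \<mu>) \<in> carrier (End_tensor n d)"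
      "free_act n d (one_wt n \<nu> * E_mon \<beta>s A) \<in> carrier (End_tensor n d)"
      using c \<beta>s(2) by (auto intro!: free_act_End Ufree_closed)
    fix u x assume u: "u \<in> words n d" and x: "x \<in> words n d"
    have "entry (free_act n d (one_wt n \<nu> * E_mon \<beta>s A)) u x = wt_indicator n \<nu> u * cf (Eop v \<beta>s A (monomial x)) u"
      using \<beta>s(2) x by (simp add: entry_free_act full_act_mult full_act_E_mon [of \<beta>s n] cf_one_wt [OF \<nu>] Eop_tensor monomial_tensor)
    moreover have "wt_indicator n \<nu> u = wt_indicator n \<mu> x" if "cf (Eop v \<beta>s A (monomial x)) u \<noteq> 0"
    proof -
      have "wt_indicator n \<nu> u = (if mset u = mset ?u then 1 else 0)"
        by (rule wt_indicator_mset [OF u s(1)]) (simp add: \<nu>_def)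
      moreover have "wt_indicator n \<mu> x = (if mset x = mset ?w then 1 else 0)"
        by (rule wt_indicator_mset [OF x w]) (simp add: count_dom_word)
      moreover have "mset u = mset ?u \<longleftrightarrow> mset x = mset ?w"
        using IJ' [OF that] IJ' [OF nz] by (metis add_right_cancel)
      ultimately show ?thesis by simp
    qed
    ultimately show "entry (free_act n d (E_mon \<beta>s A * one_wt n \<mu>)) u x = entry (free_act n d (one_wt n \<nu> * E_mon \<beta>s A)) u x"
      using \<beta>s(2) by (cases "cf (Eop v \<beta>s A (monomial x)) u = 0") (simp_all add: entry_E_one_wt [OF _ \<mu> x])
  qed
  also have "\<dots> = free_act n d (one_wt n \<nu>) \<otimes>\<^bsub>End_tensor n d\<^esub> free_act n d (E_mon \<beta>s A)"
    using c \<beta>s(2) by (intro free_act_mult) auto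
  finally show ?thesis
    using one_wt_SA_zero E_mon_SA_plus [of \<beta>s n d A] \<beta>s(2) by blast
qed

lemma SA_zero_Hecke_upper: "SA_zero n d \<subseteq> E_side.Hecke_upper n d"
  by (rule SA_zero_least [OF E_side.Hecke_upper_subalgebra]) (auto simp: free_act_full_act intro!: E_side.Hecke_upper_diag lin_full_act)

lemma SA_plus_Hecke_upper: "SA_plus n d \<subseteq> E_side.Hecke_upper n d"
proof (rule SA_plus_least [OF E_side.Hecke_upper_subalgebra])
  fix \<alpha> m assume "\<alpha> \<in> Phi_pos n"
  moreover obtain i j where "\<alpha> = (i, j)" by (cases \<alpha>)
  ultimately have ij: "(i, j) \<in> Phi_pos n" "i < j" "\<alpha> = (i, j)"
    by (auto simp: Phi_pos_def)
  then have "free_act n d (Xpos_div \<alpha> m) = restrict (Xop v i j m) (tensor n d)"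
    by (simp add: free_act_full_act full_act_Xpos_div cong: restrict_cong)
  then show "free_act n d (Xpos_div \<alpha> m) \<in> E_side.Hecke_upper n d"
    using E_side.Hecke_upper_Xop [OF ij(1)] by simp
qed

theorem Borel_ge_basis:
  assumes \<beta>s: "distinct \<beta>s" "set \<beta>s = Phi_pos n"
  shows "A_basis (End_tensor n d) (Borel_index n d)
           (\<lambda>(A, \<mu>). free_act n d (E_mon \<beta>s A * one_wt n \<mu>)) (Borel_ge n d)"
  unfolding Borel_ge_def
proof (rule A_basis_triangular [where N = "E_side.Hecke_upper n d" and x = "\<lambda>(A, \<mu>). block_word n A \<mu>" and y = "\<lambda>(A, \<mu>). dom_word n \<mu>"
      and st = "\<lambda>(A, \<mu>). stat (int n ^ 2 + 1) (matrix_mset n A \<mu>)"])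
  show "finite (Borel_index n d)"
    by (rule finite_Borel_index)
  show "A_submodule n d (E_side.Hecke_upper n d)"
    by (rule A_subalgebra_submodule [OF E_side.Hecke_upper_subalgebra])
  show "{x \<otimes>\<^bsub>End_tensor n d\<^esub> y | x y. x \<in> SA_zero n d \<and> y \<in> SA_plus n d} \<subseteq> E_side.Hecke_upper n d"
    using SA_zero_Hecke_upper SA_plus_Hecke_upper E_side.Hecke_upper_subalgebra [of n d] unfolding A_subalgebra_def by blast
  have entry: "entry (free_act n d (E_mon \<beta>s A * one_wt n \<mu>)) u (dom_word n \<nu>) = wt_indicator n \<mu> (dom_word n \<nu>) * cf (Eop v \<beta>s A (monomial (dom_word n \<nu>))) u"
    if "(A, \<mu>) \<in> Borel_index n d" "(B, \<nu>) \<in> Borel_index n d" for A B \<mu> \<nu> u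
    using that \<beta>s(2) by (intro entry_E_one_wt) (auto simp: Borel_index_def dom_word_in_words)
  fix i assume i: "i \<in> Borel_index n d"
  obtain A \<mu> where A: "i = (A, \<mu>)" by (cases i)
  have \<mu>: "\<mu> \<in> Lambda n d"
    using i by (simp add: A Borel_index_def)
  note s = E_side.Eop_sites [OF \<beta>s i [unfolded A]]
  show "(case i of (A, \<mu>) \<Rightarrow> free_act n d (E_mon \<beta>s A * one_wt n \<mu>)) \<in> {x \<otimes>\<^bsub>End_tensor n d\<^esub> y | x y. x \<in> SA_zero n d \<and> y \<in> SA_plus n d}"
    using E_one_wt_in_product [OF \<beta>s, of A \<mu>] i by (simp add: A)
  show "(case i of (A, \<mu>) \<Rightarrow> block_word n A \<mu>) \<in> words n d" "(case i of (A, \<mu>) \<Rightarrow> dom_word n \<mu>) \<in> words n d"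
    using s(1) dom_word_in_words [OF \<mu>] by (simp_all add: A)
  show "Laurent_unit (entry (case i of (A, \<mu>) \<Rightarrow> free_act n d (E_mon \<beta>s A * one_wt n \<mu>)) (case i of (A, \<mu>) \<Rightarrow> block_word n A \<mu>) (case i of (A, \<mu>) \<Rightarrow> dom_word n \<mu>))"
    using s(3) i by (simp add: A entry wt_indicator_dom_word [OF \<mu> \<mu>])
  fix k assume k: "k \<in> Borel_index n d"
  obtain B \<nu> where B: "k = (B, \<nu>)" by (cases k)
  show "k = i \<or> (case k of (A, \<mu>) \<Rightarrow> stat (int n ^ 2 + 1) (matrix_mset n A \<mu>)) < (case i of (A, \<mu>) \<Rightarrow> stat (int n ^ 2 + 1) (matrix_mset n A \<mu>))"
    if "entry (case i of (A, \<mu>) \<Rightarrow> free_act n d (E_mon \<beta>s A * one_wt n \<mu>)) (case k of (A, \<mu>) \<Rightarrow> block_word n A \<mu>) (case k of (A, \<mu>) \<Rightarrow> dom_word n \<mu>) \<noteq> 0"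
    using E_side.Eop_basis_facts [OF \<beta>s, of A \<mu> d B \<nu>] that i k by (simp add: A B entry)
next
  fix f u w assume "f \<in> E_side.Hecke_upper n d" "u \<in> words n d" "w \<in> words n d"
  then show "entry f u w \<in> Laurent"
    by (simp add: E_side.Hecke_upper_def)
next
  fix f u w
  assume f: "f \<in> E_side.Hecke_upper n d" and z: "\<And>i. i \<in> Borel_index n d \<Longrightarrow> entry f (case i of (A, \<mu>) \<Rightarrow> block_word n A \<mu>) (case i of (A, \<mu>) \<Rightarrow> dom_word n \<mu>) = 0"
    and "u \<in> words n d" and w: "w \<in> words n d"
  have "entry f (block_word n A \<mu>) (dom_word n \<mu>) = 0" if "(A, \<mu>) \<in> Borel_index n d" for A \<mu>
    using z [OF that] by simp
  then show "entry f u w = 0"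
    using E_side.Hecke_upper_zero_sites [OF f _ w] by simp
qed

section \<open>The lower Borel algebra\<close>

text \<open>
  Reversing words and transposing turns the action of \<open>X\<^sub>-\<^sub>\<alpha>\<close> into that of \<open>X\<^sub>\<alpha>\<close> with \<open>v\<close> replaced by \<open>v\<^sup>-\<^sup>1\<close>.
\<close>

definition transposed :: "nat \<Rightarrow> nat \<Rightarrow> ugen free \<Rightarrow> (nat free \<Rightarrow> nat free) \<Rightarrow> bool" where
  "transposed n d x G \<longleftrightarrow> x \<in> carrier (Ufree n) \<and> lin G \<and> (\<forall>t\<in>tensor n d. G t \<in> tensor n d) \<and>
     (\<forall>u\<in>words n d. \<forall>w\<in>words n d. cf (full_act x (monomial w)) u = cf (G (monomial (rev u))) (rev w))"

lemma sum_words_rev: "(\<Sum>x\<in>words n d. f (rev x)) = (\<Sum>x\<in>words n d. f x)"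
  by (rule sum.reindex_bij_witness [of _ rev rev]) auto

text \<open>Transposition reverses products; reversing words is a bijection of
  \<open>words n d\<close>, so it only reindexes the intermediate sum.\<close>

lemma transposed_mult:
  assumes "transposed n d x G" "transposed n d y H"
  shows "transposed n d (x * y) (\<lambda>t. H (G t))"
  unfolding transposed_def
proof (intro conjI ballI)
  have x: "x \<in> carrier (Ufree n)" "lin G" "\<And>t. t \<in> tensor n d \<Longrightarrow> G t \<in> tensor n d"
    "\<And>u w. u \<in> words n d \<Longrightarrow> w \<in> words n d \<Longrightarrow> cf (full_act x (monomial w)) u = cf (G (monomial (rev u))) (rev w)"
    using assms(1) by (auto simp: transposed_def)
  have y: "y \<in> carrier (Ufree n)" "lin H" "\<And>t. t \<in> tensor n d \<Longrightarrow> H t \<in> tensor n d"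
    "\<And>u w. u \<in> words n d \<Longrightarrow> w \<in> words n d \<Longrightarrow> cf (full_act y (monomial w)) u = cf (H (monomial (rev u))) (rev w)"
    using assms(2) by (auto simp: transposed_def)
  show "x * y \<in> carrier (Ufree n)" "lin (\<lambda>t. H (G t))"
    using x y by (auto intro: Ufree_closed lin_comp)
  show "t \<in> tensor n d \<Longrightarrow> H (G t) \<in> tensor n d" for t
    using x y by simp
  fix u w assume u: "u \<in> words n d" and w: "w \<in> words n d"
  have "cf (full_act (x * y) (monomial w)) u = cf (full_act x (full_act y (monomial w))) u"
    by (simp add: full_act_mult)
  also have "\<dots> = (\<Sum>z\<in>words n d. cf (full_act y (monomial w)) z * cf (full_act x (monomial z)) u)"
    by (rule cf_lin_words [OF lin_full_act full_act_tensor [OF y(1) monomial_tensor [OF w]]])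
  also have "\<dots> = (\<Sum>z\<in>words n d. cf (H (monomial (rev z))) (rev w) * cf (G (monomial (rev u))) (rev z))"
    using x(4) y(4) u w by (intro sum.cong) auto
  also have "\<dots> = (\<Sum>z\<in>words n d. cf (G (monomial (rev u))) z * cf (H (monomial z)) (rev w))"
    unfolding sum_words_rev [of "\<lambda>z. cf (H (monomial z)) (rev w) * cf (G (monomial (rev u))) z"]
    by (simp add: mult.commute)
  also have "\<dots> = cf (H (G (monomial (rev u)))) (rev w)"
    using u by (intro cf_lin_words [symmetric] y(2) x(3) monomial_tensor) simp
  finally show "cf (full_act (x * y) (monomial w)) u = cf (H (G (monomial (rev u)))) (rev w)" .
qed

lemma transposed_diff: "transposed n d x G \<Longrightarrow> transposed n d y H \<Longrightarrow> transposed n d (x - y) (\<lambda>t. G t - H t)"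
  using tensor_closed(2) [of "G _" n d "- H _"] tensor_closed(4)
  by (auto simp: transposed_def full_act_left cf_simps intro!: Ufree_closed lin_diff)

lemma transposed_cst: "transposed n d x G \<Longrightarrow> transposed n d (cst c * x) (\<lambda>t. cst c * G t)"
  by (auto simp: transposed_def full_act_left cf_simps intro!: Ufree_closed lin_cmult tensor_closed)

lemma transposed_one: "transposed n d 1 (\<lambda>t. t)"
  by (auto simp: transposed_def full_act_one cf_monomial lin_id intro!: Ufree_closed)

lemma transposed_power: "transposed n d x G \<Longrightarrow> transposed n d (x ^ m) (G ^^ m)"
proof (induct m)
  case 0
  then show ?case using transposed_one by (simp add: id_def)
next
  case (Suc m)
  then have "transposed n d (x * x ^ m) (\<lambda>t. (G ^^ m) (G t))"
    by (intro transposed_mult)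
  then show ?case
    by (simp add: funpow_Suc_right comp_def del: funpow.simps)
qed

text \<open>Reversal turns the first letter into the last one, while \<open>Rop\<close> peels from
  the front. For a simple root there is no intermediate letter, so the coproduct E \<otimes> K + 1
  \<otimes> E can also be split before the last factor.\<close>

lemma E_snoc:
  assumes "length u = length w"
  shows "cf (Rop q i (Suc i) (monomial (w @ [c]))) (u @ [e]) =
    (if c = e then kap q i (Suc i) c * cf (Rop q i (Suc i) (monomial w)) u else 0) +
    (if c = Suc i \<and> e = i \<and> w = u then 1 else 0)"
  using assms
proof (induct w u rule: list_induct2')
  case 1
  then show ?case by (auto simp: cf_Rop_Cons cf_Rop_Nil kprod_def)
next
  case (4 x w y u)
  then show ?case
    by (auto simp: cf_Rop_Cons kprod_append) (auto simp: kprod_def)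
qed auto

lemma F_Cons: "cf (opF i (monomial (a # w))) (c # u) =
    (if i = a \<and> c = Suc i \<and> w = u then 1 else 0) +
    (if a = c then kap (inverse v) i (Suc i) a * cf (opF i (monomial w)) u else 0)"
  by (auto simp: monomial_Cons opF_gen kap_def cf_simps cf_gen_Cons cf_monomial)

lemma F_transpose:
  "length u = length w \<Longrightarrow> cf (opF i (monomial w)) u = cf (Rop (inverse v) i (Suc i) (monomial (rev u))) (rev w)"
proof (induct u w rule: list_induct2)
  case Nil
  then show ?case by (simp add: monomial_Nil Rop_one)
next
  case (Cons c u a w)
  have "cf (Rop (inverse v) i (Suc i) (monomial (rev (c # u)))) (rev (a # w)) =
    (if c = a then kap (inverse v) i (Suc i) c * cf (opF i (monomial w)) u else 0) +
    (if c = Suc i \<and> a = i \<and> u = w then 1 else 0)"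
    using Cons by (simp add: E_snoc)
  then show ?case
    unfolding F_Cons by (cases "c = a"; cases "u = w") auto
qed

lemma transposed_F: "(i, Suc i) \<in> Phi_pos n \<Longrightarrow> transposed n d (UF i) (Rop (inverse v) i (Suc i))"
  unfolding transposed_def
  by (auto intro!: Ufree_closed lin_Rop Rop_tensor F_transpose simp: full_act_gen words_def)
     (auto simp: ugens_def Phi_pos_def)

text \<open>Reversing products turns v X F - F X into v (E R - v^-1 R E), which is
  \<open>Rop_step\<close> for q = v^-1 up to the accumulated power of \<open>v\<close>.\<close>

lemma transposed_Xneg: "(i, j) \<in> Phi_pos n \<Longrightarrow> transposed n d (Xneg i j) (\<lambda>t. cst (v ^ (j - i - 1)) * Rop (inverse v) i j t)"
proof (induct i j rule: Xneg.induct)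
  case (1 i j)
  show ?case
  proof (cases "j \<le> i + 1")
    case True
    then have "j = Suc i"
      using "1.prems" by (auto simp: Phi_pos_def)
    then show ?thesis
      using transposed_F [of i n d] "1.prems" by (simp add: Xneg.simps)
  next
    case False
    define e where "e = j - Suc (Suc i)"
    have j: "j - i - 1 = Suc e"
      using False by (simp add: e_def)
    have ij: "(Suc i, j) \<in> Phi_pos n" "(i, Suc i) \<in> Phi_pos n"
      using "1.prems" False by (auto simp: Phi_pos_def)
    have IH: "transposed n d (Xneg (Suc i) j) (\<lambda>t. cst (v ^ e) * Rop (inverse v) (Suc i) j t)"
      using "1.hyps"(1) [OF False] ij(1) by (simp add: e_def)
    have "transposed n d (cst v * (Xneg (Suc i) j * UF i) - UF i * Xneg (Suc i) j)
       (\<lambda>t. cst v * Rop (inverse v) i (Suc i) (cst (v ^ e) * Rop (inverse v) (Suc i) j t)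
        - cst (v ^ e) * Rop (inverse v) (Suc i) j (Rop (inverse v) i (Suc i) t))"
      by (intro transposed_diff transposed_cst transposed_mult [OF IH transposed_F [OF ij(2)]] transposed_mult [OF transposed_F [OF ij(2)] IH])
    then have "transposed n d (Xneg i j) (\<lambda>t. cst v * Rop (inverse v) i (Suc i) (cst (v ^ e) * Rop (inverse v) (Suc i) j t)
        - cst (v ^ e) * Rop (inverse v) (Suc i) j (Rop (inverse v) i (Suc i) t))"
      using False by (subst Xneg.simps) simp
    moreover have "cst v * Rop (inverse v) i (Suc i) (cst (v ^ e) * Rop (inverse v) (Suc i) j t)
        - cst (v ^ e) * Rop (inverse v) (Suc i) j (Rop (inverse v) i (Suc i) t) = cst (v ^ (j - i - 1)) * Rop (inverse v) i j t" for t
    proof -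
      have "v * v ^ e * inverse v = v ^ e"
        by simp
      note e = this
      show ?thesis
        using False unfolding j
        by (simp add: Rop_step [of "inverse v" i j] linD [OF lin_Rop] right_diff_distrib cst_cst e)
    qed
    ultimately show ?thesis by simp
  qed
qed

lemma transposed_Xneg_div: "(i, j) \<in> Phi_pos n \<Longrightarrow> transposed n d (Xneg_div (i, j) m) (Xop (inverse v) i j m)"
proof -
  assume ij: "(i, j) \<in> Phi_pos n"
  have "transposed n d (Xneg_div (i, j) m) (\<lambda>t. cst (1 / qfact m) * ((\<lambda>t. cst (v ^ (j - i - 1)) * Rop (inverse v) i j t) ^^ m) t)"
    unfolding Xneg_div_def fst_conv snd_conv by (intro transposed_cst transposed_power transposed_Xneg ij)
  moreover have "(\<lambda>t. cst (1 / qfact m) * ((\<lambda>t. cst (v ^ (j - i - 1)) * Rop (inverse v) i j t) ^^ m) t) = Xop (inverse v) i j m"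
    by (simp add: fun_eq_iff Xop_def funpow_cst [OF lin_Rop] cst_cst flip: power_mult)
  ultimately show ?thesis by simp
qed

lemma Eop_append: "Eop q (\<beta>s @ \<gamma>s) A t = Eop q \<beta>s A (Eop q \<gamma>s A t)"
  by (simp add: Eop_def)

text \<open>The roots appear in reverse order, which is another admissible enumeration.\<close>

lemma transposed_F_mon: "set \<beta>s \<subseteq> Phi_pos n \<Longrightarrow> transposed n d (F_mon \<beta>s C) (Eop (inverse v) (rev \<beta>s) C)"
proof (induct \<beta>s)
  case Nil
  then show ?case using transposed_one by (simp add: F_mon_def Eop_def [abs_def])
next
  case (Cons \<alpha> \<beta>s)
  obtain i j where ij: "\<alpha> = (i, j)" by (cases \<alpha>)
  have "transposed n d (Xneg_div (i, j) (C \<alpha>) * F_mon \<beta>s C) (\<lambda>t. Eop (inverse v) (rev \<beta>s) C (Xop (inverse v) i j (C \<alpha>) t))"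
    using Cons by (intro transposed_mult transposed_Xneg_div) (auto simp: ij)
  then show ?case
    by (simp add: F_mon_def ij Eop_append Eop_simps [abs_def])
qed

text \<open>The transposed partner is only asked to exist; for a product it is the product of the
  partners in reverse order.\<close>

definition Hecke_lower :: "nat \<Rightarrow> nat \<Rightarrow> (nat free \<Rightarrow> nat free) set" where
  "Hecke_lower n d = {f \<in> carrier (End_tensor n d). \<exists>g\<in>F_side.Hecke_upper n d. \<forall>u\<in>words n d. \<forall>w\<in>words n d. entry f u w = entry g (rev w) (rev u)}"

lemma Hecke_lower_subalgebra: "A_subalgebra (End_tensor n d) (Hecke_lower n d)"
  unfolding A_subalgebra_def
proof (intro conjI ballI)
  have N: "\<one>\<^bsub>End_tensor n d\<^esub> \<in> F_side.Hecke_upper n d"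
    "\<And>x y. x \<in> F_side.Hecke_upper n d \<Longrightarrow> y \<in> F_side.Hecke_upper n d \<Longrightarrow> x \<oplus>\<^bsub>End_tensor n d\<^esub> y \<in> F_side.Hecke_upper n d"
    "\<And>x y. x \<in> F_side.Hecke_upper n d \<Longrightarrow> y \<in> F_side.Hecke_upper n d \<Longrightarrow> x \<otimes>\<^bsub>End_tensor n d\<^esub> y \<in> F_side.Hecke_upper n d"
    "\<And>c x. c \<in> Laurent \<Longrightarrow> x \<in> F_side.Hecke_upper n d \<Longrightarrow> c \<odot>\<^bsub>End_tensor n d\<^esub> x \<in> F_side.Hecke_upper n d"
    "\<And>x. x \<in> F_side.Hecke_upper n d \<Longrightarrow> x \<in> carrier (End_tensor n d)"
    using F_side.Hecke_upper_subalgebra [of n d] by (auto simp: A_subalgebra_def)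
  show "Hecke_lower n d \<subseteq> carrier (End_tensor n d)"
    by (auto simp: Hecke_lower_def)
  show "\<one>\<^bsub>End_tensor n d\<^esub> \<in> Hecke_lower n d"
    unfolding Hecke_lower_def mem_Collect_eq using N(5) [OF N(1)]
    by (intro conjI bexI [OF _ N(1)]) (auto simp: entry_ops)
  fix f assume "f \<in> Hecke_lower n d"
  then obtain f' where f: "f \<in> carrier (End_tensor n d)" "f' \<in> F_side.Hecke_upper n d"
    "\<And>u w. u \<in> words n d \<Longrightarrow> w \<in> words n d \<Longrightarrow> entry f u w = entry f' (rev w) (rev u)"
    by (auto simp: Hecke_lower_def)
  {
    fix g assume "g \<in> Hecke_lower n d"
    then obtain g' where g: "g \<in> carrier (End_tensor n d)" "g' \<in> F_side.Hecke_upper n d"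
      "\<And>u w. u \<in> words n d \<Longrightarrow> w \<in> words n d \<Longrightarrow> entry g u w = entry g' (rev w) (rev u)"
      by (auto simp: Hecke_lower_def)
    show "f \<oplus>\<^bsub>End_tensor n d\<^esub> g \<in> Hecke_lower n d"
      unfolding Hecke_lower_def mem_Collect_eq
      using f g by (intro conjI bexI [OF _ N(2) [OF f(2) g(2)]] End_closed) (auto simp: entry_ops)
    have "entry (f \<otimes>\<^bsub>End_tensor n d\<^esub> g) u w = entry (g' \<otimes>\<^bsub>End_tensor n d\<^esub> f') (rev w) (rev u)"
      if u: "u \<in> words n d" and w: "w \<in> words n d" for u w
    proof -
      have "entry (f \<otimes>\<^bsub>End_tensor n d\<^esub> g) u w = (\<Sum>x\<in>words n d. entry f' (rev x) (rev u) * entry g' (rev w) (rev x))"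
        unfolding entry_mult [OF f(1) g(1) w] using f(3) g(3) u w by (intro sum.cong) auto
      also have "\<dots> = (\<Sum>x\<in>words n d. entry g' (rev w) x * entry f' x (rev u))"
        unfolding sum_words_rev [of "\<lambda>x. entry f' x (rev u) * entry g' (rev w) x"] by (simp add: mult.commute)
      finally show ?thesis
        using entry_mult [OF N(5) [OF g(2)] N(5) [OF f(2)], of "rev u" "rev w"] u by simp
    qed
    then show "f \<otimes>\<^bsub>End_tensor n d\<^esub> g \<in> Hecke_lower n d"
      unfolding Hecke_lower_def mem_Collect_eq
      using f g by (intro conjI bexI [OF _ N(3) [OF g(2) f(2)]] End_closed) auto
  }
  fix c assume c: "c \<in> Laurent"
  show "c \<odot>\<^bsub>End_tensor n d\<^esub> f \<in> Hecke_lower n d"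
    unfolding Hecke_lower_def mem_Collect_eq
    using f by (intro conjI bexI [OF _ N(4) [OF c f(2)]] End_closed) (auto simp: entry_ops)
qed

lemma transposed_Hecke_lower:
  assumes "transposed n d x G" "restrict G (tensor n d) \<in> F_side.Hecke_upper n d"
  shows "free_act n d x \<in> Hecke_lower n d"
  using assms unfolding Hecke_lower_def transposed_def
  by (auto simp: free_act_End entry_free_act monomial_tensor intro!: bexI [OF _ assms(2)])

lemma SA_zero_Hecke_lower: "SA_zero n d \<subseteq> Hecke_lower n d"
proof (rule SA_zero_least [OF Hecke_lower_subalgebra])
  fix x h
  assume x: "x \<in> carrier (Ufree n)" and h: "\<And>w. w \<in> words n d \<Longrightarrow> full_act x (monomial w) = cst (h (mset w)) * monomial w"
    and L: "\<And>w. w \<in> words n d \<Longrightarrow> h (mset w) \<in> Laurent"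
  have "transposed n d x (full_act x)"
    unfolding transposed_def using x h by (auto simp: lin_full_act full_act_tensor cf_simps cf_monomial)
  moreover have "restrict (full_act x) (tensor n d) \<in> F_side.Hecke_upper n d"
    by (rule F_side.Hecke_upper_diag [OF lin_full_act h L])
  ultimately show "free_act n d x \<in> Hecke_lower n d"
    by (rule transposed_Hecke_lower)
qed

lemma SA_minus_Hecke_lower: "SA_minus n d \<subseteq> Hecke_lower n d"
proof (rule SA_minus_least [OF Hecke_lower_subalgebra])
  fix \<alpha> m assume "\<alpha> \<in> Phi_pos n"
  moreover obtain i j where "\<alpha> = (i, j)" by (cases \<alpha>)
  ultimately show "free_act n d (Xneg_div \<alpha> m) \<in> Hecke_lower n d"
    using transposed_Hecke_lower [OF transposed_Xneg_div F_side.Hecke_upper_Xop] by simp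
qed

text \<open>Transposition exchanges the two words of each site, and the idempotent, which acts on
  the output, then selects the weight of the descending word. Since it already stands on the left,
  membership in S^0 S^- is immediate.\<close>

theorem Borel_le_basis:
  assumes \<beta>s: "distinct \<beta>s" "set \<beta>s = Phi_pos n"
  shows "A_basis (End_tensor n d) (Borel_index n d)
           (\<lambda>(C, \<mu>). free_act n d (one_wt n \<mu> * F_mon \<beta>s C)) (Borel_le n d)"
  unfolding Borel_le_def
proof (rule A_basis_triangular [where N = "Hecke_lower n d" and x = "\<lambda>(A, \<mu>). rev (dom_word n \<mu>)" and y = "\<lambda>(A, \<mu>). rev (block_word n A \<mu>)"
      and st = "\<lambda>(A, \<mu>). stat (int n ^ 2 + 1) (matrix_mset n A \<mu>)"])
  have \<beta>s': "distinct (rev \<beta>s)" "set (rev \<beta>s) = Phi_pos n"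
    using \<beta>s by auto
  show "finite (Borel_index n d)"
    by (rule finite_Borel_index)
  show "A_submodule n d (Hecke_lower n d)"
    by (rule A_subalgebra_submodule [OF Hecke_lower_subalgebra])
  show "{x \<otimes>\<^bsub>End_tensor n d\<^esub> y | x y. x \<in> SA_zero n d \<and> y \<in> SA_minus n d} \<subseteq> Hecke_lower n d"
    using SA_zero_Hecke_lower SA_minus_Hecke_lower Hecke_lower_subalgebra [of n d] unfolding A_subalgebra_def by blast
  have entry: "entry (free_act n d (one_wt n \<mu> * F_mon \<beta>s A)) (rev (dom_word n \<nu>)) (rev (block_word n B \<nu>))
      = wt_indicator n \<mu> (dom_word n \<nu>) * cf (Eop (inverse v) (rev \<beta>s) A (monomial (dom_word n \<nu>))) (block_word n B \<nu>)"
    if A: "(A, \<mu>) \<in> Borel_index n d" and B: "(B, \<nu>) \<in> Borel_index n d" for A B \<mu> \<nu>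
  proof -
    have \<mu>: "\<mu> \<in> Lambda n d" and w: "dom_word n \<nu> \<in> words n d"
      using A B by (auto simp: Borel_index_def dom_word_in_words)
    have u: "block_word n B \<nu> \<in> words n d"
      by (rule F_side.Eop_sites(1) [OF \<beta>s' B])
    have "full_act (F_mon \<beta>s A) (monomial (rev (block_word n B \<nu>))) \<in> tensor n d"
      using u \<beta>s(2) by (intro full_act_tensor mon_carrier monomial_tensor) auto
    then have "entry (free_act n d (one_wt n \<mu> * F_mon \<beta>s A)) (rev (dom_word n \<nu>)) (rev (block_word n B \<nu>))
      = wt_indicator n \<mu> (dom_word n \<nu>) * cf (full_act (F_mon \<beta>s A) (monomial (rev (block_word n B \<nu>)))) (rev (dom_word n \<nu>))"
      using u by (simp add: entry_free_act full_act_mult cf_one_wt [OF \<mu>])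
    also have "cf (full_act (F_mon \<beta>s A) (monomial (rev (block_word n B \<nu>)))) (rev (dom_word n \<nu>))
      = cf (Eop (inverse v) (rev \<beta>s) A (monomial (dom_word n \<nu>))) (block_word n B \<nu>)"
      using transposed_F_mon [of \<beta>s n d A] \<beta>s(2) u w by (simp add: transposed_def)
    finally show ?thesis .
  qed
  fix i assume i: "i \<in> Borel_index n d"
  obtain A \<mu> where A: "i = (A, \<mu>)" by (cases i)
  have \<mu>: "\<mu> \<in> Lambda n d"
    using i by (simp add: A Borel_index_def)
  note s = F_side.Eop_sites [OF \<beta>s' i [unfolded A]]
  have "free_act n d (one_wt n \<mu> * F_mon \<beta>s A) = free_act n d (one_wt n \<mu>) \<otimes>\<^bsub>End_tensor n d\<^esub> free_act n d (F_mon \<beta>s A)"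
    using \<beta>s(2) by (intro free_act_mult one_wt_carrier mon_carrier) auto
  then show "(case i of (C, \<mu>) \<Rightarrow> free_act n d (one_wt n \<mu> * F_mon \<beta>s C)) \<in> {x \<otimes>\<^bsub>End_tensor n d\<^esub> y | x y. x \<in> SA_zero n d \<and> y \<in> SA_minus n d}"
    using one_wt_SA_zero [of n d \<mu>] F_mon_SA_minus [of \<beta>s n d A] \<beta>s(2) by (auto simp: A)
  show "(case i of (A, \<mu>) \<Rightarrow> rev (dom_word n \<mu>)) \<in> words n d" "(case i of (A, \<mu>) \<Rightarrow> rev (block_word n A \<mu>)) \<in> words n d"
    using s(1) dom_word_in_words [OF \<mu>] by (simp_all add: A)
  show "Laurent_unit (entry (case i of (C, \<mu>) \<Rightarrow> free_act n d (one_wt n \<mu> * F_mon \<beta>s C)) (case i of (A, \<mu>) \<Rightarrow> rev (dom_word n \<mu>)) (case i of (A, \<mu>) \<Rightarrow> rev (block_word n A \<mu>)))"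
    using s(3) i by (simp add: A entry wt_indicator_dom_word [OF \<mu> \<mu>])
  fix k assume k: "k \<in> Borel_index n d"
  obtain B \<nu> where B: "k = (B, \<nu>)" by (cases k)
  show "k = i \<or> (case k of (A, \<mu>) \<Rightarrow> stat (int n ^ 2 + 1) (matrix_mset n A \<mu>)) < (case i of (A, \<mu>) \<Rightarrow> stat (int n ^ 2 + 1) (matrix_mset n A \<mu>))"
    if "entry (case i of (C, \<mu>) \<Rightarrow> free_act n d (one_wt n \<mu> * F_mon \<beta>s C)) (case k of (A, \<mu>) \<Rightarrow> rev (dom_word n \<mu>)) (case k of (A, \<mu>) \<Rightarrow> rev (block_word n A \<mu>)) \<noteq> 0"
    using F_side.Eop_basis_facts [OF \<beta>s', of A \<mu> d B \<nu>] that i k by (simp add: A B entry)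
next
  fix f u w assume "f \<in> Hecke_lower n d" "u \<in> words n d" "w \<in> words n d"
  then show "entry f u w \<in> Laurent"
    by (auto simp: Hecke_lower_def F_side.Hecke_upper_def)
next
  fix f u w
  assume "f \<in> Hecke_lower n d" and z: "\<And>i. i \<in> Borel_index n d \<Longrightarrow> entry f (case i of (A, \<mu>) \<Rightarrow> rev (dom_word n \<mu>)) (case i of (A, \<mu>) \<Rightarrow> rev (block_word n A \<mu>)) = 0"
    and u: "u \<in> words n d" and w: "w \<in> words n d"
  then obtain g where g: "g \<in> F_side.Hecke_upper n d" "\<And>u w. u \<in> words n d \<Longrightarrow> w \<in> words n d \<Longrightarrow> entry f u w = entry g (rev w) (rev u)"
    by (auto simp: Hecke_lower_def)
  have "entry g (block_word n A \<mu>) (dom_word n \<mu>) = 0" if A: "(A, \<mu>) \<in> Borel_index n d" for A \<mu>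
  proof -
    have "block_word n A \<mu> \<in> words n d" "dom_word n \<mu> \<in> words n d"
      using F_side.Eop_sites(1) [OF _ _ A, of "rev \<beta>s"] \<beta>s A by (auto simp: Borel_index_def dom_word_in_words)
    then show ?thesis
      using z [OF A] g(2) [of "rev (dom_word n \<mu>)" "rev (block_word n A \<mu>)"] by simp
  qed
  then have "g (monomial (rev u)) = 0"
    using u by (intro F_side.Hecke_upper_zero_sites [OF g(1)]) auto
  then show "entry f u w = 0"
    using g(2) [OF u w] by simp
qed

theorem proposition11p3:
  fixes n d :: nat and \<beta>s :: "(nat \<times> nat) list"
  assumes "n \<ge> 1"
    and "distinct \<beta>s" and "set \<beta>s = Phi_pos n"
  shows "A_basis (End_tensor n d) (Borel_index n d)
           (\<lambda>(A, \<mu>). Simg n d (E_mon \<beta>s A * one_wt n \<mu>)) (Borel_ge n d)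
       \<and> A_basis (End_tensor n d) (Borel_index n d)
           (\<lambda>(C, \<mu>). Simg n d (one_wt n \<mu> * F_mon \<beta>s C)) (Borel_le n d)"
proof -
  have "Simg n d (E_mon \<beta>s A * one_wt n \<mu>) = free_act n d (E_mon \<beta>s A * one_wt n \<mu>)"
    "Simg n d (one_wt n \<mu> * F_mon \<beta>s A) = free_act n d (one_wt n \<mu> * F_mon \<beta>s A)" for A \<mu>
    using assms(3) by (auto intro!: Simg_eq Ufree_closed one_wt_carrier mon_carrier)
  then show ?thesis
    using Borel_ge_basis [OF assms(2,3)] Borel_le_basis [OF assms(2,3)] by simp
qed

end
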